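(* Let $\alpha>-1$ and let $\sigma\in\mathcal{B}_2\cap\mathcal{APR}$. If $b\in\mathrm{BMO}^2(\mathbb{R}_+^2)$, then the commutator $[b,P_\alpha]$ is bounded from $L^2_\alpha(\mathbb{R}_+^2,\sigma)$ to $L^2_\alpha(\mathbb{R}_+^2,\sigma)$, and $$\|[b,P_\alpha]\|_{L^2_\alpha(\mathbb{R}_+^2,\sigma)\to L^2_\alpha(\mathbb{R}_+^2,\sigma)}\lesssim\|b\|_{\mathrm{BMO}^2(\mathbb{R}_+^2)},$$ with an implicit constant independent of $b$ (it may depend on $\alpha$ and $\sigma$). Finally, the $\mathcal{APR}$ condition is sharp, in the sense that the conclusion fails for general $\mathcal{B}_2$ weights: there exist a weight $\sigma\in\mathcal{B}_2\setminus\mathcal{APR}$ and a function $b\in\mathrm{BMO}^2(\mathbb{R}_+^2)$ such that $[b,P_\alpha]$ is not bounded on $L^2_\alpha(\mathbb{R}_+^2,\sigma)$.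
   Context: $\mathbb{R}_+^2=\{z\in\mathbb{C}:\operatorname{Im}z>0\}$, $dA=dx\,dy$, and $dA_\alpha(z)=\frac1\pi(\alpha+1)(2\operatorname{Im}z)^\alpha dA(z)$, with $\alpha>-1$ fixed. A weight is a measurable a.e. positive function on $\mathbb{R}_+^2$; $L^2_\alpha(\mathbb{R}_+^2,\sigma)$ is the space of measurable $f$ with $\int|f|^2\sigma\,dA_\alpha<\infty$. Functions are complex valued. $P_\alpha f(z)=i^{2+\alpha}\int_{\mathbb{R}_+^2}\frac{f(w)}{(z-\overline w)^{2+\alpha}}dA_\alpha(w)$ (principal branch; $z-\overline w$ lies in the upper half plane). The commutator is $[b,P_\alpha]f=b\,P_\alpha f-P_\alpha(bf)$, initially defined for bounded compactly supported $f$; "bounded" means that it extends to a bounded operator. For an interval $I\subset\mathbb{R}$, $Q_I=\{x+iy: x\in I,\ y\in(0,|I|)\}$ and $Q_I^{up}=\{x+iy: x\in I,\ y\in(|I|/2,|I|)\}$. $\mathcal{D}=\mathcal{D}^1\cup\mathcal{D}^2$, where $\mathcal{D}^1,\mathcal{D}^2$ are two fixed adjacent dyadic systems of intervals on $\mathbb{R}$, i.e. satisfying the $1/3$-trick: there is an absolute constant $C$ such that every bounded interval $I\subset\mathbb{R}$ is contained in some $J\in\mathcal{D}$ with $|J|\le C|I|$. $\mathcal{B}_2$: weights $\sigma$ with $\sup_{I\in\mathcal{D}}\Big(\frac1{A_\alpha(Q_I)}\int_{Q_I}\sigma\,dA_\alpha\Big)\Big(\frac1{A_\alpha(Q_I)}\int_{Q_I}\sigma^{-1}\,dA_\alpha\Big)<\infty$.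 $\mathcal{APR}$ (Aleman–Pott–Reguera weights, or weights of bounded hyperbolic oscillation): weights $\sigma$ for which there is $C_\sigma>0$ such that for every interval $I\subset\mathbb{R}$ and all $z,w\in Q_I^{up}$, $C_\sigma^{-1}\sigma(w)\le\sigma(z)\le C_\sigma\sigma(w)$. $\mathrm{BMO}^2(\mathbb{R}_+^2)$: functions $b\in L^2(\mathbb{R}_+^2)$ (with respect to $dA$) with $\|b\|_{\mathrm{BMO}^2(\mathbb{R}_+^2)}=\sup_{I\in\mathcal{D}}\Big(\frac1{A(Q_I)}\int_{Q_I}|b-b_{Q_I}|^2dA\Big)^{1/2}<\infty$, where here $A(Q_I)$ and the average $b_{Q_I}$ are taken with respect to Lebesgue measure $dA$. *)

theory Defs
  imports "HOL-Analysis.Analysis" "HOL-Library.Disjoint_Sets"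
begin

text \<open>Functions on the upper half plane are total functions on the type complex, and only their
  values on the half plane matter. Measurable means Lebesgue measurable.\<close>

definition uhp :: "complex set" where
  "uhp = {z. 0 < Im z}"

definition dA :: "complex measure" where
  "dA = lebesgue_on uhp"

definition dA\<^sub>w :: "real \<Rightarrow> complex measure" where
  "dA\<^sub>w \<alpha> = density dA (\<lambda>z. ennreal ((1 / pi) * (\<alpha> + 1) * (2 * Im z) powr \<alpha>))"


text \<open>Intervals are bounded and nondegenerate, with or without their endpoints.\<close>

definition bdd_interval :: "real set \<Rightarrow> bool" where
  "bdd_interval I \<longleftrightarrow> is_interval I \<and> bounded I \<and> interior I \<noteq> {}"

abbreviation len :: "real set \<Rightarrow> real" where
  "len I \<equiv> measure lborel I"

definition carleson_box :: "real set \<Rightarrow> complex set" where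
  "carleson_box I = {z. Re z \<in> I \<and> 0 < Im z \<and> Im z < len I}"

definition upper_box :: "real set \<Rightarrow> complex set" where
  "upper_box I = {z. Re z \<in> I \<and> len I / 2 < Im z \<and> Im z < len I}"

text \<open>Generation \<open>k\<close> of a dyadic system partitions the line into half-open intervals of length
  \<open>2\<^sup>-\<^sup>k\<close>, and each generation refines the previous one; the offsets of the generations
  are otherwise arbitrary.\<close>

definition dyadic_system :: "real set set \<Rightarrow> bool" where
  "dyadic_system D \<longleftrightarrow> (\<exists>G :: int \<Rightarrow> real set set. D = (\<Union>k. G k) \<and>
     (\<forall>k. partition_on UNIV (G k) \<and>
          (\<forall>I \<in> G k. \<exists>a. I = {a ..< a + 2 powi (- k)}) \<and>
          (\<forall>J \<in> G (k + 1). \<exists>I \<in> G k. J \<subseteq> I)))"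

definition adjacent_dyadic_systems :: "real set set \<Rightarrow> real set set \<Rightarrow> bool" where
  "adjacent_dyadic_systems D1 D2 \<longleftrightarrow> dyadic_system D1 \<and> dyadic_system D2 \<and>
     (\<exists>C. \<forall>I. bdd_interval I \<longrightarrow> (\<exists>J \<in> D1 \<union> D2. I \<subseteq> J \<and> len J \<le> C * len I))"


definition weight :: "(complex \<Rightarrow> real) \<Rightarrow> bool" where
  "weight \<sigma> \<longleftrightarrow> \<sigma> \<in> borel_measurable dA \<and> (AE z in dA. 0 < \<sigma> z)"

text \<open>The averages are taken in the extended nonnegative reals, so that a non-integrable
  weight is not mistaken for one of integral zero.\<close>

definition box_avg :: "real \<Rightarrow> (complex \<Rightarrow> real) \<Rightarrow> real set \<Rightarrow> ennreal" where
  "box_avg \<alpha> \<sigma> I =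
     (\<integral>\<^sup>+ z \<in> carleson_box I. ennreal (\<sigma> z) \<partial>dA\<^sub>w \<alpha>) / emeasure (dA\<^sub>w \<alpha>) (carleson_box I)"

definition B2 :: "real set set \<Rightarrow> real \<Rightarrow> (complex \<Rightarrow> real) set" where
  "B2 D \<alpha> = {\<sigma>. weight \<sigma> \<and>
     (SUP I \<in> D. box_avg \<alpha> \<sigma> I * box_avg \<alpha> (\<lambda>z. inverse (\<sigma> z)) I) < \<infinity>}"

definition APR :: "(complex \<Rightarrow> real) set" where
  "APR = {\<sigma>. weight \<sigma> \<and>
     (\<exists>C>0. \<forall>I. bdd_interval I \<longrightarrow> (\<forall>z \<in> upper_box I. \<forall>w \<in> upper_box I.
        inverse C * \<sigma> w \<le> \<sigma> z \<and> \<sigma> z \<le> C * \<sigma> w))}"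


definition L2w :: "real \<Rightarrow> (complex \<Rightarrow> real) \<Rightarrow> (complex \<Rightarrow> complex) set" where
  "L2w \<alpha> \<sigma> = {f \<in> borel_measurable dA. (\<integral>\<^sup>+ z. ennreal ((cmod (f z))\<^sup>2 * \<sigma> z) \<partial>dA\<^sub>w \<alpha>) < \<infinity>}"

definition L2w_norm :: "real \<Rightarrow> (complex \<Rightarrow> real) \<Rightarrow> (complex \<Rightarrow> complex) \<Rightarrow> real" where
  "L2w_norm \<alpha> \<sigma> f = sqrt (\<integral>z. (cmod (f z))\<^sup>2 * \<sigma> z \<partial>dA\<^sub>w \<alpha>)"


definition box_mean :: "(complex \<Rightarrow> complex) \<Rightarrow> real set \<Rightarrow> complex" where
  "box_mean b I = (LINT z:carleson_box I|dA. b z) / of_real (measure dA (carleson_box I))"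

definition box_osc :: "(complex \<Rightarrow> complex) \<Rightarrow> real set \<Rightarrow> real" where
  "box_osc b I = sqrt ((LINT z:carleson_box I|dA. (cmod (b z - box_mean b I))\<^sup>2)
                        / measure dA (carleson_box I))"

definition BMO2 :: "real set set \<Rightarrow> (complex \<Rightarrow> complex) set" where
  "BMO2 D = {b \<in> borel_measurable dA. (\<integral>\<^sup>+ z. ennreal ((cmod (b z))\<^sup>2) \<partial>dA) < \<infinity> \<and>
                bdd_above (box_osc b ` D)}"

definition BMO2_norm :: "real set set \<Rightarrow> (complex \<Rightarrow> complex) \<Rightarrow> real" where
  "BMO2_norm D b = (SUP I \<in> D. box_osc b I)"


definition bergman_proj :: "real \<Rightarrow> (complex \<Rightarrow> complex) \<Rightarrow> complex \<Rightarrow> complex" where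
  "bergman_proj \<alpha> f z = \<i> powr complex_of_real (2 + \<alpha>) *
     (\<integral>w. f w / (z - cnj w) powr complex_of_real (2 + \<alpha>) \<partial>dA\<^sub>w \<alpha>)"

definition commutator ::
  "(complex \<Rightarrow> complex) \<Rightarrow> real \<Rightarrow> (complex \<Rightarrow> complex) \<Rightarrow> complex \<Rightarrow> complex" where
  "commutator b \<alpha> f = (\<lambda>z. b z * bergman_proj \<alpha> f z - bergman_proj \<alpha> (\<lambda>w. b w * f w) z)"

definition bdd_cpt_supp :: "(complex \<Rightarrow> complex) set" where
  "bdd_cpt_supp = {f \<in> borel_measurable dA. (\<exists>M. \<forall>z \<in> uhp. cmod (f z) \<le> M) \<and>
     (\<exists>K. compact K \<and> K \<subseteq> uhp \<and> (\<forall>z \<in> uhp - K. f z = 0))}"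


text \<open>Elements of the \<open>L\<^sup>2\<close> space are represented by functions, so linearity and the
  extension property hold almost everywhere. Linearity and boundedness together imply that \<open>T\<close>
  respects almost everywhere equality.\<close>

definition bounded_op_on_L2w ::
  "real \<Rightarrow> (complex \<Rightarrow> real) \<Rightarrow> ((complex \<Rightarrow> complex) \<Rightarrow> complex \<Rightarrow> complex) \<Rightarrow> bool" where
  "bounded_op_on_L2w \<alpha> \<sigma> T \<longleftrightarrow>
     (\<forall>f \<in> L2w \<alpha> \<sigma>. T f \<in> L2w \<alpha> \<sigma>) \<and>
     (\<forall>f \<in> L2w \<alpha> \<sigma>. \<forall>g \<in> L2w \<alpha> \<sigma>. \<forall>c d. AE z in dA.
        T (\<lambda>w. c * f w + d * g w) z = c * T f z + d * T g z) \<and>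
     (\<exists>C. \<forall>f \<in> L2w \<alpha> \<sigma>. L2w_norm \<alpha> \<sigma> (T f) \<le> C * L2w_norm \<alpha> \<sigma> f)"

definition bounded_extension ::
  "real \<Rightarrow> (complex \<Rightarrow> real) \<Rightarrow> ((complex \<Rightarrow> complex) \<Rightarrow> complex \<Rightarrow> complex) \<Rightarrow>
   ((complex \<Rightarrow> complex) \<Rightarrow> complex \<Rightarrow> complex) \<Rightarrow> bool" where
  "bounded_extension \<alpha> \<sigma> S T \<longleftrightarrow> bounded_op_on_L2w \<alpha> \<sigma> T \<and>
     (\<forall>f \<in> bdd_cpt_supp. AE z in dA. T f z = S f z)"

definition L2w_opnorm ::
  "real \<Rightarrow> (complex \<Rightarrow> real) \<Rightarrow> ((complex \<Rightarrow> complex) \<Rightarrow> complex \<Rightarrow> complex) \<Rightarrow> real" where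
  "L2w_opnorm \<alpha> \<sigma> T = (SUP f \<in> {f \<in> L2w \<alpha> \<sigma>. L2w_norm \<alpha> \<sigma> f \<le> 1}. L2w_norm \<alpha> \<sigma> (T f))"

end

theory Submission
  imports Defs
begin

text \<open>The commutator is the integral operator with kernel \<open>(b z - b w) / (z - cnj w) powr (2 + \<alpha>)\<close>
(up to a unimodular constant), and its boundedness needs no cancellation: already the operator with
the absolute value of this kernel is bounded. Cut each Carleson box over a dyadic interval \<open>I\<close> into
horizontal layers, layer \<open>j\<close> being the part at heights between \<open>len I / 2 ^ (j + 1)\<close> and
\<open>len I / 2 ^ j\<close>. By the one-third trick any two points \<open>z\<close>, \<open>w\<close> lie in layers \<open>j\<close> and \<open>k\<close> of a
common box whose size is comparable with \<open>cmod (z - cnj w)\<close> (\<open>kernel_cover\<close>), so the kernel is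
dominated by a multiple of \<open>cmod (b z - b w)\<close> divided by the measure of that box on the block
\<open>layer j I \<times> layer k I\<close>. For fixed \<open>(j, k)\<close> these blocks have bounded overlap. Hence it is enough
to bound the weighted Hilbert--Schmidt norm of a block by a summable quantity in \<open>(j, k)\<close>
(\<open>block_schur_test\<close>, two applications of the Cauchy--Schwarz inequality).

That norm decays geometrically. The \<open>B2\<close> condition and the Cauchy--Schwarz inequality show that the
top layer of a box carries a fixed proportion of the mass of \<open>\<sigma>\<close> and of its inverse, so the
mass of layer \<open>j\<close> is at most \<open>\<delta> ^ j\<close> times that of the box, with \<open>\<delta> < 1\<close> (\<open>layer_decay\<close>).
The means of \<open>b\<close> over a box and over one of its halves differ by a multiple of the BMO norm,
so on layer \<open>j\<close> the deviation of \<open>b\<close> from its mean over the whole box grows only linearly in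
\<open>j\<close>. The APR condition makes the weight essentially constant on each top layer, and
therefore this unweighted control of \<open>b\<close> turns into a weighted one (\<open>weighted_layer_osc\<close>).
Polynomial growth against geometric decay is summable (\<open>commutator_kernel_bound\<close>).

Without APR the weight may have a local singularity inside the half plane. There \<open>b\<close> is only
locally square integrable, and \<open>\<sigma>\<close> can be chosen integrable with \<open>b\<close> outside \<open>L\<^sup>2(\<sigma>)\<close>
near the singularity. For a function \<open>f\<close> supported away from it, the commutator is there the
product of \<open>b\<close> with the Bergman projection of \<open>f\<close>, which is bounded below
(\<open>bergman_proj_indicator_lower_bound\<close>), so the commutator leaves \<open>L\<^sup>2(\<sigma>)\<close>.\<close>

section \<open>A Schur test over blocks\<close>

text \<open>The functions \<open>u\<close> and \<open>v\<close> stand for the square roots of a weight and of its inverse. The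
Cauchy--Schwarz inequality in \<open>w\<close> bounds the contribution of one block by its Hilbert--Schmidt norm;
a second application, to the sum over the blocks with the numbers \<open>\<epsilon> p\<close> as weights, uses only
that the weighted number of blocks above each point is at most \<open>E\<close>. The constant \<open>c\<close> is kept
apart from \<open>\<epsilon>\<close> because it is allowed to vanish.\<close>

lemma block_schur_test:
  fixes M :: "'a measure" and \<epsilon> :: "'p \<Rightarrow> real" and u v f :: "'a \<Rightarrow> ennreal"
    and k :: "'p \<Rightarrow> 'a \<Rightarrow> 'a \<Rightarrow> ennreal" and c E :: ennreal
  assumes "sigma_finite_measure M" and X: "countable X"
    and A: "\<And>p. p \<in> X \<Longrightarrow> A p \<in> sets M" and B: "\<And>p. p \<in> X \<Longrightarrow> B p \<in> sets M"
    and k: "\<And>p. p \<in> X \<Longrightarrow> (\<lambda>(z, w). k p z w) \<in> borel_measurable (M \<Otimes>\<^sub>M M)"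
    and u[measurable]: "u \<in> borel_measurable M" and v[measurable]: "v \<in> borel_measurable M"
    and f[measurable]: "f \<in> borel_measurable M"
    and uv: "AE w in M. u w * v w = 1"
    and K: "\<And>z w. z \<in> space M \<Longrightarrow> w \<in> space M \<Longrightarrow>
      K z w \<le> (\<integral>\<^sup>+ p. indicator (A p) z * (indicator (B p) w * k p z w) \<partial>count_space X)"
    and \<epsilon>: "\<And>p. p \<in> X \<Longrightarrow> \<epsilon> p > 0"
    and EA: "\<And>z. z \<in> space M \<Longrightarrow> (\<integral>\<^sup>+ p. ennreal (\<epsilon> p) * indicator (A p) z \<partial>count_space X) \<le> E"
    and EB: "\<And>w. w \<in> space M \<Longrightarrow> (\<integral>\<^sup>+ p. ennreal (\<epsilon> p) * indicator (B p) w \<partial>count_space X) \<le> E"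
    and HS: "\<And>p. p \<in> X \<Longrightarrow>
      (\<integral>\<^sup>+ z. indicator (A p) z * (\<integral>\<^sup>+ w. indicator (B p) w * ((k p z w)\<^sup>2 * (v w)\<^sup>2) \<partial>M) * (u z)\<^sup>2 \<partial>M)
      \<le> c * ennreal ((\<epsilon> p)\<^sup>2)"
  shows "(\<integral>\<^sup>+ z. (\<integral>\<^sup>+ w. K z w * f w \<partial>M)\<^sup>2 * (u z)\<^sup>2 \<partial>M) \<le> c * E\<^sup>2 * (\<integral>\<^sup>+ w. (f w)\<^sup>2 * (u w)\<^sup>2 \<partial>M)"
proof -
  interpret sigma_finite_measure M by fact
  note [measurable] = A B k
  have [measurable]: "p \<in> X \<Longrightarrow> Measurable.pred M (\<lambda>x. x \<in> A p)" 
     "p \<in> X \<Longrightarrow> Measurable.pred M (\<lambda>x. x \<in> B p)" for p using A B by auto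
  have kz[measurable]: "k p z \<in> borel_measurable M" if "p \<in> X" "z \<in> space M" for p z
    using measurable_compose[OF measurable_Pair1'[OF that(2)] k[OF that(1)]] by simp
  define h where "h p z = (\<integral>\<^sup>+ w. indicator (B p) w * k p z w * f w \<partial>M)" for p z
  define H where "H p z = (\<integral>\<^sup>+ w. indicator (B p) w * ((k p z w)\<^sup>2 * (v w)\<^sup>2) \<partial>M)" for p z
  define F where "F p = (\<integral>\<^sup>+ w. indicator (B p) w * ((f w)\<^sup>2 * (u w)\<^sup>2) \<partial>M)" for p
  have Hm[measurable]: "H p \<in> borel_measurable M" if "p \<in> X" for p
  proof -
    note [measurable] = A[OF that] B[OF that] k[OF that]
    have [measurable]: "Measurable.pred M (\<lambda>x. x \<in> B p)" using that by measurable
    show ?thesis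
    unfolding H_def by measurable
  qed
  have 1: "(\<integral>\<^sup>+ w. K z w * f w \<partial>M) \<le> (\<integral>\<^sup>+ p. indicator (A p) z * h p z \<partial>count_space X)"
    if z: "z \<in> space M" for z
  proof -
    have "(\<integral>\<^sup>+ w. K z w * f w \<partial>M) \<le>
      (\<integral>\<^sup>+ w. (\<integral>\<^sup>+ p. indicator (A p) z * (indicator (B p) w * k p z w * f w) \<partial>count_space X) \<partial>M)"
    proof (intro nn_integral_mono)
      fix w assume w: "w \<in> space M"
      have "K z w * f w \<le> (\<integral>\<^sup>+ p. indicator (A p) z
        * (indicator (B p) w * k p z w) \<partial>count_space X) * f w"
        by (intro mult_right_mono K z w) simp
      also have "\<dots> = (\<integral>\<^sup>+ p. indicator (A p) z
        * (indicator (B p) w * k p z w * f w) \<partial>count_space X)"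
        by (subst nn_integral_multc[symmetric]) (auto simp: mult.assoc)
      finally show "K z w * f w
        \<le> (\<integral>\<^sup>+ p. indicator (A p) z * (indicator (B p) w * k p z w * f w) \<partial>count_space X)" .
    qed
    also have "\<dots> = (\<integral>\<^sup>+ p. (\<integral>\<^sup>+ w. indicator (A p) z * (indicator (B p) w * k p z w * f w) \<partial>M)
      \<partial>count_space X)"
      using z by (intro nn_integral_count_space_nn_integral X) measurable
    also have "\<dots> = (\<integral>\<^sup>+ p. indicator (A p) z * h p z \<partial>count_space X)"
      unfolding h_def using z by (intro nn_integral_cong nn_integral_cmult) auto
    finally show ?thesis .
  qed
  have 2: "(h p z)\<^sup>2 \<le> H p z * F p" if p: "p \<in> X" and z: "z \<in> space M" for p z
  proof -
    have "h p z = (\<integral>\<^sup>+ w. (indicator (B p) w * k p z w * v w) * (indicator (B p) w * f w * u w) \<partial>M)"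
      unfolding h_def
    proof (rule nn_integral_cong_AE, use uv in eventually_elim)
      case (elim w)
      have "indicator (B p) w * k p z w * v w * (indicator (B p) w * f w * u w)
        = (indicator (B p) w * indicator (B p) w) * k p z w * f w * (u w * v w)"
        by (simp only: ac_simps)
      then show ?case using elim by (simp split: split_indicator)
    qed
    also have "\<dots>\<^sup>2 \<le> (\<integral>\<^sup>+ w. (indicator (B p) w * k p z w * v w)\<^sup>2 \<partial>M) *
        (\<integral>\<^sup>+ w. (indicator (B p) w * f w * u w)\<^sup>2 \<partial>M)"
      using p z by (intro Cauchy_Schwarz_nn_integral) auto
    also have "\<dots> = H p z * F p"
      unfolding H_def F_def
      by (intro arg_cong2[where f="(*)"] nn_integral_cong)
         (simp_all add: power_mult_distrib split: split_indicator)
    finally show ?thesis .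
  qed
  have 3: "(\<integral>\<^sup>+ p. indicator (A p) z * h p z \<partial>count_space X)\<^sup>2
     \<le> E * (\<integral>\<^sup>+ p. ennreal (1 / \<epsilon> p) * F p * (indicator (A p) z * H p z) \<partial>count_space X)"
    if z: "z \<in> space M" for z
  proof -
    have "(\<integral>\<^sup>+ p. indicator (A p) z * h p z \<partial>count_space X) =
      (\<integral>\<^sup>+ p. (ennreal (sqrt (\<epsilon> p)) * indicator (A p) z) *
              (ennreal (sqrt (1 / \<epsilon> p)) * h p z * indicator (A p) z) \<partial>count_space X)"
    proof (intro nn_integral_cong)
      fix p assume "p \<in> space (count_space X)"
      then have "ennreal (sqrt (\<epsilon> p)) * ennreal (sqrt (1 / \<epsilon> p)) = 1"
        using \<epsilon>[of p] by (simp add: ennreal_mult[symmetric] real_sqrt_mult[symmetric])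
      then have "ennreal (sqrt (\<epsilon> p)) * (ennreal (sqrt (1 / \<epsilon> p)) * h p z) = h p z"
        by (simp add: mult.assoc[symmetric])
      then show "indicator (A p) z * h p z = (ennreal (sqrt (\<epsilon> p)) * indicator (A p) z) *
              (ennreal (sqrt (1 / \<epsilon> p)) * h p z * indicator (A p) z)"
        by (simp split: split_indicator)
    qed
    also have "\<dots>\<^sup>2 \<le> (\<integral>\<^sup>+ p. (ennreal (sqrt (\<epsilon> p)) * indicator (A p) z)\<^sup>2 \<partial>count_space X) *
       (\<integral>\<^sup>+ p. (ennreal (sqrt (1 / \<epsilon> p)) * h p z * indicator (A p) z)\<^sup>2 \<partial>count_space X)"
      by (intro Cauchy_Schwarz_nn_integral) auto
    also have "\<dots> \<le> E * (\<integral>\<^sup>+ p. ennreal (1 / \<epsilon> p) * F p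
      * (indicator (A p) z * H p z) \<partial>count_space X)"
    proof (intro mult_mono nn_integral_mono)
      have "(\<integral>\<^sup>+ p. (ennreal (sqrt (\<epsilon> p)) * indicator (A p) z)\<^sup>2 \<partial>count_space X)
        = (\<integral>\<^sup>+ p. ennreal (\<epsilon> p) * indicator (A p) z \<partial>count_space X)"
        using \<epsilon> by (intro nn_integral_cong)
          (auto simp: power_mult_distrib ennreal_power less_imp_le split: split_indicator)
      then show "(\<integral>\<^sup>+ p. (ennreal (sqrt (\<epsilon> p)) * indicator (A p) z)\<^sup>2 \<partial>count_space X) \<le> E"
        using EA[OF z] by simp
      fix p assume "p \<in> space (count_space X)"
      then have p: "p \<in> X" by simp
      show "(ennreal (sqrt (1 / \<epsilon> p)) * h p z * indicator (A p) z)\<^sup>2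
        \<le> ennreal (1 / \<epsilon> p) * F p * (indicator (A p) z * H p z)"
        using 2[OF p z] \<epsilon>[OF p]
        by (auto simp: power_mult_distrib ennreal_power mult.assoc mult.commute[of "F p"]
            intro!: mult_left_mono split: split_indicator)
    qed auto
    finally show ?thesis .
  qed
  have "(\<integral>\<^sup>+ z. (\<integral>\<^sup>+ w. K z w * f w \<partial>M)\<^sup>2 * (u z)\<^sup>2 \<partial>M) \<le>
     (\<integral>\<^sup>+ z. (E * (\<integral>\<^sup>+ p. ennreal (1 / \<epsilon> p) * F p * (indicator (A p) z * H p z) \<partial>count_space X)) * (u z)\<^sup>2 \<partial>M)"
    by (intro nn_integral_mono mult_right_mono order_trans[OF power_mono[OF 1] 3]) auto
  also have "\<dots> = (\<integral>\<^sup>+ z. (\<integral>\<^sup>+ p. E * (ennreal (1 / \<epsilon> p) * F p)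
    * (indicator (A p) z * H p z * (u z)\<^sup>2) \<partial>count_space X) \<partial>M)"
    by (intro nn_integral_cong)
       (simp add: nn_integral_cmult[symmetric] nn_integral_multc[symmetric] mult.assoc)
  also have "\<dots> = (\<integral>\<^sup>+ p. (\<integral>\<^sup>+ z. E * (ennreal (1 / \<epsilon> p) * F p)
    * (indicator (A p) z * H p z * (u z)\<^sup>2) \<partial>M) \<partial>count_space X)"
    by (intro nn_integral_count_space_nn_integral X) measurable
  also have "\<dots> = (\<integral>\<^sup>+ p. E * (ennreal (1 / \<epsilon> p) * F p)
    * (\<integral>\<^sup>+ z. indicator (A p) z * H p z * (u z)\<^sup>2 \<partial>M) \<partial>count_space X)"
    by (intro nn_integral_cong nn_integral_cmult) (auto intro!: borel_measurable_times)
  also have "\<dots> \<le> (\<integral>\<^sup>+ p. E * (ennreal (1 / \<epsilon> p) * F p) * (c * ennreal ((\<epsilon> p)\<^sup>2)) \<partial>count_space X)"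
    using HS unfolding H_def by (intro nn_integral_mono mult_left_mono) auto
  also have "\<dots> = (\<integral>\<^sup>+ p. c * E * (ennreal (\<epsilon> p) * F p) \<partial>count_space X)"
  proof (intro nn_integral_cong)
    fix p assume "p \<in> space (count_space X)"
    then have "ennreal (1 / \<epsilon> p) * ennreal ((\<epsilon> p)\<^sup>2) = ennreal (\<epsilon> p)"
      using \<epsilon>[of p] by (simp add: ennreal_mult[symmetric] power2_eq_square)
    then have "c * E * F p * (ennreal (1 / \<epsilon> p) * ennreal ((\<epsilon> p)\<^sup>2)) = c * E * F p * ennreal (\<epsilon> p)"
      by simp
    then show "E * (ennreal (1 / \<epsilon> p) * F p) * (c * ennreal ((\<epsilon> p)\<^sup>2))
      = c * E * (ennreal (\<epsilon> p) * F p)"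
      by (simp add: ac_simps)
  qed
  also have "\<dots> = c * E * (\<integral>\<^sup>+ p. (\<integral>\<^sup>+ w. ennreal (\<epsilon> p)
    * (indicator (B p) w * ((f w)\<^sup>2 * (u w)\<^sup>2)) \<partial>M) \<partial>count_space X)"
    by (subst nn_integral_cmult) (auto simp: F_def nn_integral_cmult intro!: arg_cong[where f="(*) (c*E)"] nn_integral_cong)
  also have "\<dots> = c * E * (\<integral>\<^sup>+ w. (\<integral>\<^sup>+ p. ennreal (\<epsilon> p)
    * (indicator (B p) w * ((f w)\<^sup>2 * (u w)\<^sup>2)) \<partial>count_space X) \<partial>M)"
    by (subst nn_integral_count_space_nn_integral[OF X]) auto
  also have "\<dots> = c * E * (\<integral>\<^sup>+ w. (\<integral>\<^sup>+ p. ennreal (\<epsilon> p) * indicator (B p) w \<partial>count_space X)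
    * ((f w)\<^sup>2 * (u w)\<^sup>2) \<partial>M)"
    by (simp add: nn_integral_multc[symmetric] mult.assoc)
  also have "\<dots> \<le> c * E * (\<integral>\<^sup>+ w. E * ((f w)\<^sup>2 * (u w)\<^sup>2) \<partial>M)"
    using EB by (intro mult_left_mono nn_integral_mono mult_right_mono) auto
  also have "\<dots> = c * E\<^sup>2 * (\<integral>\<^sup>+ w. (f w)\<^sup>2 * (u w)\<^sup>2 \<partial>M)"
    by (subst nn_integral_cmult) (auto simp: power2_eq_square mult.assoc)
  finally show ?thesis .
qed

section \<open>Layers of Carleson boxes and their measure\<close>

lemma uhp_borel [measurable]: "uhp \<in> sets borel"
  unfolding uhp_def by measurable

abbreviation mass :: "real \<Rightarrow> complex set \<Rightarrow> (complex \<Rightarrow> ennreal) \<Rightarrow> ennreal" where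
  "mass \<alpha> S s \<equiv> (\<integral>\<^sup>+z\<in>S. s z \<partial>dA\<^sub>w \<alpha>)"

lemma space_dA [simp]: "space dA = uhp"
  by (simp add: dA_def space_restrict_space)

lemma space_dAw [simp]: "space (dA\<^sub>w \<alpha>) = uhp"
  by (simp add: dA\<^sub>w_def)

lemma sets_dAw [simp]: "sets (dA\<^sub>w \<alpha>) = sets dA"
  by (simp add: dA\<^sub>w_def)

lemma measurable_dAw [simp]: "measurable (dA\<^sub>w \<alpha>) N = measurable dA N"
  by (rule measurable_cong_sets) simp_all

lemma borel_measurable_dA: "f \<in> borel_measurable borel \<Longrightarrow> f \<in> borel_measurable dA"
  unfolding dA_def by (intro measurable_restrict_space1 measurable_completion) auto

lemma borel_sets_dA: "S \<in> sets borel \<Longrightarrow> S \<subseteq> uhp \<Longrightarrow> S \<in> sets dA"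
  by (auto simp: dA_def sets_restrict_space_iff)

definition density_w :: "real \<Rightarrow> complex \<Rightarrow> real" where
  "density_w \<alpha> z = (1 / pi) * (\<alpha> + 1) * (2 * Im z) powr \<alpha>"

lemma density_w_measurable [measurable]: "density_w \<alpha> \<in> borel_measurable dA"
  unfolding density_w_def[abs_def] by (intro borel_measurable_dA) measurable

lemma dAw_eq: "dA\<^sub>w \<alpha> = density dA (\<lambda>z. ennreal (density_w \<alpha> z))"
  by (simp add: dA\<^sub>w_def density_w_def)

lemma nn_integral_dAw:
  "f \<in> borel_measurable dA \<Longrightarrow> (\<integral>\<^sup>+z. f z \<partial>dA\<^sub>w \<alpha>) = (\<integral>\<^sup>+z. ennreal (density_w \<alpha> z) * f z \<partial>dA)"
  unfolding dAw_eq by (intro nn_integral_density) auto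

lemma density_w_pos: "\<alpha> > -1 \<Longrightarrow> z \<in> uhp \<Longrightarrow> density_w \<alpha> z > 0"
  by (auto simp: density_w_def uhp_def)

lemma AE_dAw_iff:
  assumes "\<alpha> > -1"
  shows "(AE z in dA\<^sub>w \<alpha>. P z) \<longleftrightarrow> (AE z in dA. P z)"
proof -
  have "(AE z in dA\<^sub>w \<alpha>. P z) \<longleftrightarrow> (AE z in dA. 0 < ennreal (density_w \<alpha> z) \<longrightarrow> P z)"
    unfolding dAw_eq by (intro AE_density) auto
  also have "\<dots> \<longleftrightarrow> (AE z in dA. P z)"
    by (rule AE_cong) (use density_w_pos[OF assms] in auto)
  finally show ?thesis .
qed

lemma sigma_finite_dA: "sigma_finite_measure dA"
proof -
  have "sigma_finite_measure (lebesgue :: complex measure)"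
  proof
    show "\<exists>A::complex set set. countable A \<and> A \<subseteq> sets lebesgue \<and> \<Union>A
      = space lebesgue \<and> (\<forall>a\<in>A. emeasure lebesgue a \<noteq> \<infinity>)"
    proof (intro exI[of _ "range (\<lambda>n::nat. cball 0 (real n))"] conjI ballI)
      show "\<Union>(range (\<lambda>n::nat. cball 0 (real n))) = space (lebesgue :: complex measure)"
        by (auto simp: real_arch_simple)
    next
      fix a :: "complex set" assume "a \<in> range (\<lambda>n::nat. cball 0 (real n))"
      then have "emeasure lborel a < \<infinity>"
        by (auto intro!: emeasure_lborel_cball_finite[unfolded infinity_ennreal_def])
      then show "emeasure lebesgue a \<noteq> \<infinity>"
        using \<open>a \<in> _\<close> by (auto simp: emeasure_completion main_part_sets)
    qed auto
  qed
  then show ?thesis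
    unfolding dA_def by (rule sigma_finite_measure_restrict_space) auto
qed

lemma sigma_finite_dAw: "sigma_finite_measure (dA\<^sub>w \<alpha>)"
  unfolding dAw_eq
  by (subst sigma_finite_measure.sigma_finite_iff_density_finite[OF sigma_finite_dA]) auto

text \<open>The two inclusions leave open which sides of the rectangle belong to the set, so that all shapes
of boundary are treated at once.\<close>

lemma emeasure_dA_rectangle:
  assumes S: "S \<in> sets borel" "S \<subseteq> uhp" and ab: "a \<le> b" "c \<le> d"
    and sub: "box (Complex a c) (Complex b d) \<subseteq> S" "S \<subseteq> cbox (Complex a c) (Complex b d)"
  shows "emeasure dA S = ennreal ((b - a) * (d - c))"
proof -
  have "emeasure dA S = emeasure lborel S"
    using S unfolding dA_def by (subst emeasure_restrict_space) auto
  moreover have "emeasure lborel S \<le> emeasure lborel (cbox (Complex a c) (Complex b d))"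
    using sub by (intro emeasure_mono) auto
  moreover have "emeasure lborel (box (Complex a c) (Complex b d)) \<le> emeasure lborel S"
    using sub S by (intro emeasure_mono) auto
  ultimately show ?thesis
    using ab by (simp add: emeasure_lborel_cbox_eq emeasure_lborel_box_eq Basis_complex_def)
qed

text \<open>Half-open layers: for fixed \<open>j\<close>, the layers \<open>layer j I\<close> over the intervals of one dyadic
system partition the half plane, and for fixed \<open>I\<close> they partition the box over \<open>I\<close>.\<close>

definition layer :: "nat \<Rightarrow> real set \<Rightarrow> complex set" where
  "layer j I = {z. Re z \<in> I \<and> len I / 2 ^ Suc j \<le> Im z \<and> Im z < len I / 2 ^ j}"

lemma len_ico [simp]: "L > 0 \<Longrightarrow> len {a..<a + L} = L"
  by simp

lemma layer_borel [measurable]: "layer j {a..<a+L} \<in> sets borel"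
  unfolding layer_def by measurable

lemma layer_sub_uhp:
  assumes "0 < L" shows "layer j {a..<a+L} \<subseteq> uhp"
proof
  fix z assume "z \<in> layer j {a..<a+L}"
  with assms have "0 < L / 2 ^ Suc j" "L / 2 ^ Suc j \<le> Im z" by (auto simp: layer_def)
  then show "z \<in> uhp" unfolding uhp_def mem_Collect_eq by linarith
qed

lemma layer_sets_dA: "L > 0 \<Longrightarrow> layer j {a..<a+L} \<in> sets dA"
  by (intro borel_sets_dA layer_borel layer_sub_uhp)

lemma carleson_box_borel [measurable]: "carleson_box {a..<a+L} \<in> sets borel"
  unfolding carleson_box_def by measurable

lemma carleson_box_sub_uhp: "carleson_box I \<subseteq> uhp"
  by (auto simp: carleson_box_def uhp_def)

lemma carleson_box_sets_dA: "carleson_box {a..<a+L} \<in> sets dA"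
  by (intro borel_sets_dA carleson_box_borel carleson_box_sub_uhp)

lemma emeasure_dA_carleson_box:
  assumes "L > 0" shows "emeasure dA (carleson_box {a..<a+L}) = ennreal (L\<^sup>2)"
proof -
  have "emeasure dA (carleson_box {a..<a+L}) = ennreal (((a + L) - a) * (L - 0))"
    using assms by (intro emeasure_dA_rectangle carleson_box_borel carleson_box_sub_uhp)
       (auto simp: carleson_box_def in_box_complex_iff in_cbox_complex_iff)
  then show ?thesis by (simp add: power2_eq_square)
qed

lemma measure_dA_carleson_box: "L > 0 \<Longrightarrow> measure dA (carleson_box {a..<a+L}) = L\<^sup>2"
  by (simp add: measure_def emeasure_dA_carleson_box)

lemma emeasure_dA_layer:
  assumes "L > 0" shows "emeasure dA (layer j {a..<a+L}) = ennreal (L\<^sup>2 / 2 ^ Suc j)"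
proof -
  have "emeasure dA (layer j {a..<a+L}) = ennreal (((a + L) - a) * (L / 2 ^ j - L / 2 ^ Suc j))"
    using assms by (intro emeasure_dA_rectangle layer_borel layer_sub_uhp)
       (auto simp: layer_def in_box_complex_iff in_cbox_complex_iff field_simps)
  then show ?thesis by (simp add: power2_eq_square field_simps)
qed

lemma layer_ex:
  assumes "L > 0" "z \<in> carleson_box {a..<a+L}"
  shows "\<exists>j. z \<in> layer j {a..<a+L}"
proof -
  have z: "Re z \<in> {a..<a+L}" "0 < Im z" "Im z < L" using assms by (auto simp: carleson_box_def)
  obtain n where n: "L / 2 ^ n < Im z"
  proof -
    obtain n where "(1/2) ^ n < Im z / L"
      using real_arch_pow_inv[of "Im z / L" "1/2"] z assms(1) by auto
    then show thesis using assms(1) that[of n] by (simp add: power_one_over field_simps)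
  qed
  define m where "m = (LEAST n. L / 2 ^ n \<le> Im z)"
  have m: "L / 2 ^ m \<le> Im z" unfolding m_def by (rule LeastI[of _ n]) (use n in simp)
  have "m \<noteq> 0" using m z by (intro notI) simp
  then obtain j where j: "m = Suc j" by (cases m) auto
  have "\<not> L / 2 ^ j \<le> Im z" using not_less_Least[of j "\<lambda>n. L / 2 ^ n \<le> Im z"] j m_def by auto
  then show ?thesis using m z assms(1) unfolding j layer_def by (intro exI[of _ j]) auto
qed

lemma layer_sub_carleson_box: 
  assumes "L > 0" shows "layer j {a..<a+L} \<subseteq> carleson_box {a..<a+L}"
proof
  fix z assume z: "z \<in> layer j {a..<a+L}"
  have "L / 2 ^ j \<le> L" using assms by (simp add: field_simps)
  then show "z \<in> carleson_box {a..<a+L}"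
    using z assms layer_sub_uhp[OF assms, of j a] by (auto simp: layer_def carleson_box_def uhp_def)
qed

lemma carleson_box_eq_UN_layer:
  assumes "L > 0" shows "carleson_box {a..<a+L} = (\<Union>j. layer j {a..<a+L})"
proof (intro equalityI subsetI)
  fix z assume "z \<in> carleson_box {a..<a+L}"
  then show "z \<in> (\<Union>j. layer j {a..<a+L})" using layer_ex[OF assms] by auto
qed (use layer_sub_carleson_box[OF assms] in auto)

text \<open>On a layer \<open>2 * Im z\<close> varies between \<open>L / 2 ^ j\<close> and twice that number; the two signs of
\<open>\<alpha>\<close> decide which end is the larger one, whence the absolute value in the exponents.\<close>

lemma density_w_layer:
  assumes \<alpha>: "\<alpha> > -1" and L: "L > 0" and z: "z \<in> layer j {a..<a+L}"
  defines "C \<equiv> (\<alpha> + 1) / pi * 2 powr \<bar>\<alpha>\<bar>" and "c \<equiv> (\<alpha> + 1) / pi * 2 powr (- \<bar>\<alpha>\<bar>)"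
  shows "c * (L / 2 ^ j) powr \<alpha> \<le> density_w \<alpha> z" "density_w \<alpha> z \<le> C * (L / 2 ^ j) powr \<alpha>"
proof -
  define y where "y = L / 2 ^ j"
  have y: "y > 0" using L by (simp add: y_def)
  have b: "y \<le> 2 * Im z" "2 * Im z \<le> 2 * y"
    using z L by (auto simp: layer_def y_def field_simps)
  have "2 powr (- \<bar>\<alpha>\<bar>) * y powr \<alpha> \<le> (2 * Im z) powr \<alpha> \<and> (2 * Im z) powr \<alpha> \<le> 2 powr \<bar>\<alpha>\<bar> * y powr \<alpha>"
  proof (cases "\<alpha> \<ge> 0")
    case True
    have "y powr \<alpha> \<le> (2 * Im z) powr \<alpha>" "(2 * Im z) powr \<alpha> \<le> (2 * y) powr \<alpha>"
      using True y b by (auto intro!: powr_mono2)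
    moreover have "2 powr (- \<bar>\<alpha>\<bar>) * y powr \<alpha> \<le> 1 * y powr \<alpha>"
      using True powr_mono[of "-\<alpha>" 0 "2::real"] by (intro mult_right_mono) auto
    moreover have "(2 * y) powr \<alpha> = 2 powr \<bar>\<alpha>\<bar> * y powr \<alpha>" using True y by (simp add: powr_mult)
    ultimately show ?thesis by linarith
  next
    case False
    have "(2 * y) powr \<alpha> \<le> (2 * Im z) powr \<alpha>" "(2 * Im z) powr \<alpha> \<le> y powr \<alpha>"
      using False y b by (auto intro!: powr_mono2')
    moreover have "1 * y powr \<alpha> \<le> 2 powr \<bar>\<alpha>\<bar> * y powr \<alpha>"
      using False powr_mono[of 0 "-\<alpha>" "2::real"] by (intro mult_right_mono) auto
    moreover have "(2 * y) powr \<alpha> = 2 powr (- \<bar>\<alpha>\<bar>) * y powr \<alpha>" using False y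
      by (simp add: powr_mult)
    ultimately show ?thesis by linarith
  qed
  moreover have "(\<alpha> + 1) / pi \<ge> 0" using \<alpha> by simp
  ultimately show "c * (L / 2 ^ j) powr \<alpha> \<le> density_w \<alpha> z" "density_w \<alpha> z \<le> C * (L / 2 ^ j) powr \<alpha>"
    unfolding density_w_def C_def c_def y_def[symmetric]
    using \<alpha> by (auto simp: mult.assoc intro!: mult_left_mono divide_right_mono)
qed

text \<open>The area of layer \<open>j\<close> halves from one layer to the next, and the density changes by the factor
\<open>2 powr (-\<alpha>)\<close>. The resulting ratio is less than 1 because \<open>\<alpha> > -1\<close>.\<close>

lemma emeasure_dAw_layer:
  assumes \<alpha>: "\<alpha> > -1" and L: "L > 0"
  defines "C \<equiv> (\<alpha> + 1) / pi * 2 powr \<bar>\<alpha>\<bar>" and "c \<equiv> (\<alpha> + 1) / pi * 2 powr (- \<bar>\<alpha>\<bar>)"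
  shows "ennreal (c / 2 * L powr (2 + \<alpha>) * (2 powr (-(1 + \<alpha>))) ^ j)
    \<le> emeasure (dA\<^sub>w \<alpha>) (layer j {a..<a+L})"
    and "emeasure (dA\<^sub>w \<alpha>) (layer j {a..<a+L})
      \<le> ennreal (C / 2 * L powr (2 + \<alpha>) * (2 powr (-(1 + \<alpha>))) ^ j)"
proof -
  have C: "C \<ge> 0" "c \<ge> 0" using \<alpha> by (auto simp: C_def c_def)
  have S[measurable]: "layer j {a..<a+L} \<in> sets dA" using L by (rule layer_sets_dA)
  have e: "emeasure (dA\<^sub>w \<alpha>) (layer j {a..<a+L})
    = (\<integral>\<^sup>+z. ennreal (density_w \<alpha> z) * indicator (layer j {a..<a+L}) z \<partial>dA)"
    unfolding dAw_eq by (subst emeasure_density) auto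
  have p: "(L / 2 ^ j) powr \<alpha> * (L\<^sup>2 / 2 ^ Suc j) = L powr (2 + \<alpha>) * (2 powr (-(1 + \<alpha>))) ^ j / 2"
  proof -
    have "(2 powr (-(1 + \<alpha>))) ^ j = 2 powr (- real j * \<alpha>) / 2 ^ j"
    proof -
      have "(2 powr (-(1 + \<alpha>))) ^ j = 2 powr (- real j * \<alpha> - real j)"
        by (simp add: powr_power) (rule arg_cong[where f="(powr) 2"], simp add: algebra_simps)
      then show ?thesis by (simp only: powr_diff powr_realpow[OF zero_less_numeral])
    qed
    moreover have "(L / 2 ^ j) powr \<alpha> = L powr \<alpha> * 2 powr (- real j * \<alpha>)"
    proof -
      have "(2 ^ j :: real) powr \<alpha> = 2 powr (real j * \<alpha>)"
        by (subst powr_realpow[symmetric]) (simp_all add: powr_powr)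
      then show ?thesis using L by (simp add: powr_divide powr_minus_divide)
    qed
    moreover have "L powr (2 + \<alpha>) = L\<^sup>2 * L powr \<alpha>"
      using L powr_realpow[of L 2] by (simp add: powr_add)
    ultimately show ?thesis by (simp add: mult.commute mult.left_commute)
  qed
  have ci: "(\<integral>\<^sup>+z. ennreal (D * (L / 2 ^ j) powr \<alpha>) * indicator (layer j {a..<a+L}) z \<partial>dA)
     = ennreal (D / 2 * L powr (2 + \<alpha>) * (2 powr (-(1 + \<alpha>))) ^ j)" if "D \<ge> 0" for D
  proof -
    have "(\<integral>\<^sup>+z. ennreal (D * (L / 2 ^ j) powr \<alpha>) * indicator (layer j {a..<a+L}) z \<partial>dA)
       = ennreal (D * (L / 2 ^ j) powr \<alpha>) * ennreal (L\<^sup>2 / 2 ^ Suc j)"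
      using L by (simp add: nn_integral_cmult_indicator emeasure_dA_layer del: power_Suc)
    also have "\<dots> = ennreal (D * ((L / 2 ^ j) powr \<alpha> * (L\<^sup>2 / 2 ^ Suc j)))"
      using that by (simp add: ennreal_mult[symmetric] mult.assoc del: power_Suc)
    finally show ?thesis unfolding p by (simp add: mult.assoc)
  qed
  show "ennreal (c / 2 * L powr (2 + \<alpha>) * (2 powr (-(1 + \<alpha>))) ^ j)
    \<le> emeasure (dA\<^sub>w \<alpha>) (layer j {a..<a+L})"
    unfolding e ci[OF C(2), symmetric]
    using density_w_layer(1)[OF \<alpha> L] unfolding c_def
    by (intro nn_integral_mono) (auto split: split_indicator intro!: ennreal_leI)
  show "emeasure (dA\<^sub>w \<alpha>) (layer j {a..<a+L})
    \<le> ennreal (C / 2 * L powr (2 + \<alpha>) * (2 powr (-(1 + \<alpha>))) ^ j)"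
    unfolding e ci[OF C(1), symmetric]
    using density_w_layer(2)[OF \<alpha> L] unfolding C_def
    by (intro nn_integral_mono) (auto split: split_indicator intro!: ennreal_leI)
qed

lemma emeasure_dAw_carleson_box_le:
  assumes \<alpha>: "\<alpha> > -1"
  obtains C where "C > 0" "\<And>a L. L > 0 \<Longrightarrow>
    emeasure (dA\<^sub>w \<alpha>) (carleson_box {a..<a+L}) \<le> ennreal (C * L powr (2 + \<alpha>))"
proof -
  define C where "C = (\<alpha> + 1) / pi * 2 powr \<bar>\<alpha>\<bar>"
  define q where "q = 2 powr (-(1 + \<alpha>))"
  have q: "0 < q" "q < 1" using \<alpha> powr_less_mono[of "-(1+\<alpha>)" 0 "2::real"] by (auto simp: q_def)
  have C: "C > 0" using \<alpha> by (auto simp: C_def)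
  have "emeasure (dA\<^sub>w \<alpha>) (carleson_box {a..<a+L}) \<le> ennreal ((C / 2 / (1 - q)) * L powr (2 + \<alpha>))"
    if L: "L > 0" for a L
  proof -
    have "emeasure (dA\<^sub>w \<alpha>) (carleson_box {a..<a+L}) \<le> (\<Sum>j. emeasure (dA\<^sub>w \<alpha>) (layer j {a..<a+L}))"
      unfolding carleson_box_eq_UN_layer[OF L] using L
      by (intro emeasure_subadditive_countably) (auto simp: layer_sets_dA)
    also have "\<dots> \<le> (\<Sum>j. ennreal (C / 2 * L powr (2 + \<alpha>) * q ^ j))"
      unfolding C_def q_def by (intro suminf_le emeasure_dAw_layer(2)[OF \<alpha> L]) auto
    also have "\<dots> = ennreal (C / 2 * L powr (2 + \<alpha>) * (1 / (1 - q)))"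
      using C q by (intro suminf_ennreal_eq sums_mult geometric_sums) auto
    finally show ?thesis by (simp add: field_simps)
  qed
  then show ?thesis using that[of "C / 2 / (1 - q)"] C q by auto
qed

section \<open>Dyadic systems and decay over the layers\<close>

text \<open>The part of the dyadic structure that passes to the union of two dyadic systems. It supports
induction on \<open>j\<close>: layer \<open>j + 1\<close> over an interval is the union of the layers \<open>j\<close> over its halves.
The right half is written with the length \<open>L / 2\<close> visible, so that it is again of the
form \<open>{a'..<a' + L'}\<close>.\<close>

definition halving_family :: "real set set \<Rightarrow> bool" where
  "halving_family D \<longleftrightarrow> (\<forall>I\<in>D. \<exists>a L. 0 < L \<and> I = {a..<a+L}) \<and>
     (\<forall>a L. 0 < L \<longrightarrow> {a..<a+L} \<in> D \<longrightarrow>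
        {a..<a+L/2} \<in> D \<and> {a+L/2..<a+L/2+L/2} \<in> D)"

lemma ico_eq_iff:
  fixes a b :: real assumes "L > 0" "{a..<a+L} = {b..<b+L'}"
  shows "a = b \<and> L = L'"
  using assms by (auto simp: Ico_eq_Ico)

text \<open>The intervals of the next generation through the left endpoint and through the midpoint lie inside
the given interval, which forces them to be its two halves.\<close>

lemma dyadic_system_halving:
  assumes "dyadic_system D" shows "halving_family D"
proof -
  obtain G :: "int \<Rightarrow> real set set" where D: "D = (\<Union>k. G k)"
    and part: "\<And>k. partition_on UNIV (G k)"
    and ico: "\<And>k I. I \<in> G k \<Longrightarrow> \<exists>a. I = {a ..< a + 2 powi (- k)}"
    and ref: "\<And>k J. J \<in> G (k + 1) \<Longrightarrow> \<exists>I\<in>G k. J \<subseteq> I"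
    using assms unfolding dyadic_system_def by blast
  have same: "I = J" if "I \<in> G k" "J \<in> G k" "x \<in> I" "x \<in> J" for I J k x
    using part[of k] that unfolding partition_on_def disjoint_def by blast
  have cov: "\<exists>J\<in>G k. x \<in> J" for k x
    using part[of k] unfolding partition_on_def by blast
  have H: "{a..<a+L/2} \<in> D \<and> {a+L/2..<a+L/2+L/2} \<in> D" if L: "L > 0" and I: "{a..<a+L} \<in> D" for a L
  proof -
    obtain k where k: "{a..<a+L} \<in> G k" using I unfolding D by blast
    have Lk: "L = 2 powi (- k)" using ico[OF k] ico_eq_iff[OF L] by blast
    have L2: "2 powi (- (k + 1)) = L / 2"
      unfolding Lk by (simp add: power_int_diff power_int_minus divide_simps power_int_add)
    have sub: "J \<subseteq> {a..<a+L} \<and> (\<exists>c. J = {c..<c+L/2})" if J: "J \<in> G (k+1)" "x \<in> J" "x \<in> {a..<a+L}"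
      for J x
    proof -
      obtain I' where I': "I' \<in> G k" "J \<subseteq> I'" using ref[OF J(1)] by blast
      have "I' = {a..<a+L}" using same[OF I'(1) k, of x] I' J by auto
      then show ?thesis using I' ico[OF J(1)] L2 by auto
    qed
    obtain J1 where J1: "J1 \<in> G (k+1)" "a \<in> J1" using cov by blast
    obtain c where c: "J1 = {c..<c+L/2}" "J1 \<subseteq> {a..<a+L}" using sub[OF J1] L by force
    have "c = a"
    proof -
      have "c \<in> J1" using c(1) L by simp
      then have "c \<in> {a..<a+L}" using c(2) by blast
      then show ?thesis using J1(2) unfolding c(1) by simp
    qed
    obtain J2 where J2: "J2 \<in> G (k+1)" "a + L/2 \<in> J2" using cov by blast
    obtain d where d: "J2 = {d..<d+L/2}" "J2 \<subseteq> {a..<a+L}" using sub[OF J2] L by force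
    have "d \<in> J2" using d(1) L by simp
    then have da: "d \<in> {a..<a+L}" using d(2) by blast
    have "d = a + L/2"
    proof (rule ccontr)
      assume "d \<noteq> a + L/2"
      then have "d < a + L/2" using J2(2) unfolding d(1) by simp
      then have "d \<in> J1" using da unfolding c(1) \<open>c = a\<close> by simp
      moreover note \<open>d \<in> J2\<close>
      ultimately have "J1 = J2" by (rule same[OF J1(1) J2(1)])
      then have "a + L/2 \<in> J1" using J2(2) by simp
      then show False unfolding c(1) \<open>c = a\<close> by simp
    qed
    then show ?thesis using J1(1) J2(1) unfolding c(1) d(1) \<open>c = a\<close> D by blast
  qed
  have N: "\<exists>a L. 0 < L \<and> I = {a..<a+L}" if ID: "I \<in> D" for I
  proof -
    obtain k where "I \<in> G k" using ID unfolding D by blast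
    then obtain a where "I = {a ..< a + 2 powi (- k)}" using ico by blast
    then show ?thesis by (intro exI[of _ a] exI[of _ "2 powi (-k)"]) auto
  qed
  show ?thesis unfolding halving_family_def
    by (intro conjI ballI allI impI) (erule N, erule (1) H[THEN conjunct1], erule (1) H[THEN conjunct2])
qed

lemma dyadic_system_countable:
  assumes "dyadic_system D" shows "countable D"
proof -
  obtain G :: "int \<Rightarrow> real set set" where D: "D = (\<Union>k. G k)"
    and part: "\<And>k. partition_on UNIV (G k)"
    and ico: "\<And>k I. I \<in> G k \<Longrightarrow> \<exists>a. I = {a ..< a + 2 powi (- k)}"
    using assms unfolding dyadic_system_def by blast
  have "countable (G k)" for k
  proof (rule countable_disjoint_nonempty_interior_subsets)
    show "disjoint (G k)" using part[of k] by (simp add: partition_on_def)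
    fix I assume I: "I \<in> G k" "interior I = {}"
    obtain a where "I = {a ..< a + 2 powi (- k)}" using ico[OF I(1)] by blast
    then show "I = {}" using I(2) by (simp add: interior_atLeastLessThan)
  qed
  then show ?thesis unfolding D by auto
qed

text \<open>The height of \<open>z\<close> and the number \<open>j\<close> determine the generation of the interval.\<close>

lemma dyadic_layer_unique:
  assumes "dyadic_system D" "I \<in> D" "J \<in> D" "z \<in> layer j I" "z \<in> layer j J"
  shows "I = J"
proof -
  obtain G :: "int \<Rightarrow> real set set" where D: "D = (\<Union>k. G k)"
    and part: "\<And>k. partition_on UNIV (G k)"
    and ico: "\<And>k I. I \<in> G k \<Longrightarrow> \<exists>a. I = {a ..< a + 2 powi (- k)}"
    using assms(1) unfolding dyadic_system_def by blast
  obtain k l where k: "I \<in> G k" "J \<in> G l" using assms(2,3) unfolding D by blast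
  have len: "len I = 2 powi (-k)" "len J = 2 powi (-l)"
  proof -
    have "len I = 2 powi (-k)" if IG: "I \<in> G k" for I k
    proof -
      obtain a where I: "I = {a ..< a + 2 powi (- k)}" using ico[OF IG] ..
      show ?thesis unfolding I by (rule len_ico) simp
    qed
    then show "len I = 2 powi (-k)" "len J = 2 powi (-l)" using k by blast+
  qed
  have "len I < 2 * len J" "len J < 2 * len I"
  proof -
    have *: "len I' < 2 * len J'" if "z \<in> layer j I'" "z \<in> layer j J'" for I' J'
    proof -
      have "len I' / 2 ^ Suc j < len J' / 2 ^ j" using that by (auto simp: layer_def)
      then show ?thesis by (simp add: field_simps)
    qed
    show "len I < 2 * len J" "len J < 2 * len I"
      by (rule *[OF assms(4,5)], rule *[OF assms(5,4)])
  qed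
  then have "2 powi (-k) < (2::real) powi (1 - l)" "2 powi (-l) < (2::real) powi (1 - k)"
    using power_int_add[of "2::real" 1 "-l"] power_int_add[of "2::real" 1 "-k"] unfolding len
      by simp_all
  moreover have "x < y" if xy: "2 powi x < (2::real) powi y" for x y
  proof (rule ccontr)
    assume "\<not> x < y"
    then have "(2::real) powi y \<le> 2 powi x" by (intro power_int_increasing) auto
    then show False using xy by linarith
  qed
  ultimately have "-k < 1 - l" "-l < 1 - k" by blast+
  then have "k = l" by linarith
  then have "I \<in> G k" "J \<in> G k" using k by auto
  moreover have "Re z \<in> I" "Re z \<in> J" using assms(4,5) by (auto simp: layer_def)
  moreover have "disjoint (G k)" using part[of k] by (simp add: partition_on_def)
  ultimately show ?thesis using disjointD[of "G k" I J] by auto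
qed

lemma halving_family_ico: "halving_family D \<Longrightarrow> I \<in> D \<Longrightarrow> \<exists>a L. 0 < L \<and> I = {a..<a+L}"
  by (simp only: halving_family_def)

lemma halving_family_halves:
  assumes "halving_family D" "0 < L" "{a..<a+L} \<in> D"
  shows "{a..<a+L/2} \<in> D" "{a+L/2..<a+L/2+L/2} \<in> D"
  using assms(1) unfolding halving_family_def by (meson assms(2,3))+

lemma halving_family_Un:
  assumes "halving_family D1" "halving_family D2"
  shows "halving_family (D1 \<union> D2)"
  unfolding halving_family_def
proof (intro conjI ballI allI impI)
  fix I assume "I \<in> D1 \<union> D2"
  then show "\<exists>a L. 0 < L \<and> I = {a..<a+L}"
    using assms[THEN halving_family_ico] by (elim UnE)
next
  fix a L :: real assume L: "0 < L" and I: "{a..<a+L} \<in> D1 \<union> D2"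
  from I show "{a..<a+L/2} \<in> D1 \<union> D2"
    by (elim UnE) (use assms[THEN halving_family_halves(1), OF L] in blast)+
  from I show "{a+L/2..<a+L/2+L/2} \<in> D1 \<union> D2"
    by (elim UnE) (use assms[THEN halving_family_halves(2), OF L] in blast)+
qed

lemma halving_familyE:
  assumes "halving_family D" "I \<in> D"
  obtains a L where "0 < L" "I = {a..<a+L}" "{a..<a+L/2} \<in> D" "{a+L/2..<a+L/2+L/2} \<in> D"
proof -
  obtain a L where I: "0 < L" "I = {a..<a+L}" using halving_family_ico[OF assms] by blast
  then show thesis
    using that[OF I] halving_family_halves[OF assms(1) I(1), of a] assms(2) by blast
qed

lemma mem_layer: "0 < L \<Longrightarrow> z \<in> layer j {a..<a+L} \<longleftrightarrow>
    Re z \<in> {a..<a+L} \<and> L / 2 ^ Suc j \<le> Im z \<and> Im z < L / 2 ^ j"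
  by (simp only: layer_def len_ico mem_Collect_eq)

lemma mem_carleson_box: "0 < L \<Longrightarrow> z \<in> carleson_box {a..<a+L} \<longleftrightarrow>
    Re z \<in> {a..<a+L} \<and> 0 < Im z \<and> Im z < L"
  by (simp only: carleson_box_def len_ico mem_Collect_eq)

lemma ico_halves:
  fixes a x L :: real
  assumes "0 < L"
  shows "x \<in> {a..<a+L} \<longleftrightarrow> x \<in> {a..<a+L/2} \<or> x \<in> {a+L/2..<a+L/2+L/2}"
    and "\<not> (x \<in> {a..<a+L/2} \<and> x \<in> {a+L/2..<a+L/2+L/2})"
  unfolding atLeastLessThan_iff using assms by (smt (verit) field_sum_of_halves)+

lemma layer_Suc:
  assumes L: "L > 0"
  shows "layer (Suc j) {a..<a+L} = layer j {a..<a+L/2} \<union> layer j {a+L/2..<a+L/2+L/2}"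
    and "layer j {a..<a+L/2} \<inter> layer j {a+L/2..<a+L/2+L/2} = {}"
proof -
  have L2: "0 < L / 2" using L by simp
  have p: "L / 2 ^ Suc (Suc j) = L / 2 / 2 ^ Suc j" "L / 2 ^ Suc j = L / 2 / 2 ^ j" by simp_all
  show "layer (Suc j) {a..<a+L} = layer j {a..<a+L/2} \<union> layer j {a+L/2..<a+L/2+L/2}"
    by (rule set_eqI) (use ico_halves(1)[OF L] in \<open>simp only: Un_iff mem_layer[OF L] mem_layer[OF L2] p, blast\<close>)
  show "layer j {a..<a+L/2} \<inter> layer j {a+L/2..<a+L/2+L/2} = {}"
    unfolding disjoint_iff mem_layer[OF L2] using ico_halves(2)[OF L] by blast
qed

lemma carleson_box_split:
  assumes L: "L > 0"
  shows "carleson_box {a..<a+L} = layer 0 {a..<a+L} \<union>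
      (carleson_box {a..<a+L/2} \<union> carleson_box {a+L/2..<a+L/2+L/2})"
    and "layer 0 {a..<a+L} \<inter> (carleson_box {a..<a+L/2} \<union> carleson_box {a+L/2..<a+L/2+L/2}) = {}"
    and "carleson_box {a..<a+L/2} \<inter> carleson_box {a+L/2..<a+L/2+L/2} = {}"
proof -
  have L2: "0 < L / 2" using L by simp
  have im: "0 < y \<and> y < L \<longleftrightarrow> (L / 2 ^ Suc 0 \<le> y \<and> y < L / 2 ^ 0) \<or> (0 < y \<and> y < L / 2)"
      "\<not> (L / 2 ^ Suc 0 \<le> y \<and> y < L / 2)" for y :: real
    using L by auto
  show "carleson_box {a..<a+L} = layer 0 {a..<a+L} \<union>
      (carleson_box {a..<a+L/2} \<union> carleson_box {a+L/2..<a+L/2+L/2})"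
    unfolding set_eq_iff Un_iff mem_layer[OF L] mem_carleson_box[OF L] mem_carleson_box[OF L2] im(1) ico_halves(1)[OF L] by blast
  show "layer 0 {a..<a+L} \<inter> (carleson_box {a..<a+L/2} \<union> carleson_box {a+L/2..<a+L/2+L/2}) = {}"
    unfolding disjoint_iff Un_iff mem_layer[OF L] mem_carleson_box[OF L2] using im(2) by blast
  show "carleson_box {a..<a+L/2} \<inter> carleson_box {a+L/2..<a+L/2+L/2} = {}"
    unfolding disjoint_iff mem_carleson_box[OF L2] using ico_halves(2)[OF L] by blast
qed

lemma nn_integral_layer_Suc:
  assumes L: "L > 0" and f: "f \<in> borel_measurable dA"
  shows "mass \<alpha> (layer (Suc j) {a..<a+L}) (\<lambda>z. f z) =
     mass \<alpha> (layer j {a..<a+L/2}) (\<lambda>z. f z) + mass \<alpha> (layer j {a+L/2..<a+L/2+L/2}) (\<lambda>z. f z)"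
  unfolding layer_Suc(1)[OF L]
  by (rule nn_integral_disjoint_pair)
     (unfold measurable_dAw sets_dAw, rule f, rule layer_sets_dA, use L in simp,
      rule layer_sets_dA, use L in simp, rule layer_Suc(2)[OF L])

lemma nn_integral_carleson_box_split:
  assumes L: "L > 0" and f: "f \<in> borel_measurable dA"
  shows "mass \<alpha> (carleson_box {a..<a+L}) (\<lambda>z. f z) = mass \<alpha> (layer 0 {a..<a+L}) (\<lambda>z. f z) +
     (mass \<alpha> (carleson_box {a..<a+L/2}) (\<lambda>z. f z) + mass \<alpha> (carleson_box {a+L/2..<a+L/2+L/2}) (\<lambda>z. f z))"
proof -
  note sets = layer_sets_dA[OF L, of 0 a] carleson_box_sets_dA[of a "L/2"] carleson_box_sets_dA[of "a+L/2" "L/2"]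
  have "mass \<alpha> (carleson_box {a..<a+L}) (\<lambda>z. f z) = mass \<alpha> (layer 0 {a..<a+L}) (\<lambda>z. f z) +
     mass \<alpha> (carleson_box {a..<a+L/2} \<union> carleson_box {a+L/2..<a+L/2+L/2}) (\<lambda>z. f z)"
    unfolding carleson_box_split(1)[OF L]
    by (rule nn_integral_disjoint_pair)
      (unfold measurable_dAw sets_dAw, rule f, rule sets, rule sets.Un, rule sets, rule sets,
       rule carleson_box_split(2)[OF L])
  also have "mass \<alpha> (carleson_box {a..<a+L/2} \<union> carleson_box {a+L/2..<a+L/2+L/2}) (\<lambda>z. f z) =
    mass \<alpha> (carleson_box {a..<a+L/2}) (\<lambda>z. f z) + mass \<alpha> (carleson_box {a+L/2..<a+L/2+L/2}) (\<lambda>z. f z)"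
    by (rule nn_integral_disjoint_pair)
      (unfold measurable_dAw sets_dAw, rule f, rule sets, rule sets, rule carleson_box_split(3)[OF L])
  finally show ?thesis .
qed

text \<open>If the top layer carries at least the proportion \<open>1 / \<Theta>\<close> of the mass of every box, then
the boxes over the two halves of \<open>I\<close> together carry at most \<open>1 - 1 / \<Theta>\<close> of the mass of the
box over \<open>I\<close>; iterate.\<close>

lemma layer_decay:
  assumes D: "halving_family D" and [measurable]: "s \<in> borel_measurable dA"
    and top: "\<And>I. I \<in> D \<Longrightarrow> mass \<alpha> (carleson_box I) s \<le> ennreal \<Theta> * mass \<alpha> (layer 0 I) s"
    and fin: "\<And>I. I \<in> D \<Longrightarrow> mass \<alpha> (carleson_box I) s < \<infinity>"
    and \<Theta>: "\<Theta> \<ge> 1" and I: "I \<in> D"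
  shows "mass \<alpha> (layer j I) s \<le> ennreal ((1 - 1 / \<Theta>) ^ j) * mass \<alpha> (carleson_box I) s"
  using I
proof (induction j arbitrary: I)
  case 0
  then obtain a L where I: "0 < L" "I = {a..<a+L}" using halving_familyE[OF D] by metis
  show ?case using layer_sub_carleson_box[OF I(1), of 0 a] unfolding I(2)
    by (auto intro!: nn_integral_mono split: split_indicator)
next
  case (Suc j)
  obtain a L where I: "0 < L" "I = {a..<a+L}" "{a..<a+L/2} \<in> D" "{a+L/2..<a+L/2+L/2} \<in> D"
    using halving_familyE[OF D Suc.prems] by metis
  define \<delta> where "\<delta> = 1 - 1 / \<Theta>"
  have \<delta>: "\<delta> \<ge> 0" using \<Theta> by (simp add: \<delta>_def)
  let ?s = "\<lambda>S. \<integral>\<^sup>+z\<in>S. s z \<partial>dA\<^sub>w \<alpha>"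
  let ?I1 = "{a..<a+L/2}" and ?I2 = "{a+L/2..<a+L/2+L/2}"
  have split: "?s (carleson_box I)
    = ?s (layer 0 I) + (?s (carleson_box ?I1) + ?s (carleson_box ?I2))"
    unfolding I(2) by (rule nn_integral_carleson_box_split) (use I(1) in auto)
  have ftop: "?s (layer 0 I) < \<infinity>" "?s (carleson_box ?I1) < \<infinity>" "?s (carleson_box ?I2) < \<infinity>"
    using fin[OF Suc.prems] unfolding split by auto
  have "?s (carleson_box ?I1) + ?s (carleson_box ?I2) \<le> ennreal \<delta> * ?s (carleson_box I)"
  proof -
    obtain t where t: "?s (layer 0 I) = ennreal t" "t \<ge> 0"
      using ftop(1) by (cases "?s (layer 0 I)" rule: ennreal_cases) auto
    obtain q where q: "?s (carleson_box ?I1) + ?s (carleson_box ?I2) = ennreal q" "q \<ge> 0"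
    proof (cases "?s (carleson_box ?I1) + ?s (carleson_box ?I2)" rule: ennreal_cases)
      case top
      then show thesis using ftop(2,3) by (auto simp: less_top[symmetric])
    qed
    have tq: "t + q \<le> \<Theta> * t"
      using top[OF Suc.prems] t q \<Theta> unfolding split
      by (simp add: ennreal_plus[symmetric] ennreal_mult[symmetric] del: ennreal_plus)
    have "q \<le> \<delta> * (t + q)"
      using tq \<Theta> t(2) q(2) unfolding \<delta>_def by (simp add: field_simps)
    then show ?thesis
      using t q \<delta> unfolding split
      by (simp add: ennreal_plus[symmetric] ennreal_mult[symmetric] del: ennreal_plus)
  qed
  then have "ennreal (\<delta> ^ j) * (?s (carleson_box ?I1) + ?s (carleson_box ?I2))
    \<le> ennreal (\<delta> ^ j) * (ennreal \<delta> * ?s (carleson_box I))"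
    by (rule mult_left_mono) simp
  also have "\<dots> = ennreal (\<delta> ^ Suc j) * ?s (carleson_box I)"
    using \<delta> by (simp add: ennreal_mult mult_ac)
  finally have "ennreal (\<delta> ^ j) * ?s (carleson_box ?I1) + ennreal (\<delta> ^ j) * ?s (carleson_box ?I2)
    \<le> ennreal (\<delta> ^ Suc j) * ?s (carleson_box I)"
    by (simp add: distrib_left)
  moreover have "?s (layer (Suc j) I) = ?s (layer j ?I1) + ?s (layer j ?I2)"
    unfolding I(2) by (rule nn_integral_layer_Suc) (use I(1) in auto)
  moreover have "?s (layer j ?I1) + ?s (layer j ?I2) \<le>
      ennreal (\<delta> ^ j) * ?s (carleson_box ?I1) + ennreal (\<delta> ^ j) * ?s (carleson_box ?I2)"
    unfolding \<delta>_def by (intro add_mono Suc.IH I)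
  ultimately show ?case
    unfolding \<delta>_def[symmetric] by (simp only: order_trans)
qed

section \<open>Mass of the top layer and oscillation over the layers\<close>

lemma layer_measure_pos_finite:
  assumes "\<alpha> > -1" "L > 0"
  shows "emeasure (dA\<^sub>w \<alpha>) (layer j {a..<a+L}) \<noteq> 0" "emeasure (dA\<^sub>w \<alpha>) (layer j {a..<a+L}) \<noteq> top"
proof -
  have "0 < (\<alpha> + 1) / pi * 2 powr - \<bar>\<alpha>\<bar> / 2 * L powr (2 + \<alpha>) * (2 powr - (1 + \<alpha>)) ^ j"
    using assms by simp
  then have "0 < ennreal ((\<alpha> + 1) / pi * 2 powr - \<bar>\<alpha>\<bar> / 2 * L powr (2 + \<alpha>)
    * (2 powr - (1 + \<alpha>)) ^ j)"
    by (simp only: ennreal_less_zero_iff)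
  also note emeasure_dAw_layer(1)[OF assms, of j a]
  finally show "emeasure (dA\<^sub>w \<alpha>) (layer j {a..<a+L}) \<noteq> 0" by simp
  have "emeasure (dA\<^sub>w \<alpha>) (layer j {a..<a+L}) < top"
    using emeasure_dAw_layer(2)[OF assms, of j a] by (rule le_less_trans) simp
  then show "emeasure (dA\<^sub>w \<alpha>) (layer j {a..<a+L}) \<noteq> top" by simp
qed

lemma carleson_box_le_top_layer:
  assumes \<alpha>: "\<alpha> > -1"
  obtains \<kappa> where "\<kappa> > 0"
    "\<And>a L. L > 0 \<Longrightarrow> emeasure (dA\<^sub>w \<alpha>) (carleson_box {a..<a+L})
      \<le> ennreal \<kappa> * emeasure (dA\<^sub>w \<alpha>) (layer 0 {a..<a+L})"
proof -
  obtain C where C: "C > 0" "\<And>a L. L > 0 \<Longrightarrow>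
    emeasure (dA\<^sub>w \<alpha>) (carleson_box {a..<a+L}) \<le> ennreal (C * L powr (2 + \<alpha>))"
    using emeasure_dAw_carleson_box_le[OF \<alpha>] by metis
  define c where "c = (\<alpha> + 1) / pi * 2 powr (- \<bar>\<alpha>\<bar>) / 2"
  have c: "c > 0" using \<alpha> by (simp add: c_def)
  have "emeasure (dA\<^sub>w \<alpha>) (carleson_box {a..<a+L})
    \<le> ennreal (C / c) * emeasure (dA\<^sub>w \<alpha>) (layer 0 {a..<a+L})"
    if L: "L > 0" for a L
  proof -
    have "emeasure (dA\<^sub>w \<alpha>) (carleson_box {a..<a+L}) \<le> ennreal (C * L powr (2 + \<alpha>))"
      by (rule C(2)[OF L])
    also have "\<dots> = ennreal (C / c) * ennreal (c * L powr (2 + \<alpha>))"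
      using C c by (simp add: ennreal_mult[symmetric])
    also have "\<dots> \<le> ennreal (C / c) * emeasure (dA\<^sub>w \<alpha>) (layer 0 {a..<a+L})"
      using emeasure_dAw_layer(1)[OF \<alpha> L, of 0 a] unfolding c_def by (intro mult_left_mono) auto
    finally show ?thesis .
  qed
  then show thesis using that[of "C / c"] C c by auto
qed

text \<open>Write \<open>T\<close> and \<open>Q\<close> for the top layer and the box. By the Cauchy--Schwarz inequality, the square of
the measure of \<open>T\<close> is at most the mass of \<open>u\<^sup>2\<close> on \<open>T\<close> times that of \<open>v\<^sup>2\<close> on \<open>Q\<close>;
multiply by the mass of \<open>u\<^sup>2\<close> on \<open>Q\<close> and use the \<open>B2\<close> bound.\<close>

lemma box_mass_le_top_layer_mass:
  assumes \<alpha>: "\<alpha> > -1" and L: "L > 0"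
    and [measurable]: "u \<in> borel_measurable dA" "v \<in> borel_measurable dA"
    and uv: "AE z in dA. u z * v z = 1"
    and B2: "mass \<alpha> (carleson_box {a..<a+L}) (\<lambda>z. (u z)\<^sup>2)
      * mass \<alpha> (carleson_box {a..<a+L}) (\<lambda>z. (v z)\<^sup>2)
        \<le> ennreal N * (emeasure (dA\<^sub>w \<alpha>) (carleson_box {a..<a+L}))\<^sup>2"
    and \<kappa>: "\<kappa> > 0" "emeasure (dA\<^sub>w \<alpha>) (carleson_box {a..<a+L})
      \<le> ennreal \<kappa> * emeasure (dA\<^sub>w \<alpha>) (layer 0 {a..<a+L})"
    and N: "N \<ge> 0"
  shows "mass \<alpha> (carleson_box {a..<a+L}) (\<lambda>z. (u z)\<^sup>2)
    \<le> ennreal (N * \<kappa>\<^sup>2) * mass \<alpha> (layer 0 {a..<a+L}) (\<lambda>z. (u z)\<^sup>2)"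
proof -
  let ?T = "layer 0 {a..<a+L}" and ?Q = "carleson_box {a..<a+L}"
  define m where "m = emeasure (dA\<^sub>w \<alpha>) ?T"
  have m: "m \<noteq> 0" "m \<noteq> top" using layer_measure_pos_finite[OF \<alpha> L] by (auto simp: m_def)
  have [measurable]: "?T \<in> sets dA" "?Q \<in> sets dA"
    by (rule layer_sets_dA[OF L], rule carleson_box_sets_dA)
  define U where "U = mass \<alpha> ?Q (\<lambda>z. (u z)\<^sup>2)"
  define V where "V = mass \<alpha> ?Q (\<lambda>z. (v z)\<^sup>2)"
  define UT where "UT = mass \<alpha> ?T (\<lambda>z. (u z)\<^sup>2)"
  have "m = (\<integral>\<^sup>+z. indicator ?T z \<partial>dA\<^sub>w \<alpha>)" unfolding m_def by (subst nn_integral_indicator) auto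
  also have "\<dots> = (\<integral>\<^sup>+z. (u z * indicator ?T z) * (v z * indicator ?T z) \<partial>dA\<^sub>w \<alpha>)"
  proof (rule nn_integral_cong_AE, use uv[unfolded AE_dAw_iff[OF \<alpha>, symmetric]] in eventually_elim)
    case (elim z)
    then show ?case by (auto split: split_indicator)
  qed
  also have "\<dots>\<^sup>2 \<le> (\<integral>\<^sup>+z. (u z * indicator ?T z)\<^sup>2 \<partial>dA\<^sub>w \<alpha>)
    * (\<integral>\<^sup>+z. (v z * indicator ?T z)\<^sup>2 \<partial>dA\<^sub>w \<alpha>)"
    by (intro Cauchy_Schwarz_nn_integral) auto
  also have "\<dots> \<le> UT * V"
    unfolding UT_def V_def using layer_sub_carleson_box[OF L, of 0 a]
    by (intro mult_mono nn_integral_mono) (auto split: split_indicator)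
  finally have mm: "m\<^sup>2 \<le> UT * V" .
  have "m\<^sup>2 * U \<le> UT * (U * V)" using mult_right_mono[OF mm, of U] by (simp add: mult_ac)
  also have "\<dots> \<le> UT * (ennreal N * (emeasure (dA\<^sub>w \<alpha>) ?Q)\<^sup>2)"
    using B2 unfolding U_def V_def by (intro mult_left_mono) auto
  also have "\<dots> \<le> UT * (ennreal N * (ennreal \<kappa> * m)\<^sup>2)"
    using \<kappa>(2) unfolding m_def by (intro mult_left_mono power_mono) auto
  also have "\<dots> = m\<^sup>2 * (ennreal (N * \<kappa>\<^sup>2) * UT)"
    using \<kappa>(1) N by (simp add: power_mult_distrib ennreal_power ennreal_mult mult_ac)
  finally have "m\<^sup>2 * U \<le> m\<^sup>2 * (ennreal (N * \<kappa>\<^sup>2) * UT)" .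
  moreover have "m\<^sup>2 \<noteq> 0" "m\<^sup>2 \<noteq> top" using m
    by (simp_all add: power2_eq_square ennreal_mult_eq_top_iff)
  ultimately show ?thesis
    unfolding U_def UT_def using ennreal_mult_le_mult_iff by blast
qed

lemma ennreal_sq_triangle:
  fixes x y c :: complex
  shows "ennreal ((cmod (x - y))\<^sup>2)
    \<le> 2 * ennreal ((cmod (x - c))\<^sup>2) + 2 * ennreal ((cmod (y - c))\<^sup>2)"
proof -
  have "cmod (x - y) \<le> cmod (x - c) + cmod (y - c)"
    by (metis dist_norm dist_triangle2)
  then have "(cmod (x - y))\<^sup>2 \<le> (cmod (x - c) + cmod (y - c))\<^sup>2" by (intro power_mono) auto
  also have "\<dots> \<le> 2 * (cmod (x - c))\<^sup>2 + 2 * (cmod (y - c))\<^sup>2"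
    using sum_squares_ge_zero[of "cmod (x - c) - cmod (y - c)" 0]
      by (simp add: power2_eq_square algebra_simps)
  finally have "ennreal ((cmod (x - y))\<^sup>2) \<le> ennreal (2 * (cmod (x - c))\<^sup>2 + 2 * (cmod (y - c))\<^sup>2)"
    by (rule ennreal_leI)
  then show ?thesis by (simp add: ennreal_mult)
qed

text \<open>Any constants approximating \<open>b\<close> well on a box and on the box over one of the halves are close
to each other, since both approximate \<open>b\<close> on the smaller box, whose area is a quarter of that of the
larger one.\<close>

lemma mean_step:
  assumes [measurable]: "b \<in> borel_measurable dA" and L: "L > 0" and B: "B \<ge> 0"
    and Q: "(\<integral>\<^sup>+z\<in>carleson_box {a..<a+L}. ennreal ((cmod (b z - m))\<^sup>2) \<partial>dA) \<le> ennreal (B\<^sup>2 * L\<^sup>2)"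
    and Q': "(\<integral>\<^sup>+z\<in>carleson_box {a'..<a'+L/2}. ennreal ((cmod (b z - m'))\<^sup>2) \<partial>dA)
      \<le> ennreal (B\<^sup>2 * (L/2)\<^sup>2)"
    and sub: "carleson_box {a'..<a'+L/2} \<subseteq> carleson_box {a..<a+L}"
  shows "cmod (m' - m) \<le> 4 * B"
proof -
  let ?Q' = "carleson_box {a'..<a'+L/2}" and ?Q = "carleson_box {a..<a+L}"
  have [measurable]: "?Q' \<in> sets dA" "?Q \<in> sets dA" by (rule carleson_box_sets_dA)+
  have "ennreal ((cmod (m' - m))\<^sup>2 * (L/2)\<^sup>2)
    = (\<integral>\<^sup>+z. ennreal ((cmod (m' - m))\<^sup>2) * indicator ?Q' z \<partial>dA)"
    using L emeasure_dA_carleson_box[of "L/2" a']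
      by (simp add: nn_integral_cmult_indicator ennreal_mult)
  also have "\<dots> \<le> (\<integral>\<^sup>+z. 2 * (ennreal ((cmod (b z - m'))\<^sup>2) * indicator ?Q' z)
    + 2 * (ennreal ((cmod (b z - m))\<^sup>2) * indicator ?Q z) \<partial>dA)"
  proof (intro nn_integral_mono)
    fix z
    show "ennreal ((cmod (m' - m))\<^sup>2) * indicator ?Q' z
      \<le> 2 * (ennreal ((cmod (b z - m'))\<^sup>2) * indicator ?Q' z) + 2 * (ennreal ((cmod (b z - m))\<^sup>2) * indicator ?Q z)"
      using ennreal_sq_triangle[of m' m "b z"] sub
      by (auto simp: norm_minus_commute split: split_indicator)
  qed
  also have "\<dots> = 2 * (\<integral>\<^sup>+z\<in>?Q'. ennreal ((cmod (b z - m'))\<^sup>2) \<partial>dA)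
    + 2 * (\<integral>\<^sup>+z\<in>?Q. ennreal ((cmod (b z - m))\<^sup>2) \<partial>dA)"
    by (subst nn_integral_add) (auto simp: nn_integral_cmult)
  also have "\<dots> \<le> 2 * ennreal (B\<^sup>2 * (L/2)\<^sup>2) + 2 * ennreal (B\<^sup>2 * L\<^sup>2)"
    by (intro add_mono mult_left_mono Q Q') auto
  also have "\<dots> = ennreal (2 * (B\<^sup>2 * (L/2)\<^sup>2) + 2 * (B\<^sup>2 * L\<^sup>2))"
    by (simp add: ennreal_mult)
  finally have "(cmod (m' - m))\<^sup>2 * (L/2)\<^sup>2 \<le> 2 * (B\<^sup>2 * (L/2)\<^sup>2) + 2 * (B\<^sup>2 * L\<^sup>2)"
    by (subst (asm) ennreal_le_iff) auto
  also have "\<dots> = 10 * B\<^sup>2 * (L/2)\<^sup>2" by (simp add: power2_eq_square)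
  also have "\<dots> \<le> (4 * B)\<^sup>2 * (L/2)\<^sup>2" by (intro mult_right_mono) (auto simp: power_mult_distrib)
  finally have "(cmod (m' - m))\<^sup>2 \<le> (4 * B)\<^sup>2" using L by simp
  then show ?thesis by (rule power2_le_imp_le) (use B in simp)
qed

text \<open>On the top layer the measure \<open>dA\<^sub>w \<alpha>\<close> is comparable with \<open>dA\<close>, up to the factor
\<open>L powr \<alpha>\<close>, so the unweighted oscillation over the box controls it for every \<open>\<alpha>\<close>.\<close>

lemma top_layer_osc:
  assumes \<alpha>: "\<alpha> > -1"
  obtains G where "G > 0"
    "\<And>b a L B m c. b \<in> borel_measurable dA \<Longrightarrow> 0 < L \<Longrightarrow> 0 \<le> B \<Longrightarrow>
      (\<integral>\<^sup>+z\<in>carleson_box {a..<a+L}. ennreal ((cmod (b z - m))\<^sup>2) \<partial>dA) \<le> ennreal (B\<^sup>2 * L\<^sup>2) \<Longrightarrow>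
      mass \<alpha> (layer 0 {a..<a+L}) (\<lambda>z. ennreal ((cmod (b z - c))\<^sup>2))
        \<le> ennreal (G * (B + cmod (m - c))\<^sup>2) * emeasure (dA\<^sub>w \<alpha>) (layer 0 {a..<a+L})"
proof -
  define C where "C = (\<alpha> + 1) / pi * 2 powr \<bar>\<alpha>\<bar>"
  define c0 where "c0 = (\<alpha> + 1) / pi * 2 powr (- \<bar>\<alpha>\<bar>)"
  have C: "C > 0" "c0 > 0" using \<alpha> by (auto simp: C_def c0_def)
  show thesis
  proof (rule that[of "4 * C / c0"])
    show "0 < 4 * C / c0" using C by simp
    fix b a L B m c
    assume [measurable]: "b \<in> borel_measurable dA" and L: "0 < L" and B: "0 \<le> B"
      and osc: "(\<integral>\<^sup>+z\<in>carleson_box {a..<a+L}. ennreal ((cmod (b z - m))\<^sup>2) \<partial>dA)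
        \<le> ennreal (B\<^sup>2 * L\<^sup>2)"
    let ?T = "layer 0 {a..<a+L}" and ?Q = "carleson_box {a..<a+L}"
    have [measurable]: "?T \<in> sets dA" "?Q \<in> sets dA"
      by (rule layer_sets_dA[OF L], rule carleson_box_sets_dA)
    define d where "d = cmod (m - c)"
    have d: "d \<ge> 0" by (simp add: d_def)
    have "mass \<alpha> ?T (\<lambda>z. ennreal ((cmod (b z - c))\<^sup>2)) =
       (\<integral>\<^sup>+z. ennreal (density_w \<alpha> z) * (ennreal ((cmod (b z - c))\<^sup>2) * indicator ?T z) \<partial>dA)"
      by (subst nn_integral_dAw) auto
    also have "\<dots> \<le> (\<integral>\<^sup>+z. ennreal (C * L powr \<alpha>) *
        (2 * (ennreal ((cmod (b z - m))\<^sup>2) * indicator ?Q z) + 2 * ennreal (d\<^sup>2) * indicator ?Q z) \<partial>dA)"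
    proof (intro nn_integral_mono)
      fix z
      show "ennreal (density_w \<alpha> z) * (ennreal ((cmod (b z - c))\<^sup>2) * indicator ?T z) \<le>
        ennreal (C * L powr \<alpha>) * (2 * (ennreal ((cmod (b z - m))\<^sup>2) * indicator ?Q z) + 2 * ennreal (d\<^sup>2) * indicator ?Q z)"
      proof (cases "z \<in> ?T")
        case True
        then have "z \<in> ?Q" using layer_sub_carleson_box[OF L] by blast
        moreover have "density_w \<alpha> z \<le> C * L powr \<alpha>"
          using density_w_layer(2)[OF \<alpha> L True] by (simp add: C_def)
        ultimately show ?thesis
          using ennreal_sq_triangle[of "b z" c m] True
          by (auto simp: d_def norm_minus_commute intro!: mult_mono ennreal_leI)
      qed simp
    qed
    also have "\<dots> = ennreal (C * L powr \<alpha>)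
      * (2 * (\<integral>\<^sup>+z\<in>?Q. ennreal ((cmod (b z - m))\<^sup>2) \<partial>dA) + 2 * ennreal (d\<^sup>2) * ennreal (L\<^sup>2))"
      by (subst nn_integral_cmult, measurable, subst nn_integral_add)
         (auto simp: nn_integral_cmult nn_integral_cmult_indicator emeasure_dA_carleson_box[OF L])
    also have "\<dots> \<le> ennreal (C * L powr \<alpha>)
      * (2 * ennreal (B\<^sup>2 * L\<^sup>2) + 2 * ennreal (d\<^sup>2) * ennreal (L\<^sup>2))"
      by (intro mult_left_mono add_mono osc) auto
    also have "\<dots> = ennreal (C * L powr \<alpha> * (2 * (B\<^sup>2 * L\<^sup>2) + 2 * d\<^sup>2 * L\<^sup>2))"
      using C by (simp add: ennreal_mult)
    also have "\<dots> \<le> ennreal (4 * C / c0 * (B + d)\<^sup>2 * (c0 / 2 * L powr (2 + \<alpha>)))"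
    proof (rule ennreal_leI)
      have "L powr (2 + \<alpha>) = L\<^sup>2 * L powr \<alpha>"
        using L powr_realpow[of L 2] by (simp add: powr_add)
      moreover have "B\<^sup>2 + d\<^sup>2 \<le> (B + d)\<^sup>2" using B d by (simp add: power2_eq_square algebra_simps)
      ultimately show "C * L powr \<alpha> * (2 * (B\<^sup>2 * L\<^sup>2) + 2 * d\<^sup>2 * L\<^sup>2)
        \<le> 4 * C / c0 * (B + d)\<^sup>2 * (c0 / 2 * L powr (2 + \<alpha>))"
        using C mult_left_mono[of "B\<^sup>2 + d\<^sup>2" "(B + d)\<^sup>2" "2 * C * L powr \<alpha> * L\<^sup>2"]
        by (simp add: algebra_simps)
    qed
    also have "\<dots> = ennreal (4 * C / c0 * (B + d)\<^sup>2) * ennreal (c0 / 2 * L powr (2 + \<alpha>))"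
      using C by (intro ennreal_mult) auto
    also have "\<dots> \<le> ennreal (4 * C / c0 * (B + d)\<^sup>2) * emeasure (dA\<^sub>w \<alpha>) ?T"
      using emeasure_dAw_layer(1)[OF \<alpha> L, of 0 a] unfolding c0_def by (intro mult_left_mono) auto
    finally show "mass \<alpha> ?T (\<lambda>z. ennreal ((cmod (b z - c))\<^sup>2))
        \<le> ennreal (4 * C / c0 * (B + cmod (m - c))\<^sup>2) * emeasure (dA\<^sub>w \<alpha>) ?T"
      unfolding d_def .
  qed
qed

text \<open>For \<open>j = 0\<close> the hypothesis \<open>const\<close> lets the weight be replaced by its average over the top layer. In
the induction step the approximating constant changes by at most \<open>4 * B\<close> on passing to a half
of the interval (\<open>mean_step\<close>). The claim is stated for all constants \<open>c\<close> so that \<open>c\<close> can stay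
fixed while the interval shrinks.\<close>

lemma weighted_layer_osc:
  assumes \<alpha>: "\<alpha> > -1" and D: "halving_family D"
    and [measurable]: "b \<in> borel_measurable dA" "s \<in> borel_measurable dA"
    and B: "B \<ge> 0" and A: "A \<ge> 0" and G: "G \<ge> 0"
    and osc: "\<And>I. I \<in> D \<Longrightarrow> (\<integral>\<^sup>+z\<in>carleson_box I. ennreal ((cmod (b z - m I))\<^sup>2) \<partial>dA)
      \<le> ennreal (B\<^sup>2 * (len I)\<^sup>2)"
    and toposc: "\<And>I c. I \<in> D \<Longrightarrow> mass \<alpha> (layer 0 I) (\<lambda>z. ennreal ((cmod (b z - c))\<^sup>2))
        \<le> ennreal (G * (B + cmod (m I - c))\<^sup>2) * emeasure (dA\<^sub>w \<alpha>) (layer 0 I)"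
    and const: "\<And>I. I \<in> D \<Longrightarrow> AE z in dA. z \<in> layer 0 I \<longrightarrow>
        s z * emeasure (dA\<^sub>w \<alpha>) (layer 0 I) \<le> ennreal A * mass \<alpha> (layer 0 I) s"
    and I: "I \<in> D"
  shows "mass \<alpha> (layer j I) (\<lambda>z. ennreal ((cmod (b z - c))\<^sup>2) * s z)
     \<le> ennreal (A * G * (B * (1 + 4 * real j) + cmod (m I - c))\<^sup>2) * mass \<alpha> (layer j I) s"
  using I
proof (induction j arbitrary: I)
  case 0
  obtain a L where L: "0 < L" and Ie: "I = {a..<a+L}" using halving_familyE[OF D 0] by metis
  have T[measurable]: "layer 0 I \<in> sets dA" unfolding Ie by (rule layer_sets_dA[OF L])
  define \<mu> where "\<mu> = emeasure (dA\<^sub>w \<alpha>) (layer 0 I)"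
  define S where "S = mass \<alpha> (layer 0 I) s"
  have \<mu>: "\<mu> \<noteq> 0" "\<mu> \<noteq> top" unfolding \<mu>_def Ie by (rule layer_measure_pos_finite[OF \<alpha> L])+
  have "\<mu> * mass \<alpha> (layer 0 I) (\<lambda>z. ennreal ((cmod (b z - c))\<^sup>2) * s z)
      = (\<integral>\<^sup>+z. \<mu> * (ennreal ((cmod (b z - c))\<^sup>2) * s z * indicator (layer 0 I) z) \<partial>dA\<^sub>w \<alpha>)"
    by (rule nn_integral_cmult[symmetric]) auto
  also have "\<dots> \<le> (\<integral>\<^sup>+z. (ennreal A * S)
    * (ennreal ((cmod (b z - c))\<^sup>2) * indicator (layer 0 I) z) \<partial>dA\<^sub>w \<alpha>)"
  proof (rule nn_integral_mono_AE, use const[OF 0, unfolded AE_dAw_iff[OF \<alpha>, symmetric]] in eventually_elim)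
    case (elim z)
    show ?case
    proof (cases "z \<in> layer 0 I")
      case True
      then have "ennreal ((cmod (b z - c))\<^sup>2) * (s z * \<mu>)
        \<le> ennreal ((cmod (b z - c))\<^sup>2) * (ennreal A * S)"
        using elim unfolding \<mu>_def S_def by (intro mult_left_mono) auto
      then show ?thesis using True by (simp add: mult_ac)
    qed simp
  qed
  also have "\<dots> = (ennreal A * S) * mass \<alpha> (layer 0 I) (\<lambda>z. ennreal ((cmod (b z - c))\<^sup>2))"
    by (rule nn_integral_cmult) auto
  also have "\<dots> \<le> (ennreal A * S) * (ennreal (G * (B + cmod (m I - c))\<^sup>2) * \<mu>)"
    unfolding \<mu>_def by (intro mult_left_mono toposc[OF 0]) auto
  also have "\<dots> = \<mu> * (ennreal (A * G * (B + cmod (m I - c))\<^sup>2) * S)"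
    using A G by (simp add: ennreal_mult mult_ac)
  finally have "mass \<alpha> (layer 0 I) (\<lambda>z. ennreal ((cmod (b z - c))\<^sup>2) * s z)
    \<le> ennreal (A * G * (B + cmod (m I - c))\<^sup>2) * S"
    using \<mu> ennreal_mult_le_mult_iff by blast
  then show ?case by (simp add: S_def)
next
  case (Suc j)
  obtain a L where L: "0 < L" and Ie: "I = {a..<a+L}" and I1: "{a..<a+L/2} \<in> D"
    and I2: "{a+L/2..<a+L/2+L/2} \<in> D"
    using halving_familyE[OF D Suc.prems] by metis
  let ?I1 = "{a..<a+L/2}" and ?I2 = "{a+L/2..<a+L/2+L/2}"
  have L2: "0 < L / 2" using L by simp
  let ?F = "\<lambda>S. \<integral>\<^sup>+z\<in>S. ennreal ((cmod (b z - c))\<^sup>2) * s z \<partial>dA\<^sub>w \<alpha>"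
  let ?S = "\<lambda>S. \<integral>\<^sup>+z\<in>S. s z \<partial>dA\<^sub>w \<alpha>"
  have osc': "(\<integral>\<^sup>+z\<in>carleson_box {a'..<a'+L'}. ennreal ((cmod (b z - m {a'..<a'+L'}))\<^sup>2) \<partial>dA)
    \<le> ennreal (B\<^sup>2 * L'\<^sup>2)"
    if "{a'..<a'+L'} \<in> D" "L' > 0" for a' L'
    using osc[OF that(1)] unfolding len_ico[OF that(2)] .
  have half: "?F (layer j {a'..<a'+L/2})
    \<le> ennreal (A * G * (B * (1 + 4 * real (Suc j)) + cmod (m I - c))\<^sup>2) * ?S (layer j {a'..<a'+L/2})"
    if I': "{a'..<a'+L/2} \<in> D" and sub: "carleson_box {a'..<a'+L/2} \<subseteq> carleson_box I" for a'
  proof -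
    have "cmod (m {a'..<a'+L/2} - m I) \<le> 4 * B"
      unfolding Ie
      by (rule mean_step[OF _ L B osc' osc' sub[unfolded Ie]]) (use I' Suc.prems Ie L in simp_all)
    then have "cmod (m {a'..<a'+L/2} - c) \<le> 4 * B + cmod (m I - c)"
      using norm_triangle_ineq[of "m {a'..<a'+L/2} - m I" "m I - c"] by simp
    then have le: "B * (1 + 4 * real j) + cmod (m {a'..<a'+L/2} - c)
      \<le> B * (1 + 4 * real (Suc j)) + cmod (m I - c)"
      by (simp add: algebra_simps)
    have "?F (layer j {a'..<a'+L/2})
      \<le> ennreal (A * G * (B * (1 + 4 * real j) + cmod (m {a'..<a'+L/2} - c))\<^sup>2) * ?S (layer j {a'..<a'+L/2})"
      by (rule Suc.IH[OF I'])
    also have "\<dots> \<le> ennreal (A * G * (B * (1 + 4 * real (Suc j)) + cmod (m I - c))\<^sup>2)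
      * ?S (layer j {a'..<a'+L/2})"
      using A G B le by (intro mult_right_mono ennreal_leI mult_left_mono power_mono) auto
    finally show ?thesis .
  qed
  have "?F (layer (Suc j) I) = ?F (layer j ?I1) + ?F (layer j ?I2)"
    unfolding Ie by (rule nn_integral_layer_Suc[OF L]) measurable
  also have "\<dots> \<le> ennreal (A * G * (B * (1 + 4 * real (Suc j)) + cmod (m I - c))\<^sup>2)
    * ?S (layer j ?I1)
       + ennreal (A * G * (B * (1 + 4 * real (Suc j)) + cmod (m I - c))\<^sup>2) * ?S (layer j ?I2)"
    using carleson_box_split(1)[OF L, of a] by (intro add_mono half I1 I2) (auto simp only: Ie)
  also have "\<dots> = ennreal (A * G * (B * (1 + 4 * real (Suc j)) + cmod (m I - c))\<^sup>2)
    * ?S (layer (Suc j) I)"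
    unfolding Ie by (subst nn_integral_layer_Suc[OF L]) (measurable, simp only: distrib_left)
  finally show ?case .
qed

section \<open>The kernel bound\<close>

lemma emeasure_dAw_carleson_box_finite_pos:
  assumes \<alpha>: "\<alpha> > -1" and L: "L > 0"
  shows "emeasure (dA\<^sub>w \<alpha>) (carleson_box {a..<a+L})
    = ennreal (measure (dA\<^sub>w \<alpha>) (carleson_box {a..<a+L}))"
    and "0 < measure (dA\<^sub>w \<alpha>) (carleson_box {a..<a+L})"
proof -
  obtain C where C: "C > 0" "\<And>a L. L > 0 \<Longrightarrow>
    emeasure (dA\<^sub>w \<alpha>) (carleson_box {a..<a+L}) \<le> ennreal (C * L powr (2 + \<alpha>))"
    using emeasure_dAw_carleson_box_le[OF \<alpha>] by metis
  have "emeasure (dA\<^sub>w \<alpha>) (carleson_box {a..<a+L}) < top"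
    using C(2)[OF L] by (rule le_less_trans) simp
  then show e: "emeasure (dA\<^sub>w \<alpha>) (carleson_box {a..<a+L})
    = ennreal (measure (dA\<^sub>w \<alpha>) (carleson_box {a..<a+L}))"
    by (intro emeasure_eq_ennreal_measure) simp
  have "emeasure (dA\<^sub>w \<alpha>) (layer 0 {a..<a+L}) \<le> emeasure (dA\<^sub>w \<alpha>) (carleson_box {a..<a+L})"
    by (intro emeasure_mono layer_sub_carleson_box L) (simp only: sets_dAw carleson_box_sets_dA)
  then have "emeasure (dA\<^sub>w \<alpha>) (carleson_box {a..<a+L}) \<noteq> 0"
    using layer_measure_pos_finite(1)[OF \<alpha> L, of 0 a] by auto
  then show "0 < measure (dA\<^sub>w \<alpha>) (carleson_box {a..<a+L})"
    unfolding e using measure_nonneg[of "dA\<^sub>w \<alpha>" "carleson_box {a..<a+L}"] by (auto simp: less_le)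
qed

text \<open>With \<open>R = cmod (z - cnj w)\<close>, the real parts differ by at most \<open>R\<close> and both heights are below
\<open>R\<close>. An interval of length \<open>2 * R\<close> starting at the smaller real part lies in some dyadic interval of
comparable length, and the box over the latter contains both points.\<close>

lemma kernel_cover:
  assumes \<alpha>: "\<alpha> > -1" and adj: "adjacent_dyadic_systems D1 D2"
  obtains \<kappa> where "\<kappa> > 0" "\<And>z w. z \<in> uhp \<Longrightarrow> w \<in> uhp \<Longrightarrow>
    \<exists>I\<in>D1 \<union> D2. \<exists>j k. z \<in> layer j I \<and> w \<in> layer k I \<and>
      1 / cmod (z - cnj w) powr (2 + \<alpha>) \<le> \<kappa> / measure (dA\<^sub>w \<alpha>) (carleson_box I)"
proof -
  obtain C where C: "C > 0" "\<And>a L. L > 0 \<Longrightarrow>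
    emeasure (dA\<^sub>w \<alpha>) (carleson_box {a..<a+L}) \<le> ennreal (C * L powr (2 + \<alpha>))"
    using emeasure_dAw_carleson_box_le[OF \<alpha>] by metis
  have D: "halving_family (D1 \<union> D2)"
    using adj unfolding adjacent_dyadic_systems_def
      by (intro halving_family_Un dyadic_system_halving) auto
  obtain C0 where C0: "\<And>I. bdd_interval I \<Longrightarrow> \<exists>J\<in>D1 \<union> D2. I \<subseteq> J \<and> len J \<le> C0 * len I"
    using adj unfolding adjacent_dyadic_systems_def by blast
  \<comment> \<open>Positivity of the constant is needed to divide by it.\<close>
  define C1 where "C1 = max C0 1"
  have C1: "C1 \<ge> C0" "C1 > 0" by (auto simp: C1_def)
  show thesis
  proof (rule that[of "C * (2 * C1) powr (2 + \<alpha>)"])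
    show "0 < C * (2 * C1) powr (2 + \<alpha>)" using C C1 by simp
    fix z w assume zw: "z \<in> uhp" "w \<in> uhp"
    define R where "R = cmod (z - cnj w)"
    have R: "Im z + Im w \<le> R" "\<bar>Re z - Re w\<bar> \<le> R"
      using abs_Im_le_cmod[of "z - cnj w"] abs_Re_le_cmod[of "z - cnj w"] by (auto simp: R_def)
    have im: "Im z > 0" "Im w > 0" using zw by (auto simp: uhp_def)
    have Rpos: "R > 0" using R im by linarith
    define x where "x = min (Re z) (Re w)"
    have "bdd_interval {x..x + 2 * R}" using Rpos by (auto simp: bdd_interval_def is_interval_cc)
    then obtain J where J: "J \<in> D1 \<union> D2" "{x..x + 2 * R} \<subseteq> J" "len J \<le> C0 * len {x..x + 2 * R}"
      using C0 by blast
    obtain a L where L: "0 < L" and Je: "J = {a..<a+L}" using halving_familyE[OF D J(1)] by metis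
    have lenJ: "len J = L" unfolding Je by (rule len_ico[OF L])
    have "x \<in> J" "x + 2 * R \<in> J" using J(2) Rpos by auto
    then have xa: "a \<le> x" "x + 2 * R < a + L" unfolding Je by auto
    have "L \<le> C0 * (2 * R)" using J(3) Rpos unfolding lenJ by simp
    also have "\<dots> \<le> C1 * (2 * R)" using C1 Rpos by (intro mult_right_mono) auto
    finally have LR: "L / (2 * C1) \<le> R" using C1 by (simp add: field_simps)
    have zin: "z \<in> carleson_box J" "w \<in> carleson_box J"
      unfolding Je mem_carleson_box[OF L] using xa R im by (auto simp: x_def)
    then obtain j k where jk: "z \<in> layer j J" "w \<in> layer k J"
      using layer_ex[OF L] unfolding Je by metis
    have m: "0 < measure (dA\<^sub>w \<alpha>) (carleson_box J)" "measure (dA\<^sub>w \<alpha>) (carleson_box J)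
      \<le> C * L powr (2 + \<alpha>)"
      using emeasure_dAw_carleson_box_finite_pos[OF \<alpha> L, of a] C(2)[OF L, of a] C(1) unfolding Je
        by auto
    have "L powr (2 + \<alpha>) / (2 * C1) powr (2 + \<alpha>) = (L / (2 * C1)) powr (2 + \<alpha>)"
      using L C1 by (simp add: powr_divide)
    also have "\<dots> \<le> R powr (2 + \<alpha>)" using LR L C1 \<alpha> by (intro powr_mono2) auto
    finally have "L powr (2 + \<alpha>) \<le> (2 * C1) powr (2 + \<alpha>) * R powr (2 + \<alpha>)"
      using C1 by (simp add: field_simps)
    then have "C * L powr (2 + \<alpha>) \<le> C * ((2 * C1) powr (2 + \<alpha>) * R powr (2 + \<alpha>))"
      using C by (intro mult_left_mono) auto
    with m(2) have "measure (dA\<^sub>w \<alpha>) (carleson_box J) \<le> C * (2 * C1) powr (2 + \<alpha>) * R powr (2 + \<alpha>)"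
      by simp
    then have "1 / R powr (2 + \<alpha>) \<le> C * (2 * C1) powr (2 + \<alpha>) / measure (dA\<^sub>w \<alpha>) (carleson_box J)"
      using m(1) Rpos by (simp add: field_simps)
    then show "\<exists>I\<in>D1 \<union> D2. \<exists>j k. z \<in> layer j I \<and> w \<in> layer k I \<and>
      1 / cmod (z - cnj w) powr (2 + \<alpha>) \<le> C * (2 * C1) powr (2 + \<alpha>) / measure (dA\<^sub>w \<alpha>) (carleson_box I)"
      unfolding R_def[symmetric] using J(1) jk by blast
  qed
qed

lemma layer_overlap:
  assumes "dyadic_system D1" "dyadic_system D2"
  shows "emeasure (count_space UNIV) {I \<in> D1 \<union> D2. z \<in> layer j I} \<le> 2"
proof -
  have 1: "finite {I \<in> D. z \<in> layer j I} \<and> card {I \<in> D. z \<in> layer j I} \<le> 1" if "dyadic_system D"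
    for D
  proof -
    have sub: "\<exists>J. {I \<in> D. z \<in> layer j I} \<subseteq> {J}"
    proof (cases "{I \<in> D. z \<in> layer j I} = {}")
      case False
      then obtain J where J: "J \<in> D" "z \<in> layer j J" by blast
      then have "{I \<in> D. z \<in> layer j I} \<subseteq> {J}"
        using dyadic_layer_unique[OF that _ J(1) _ J(2)] by blast
      then show ?thesis ..
    next
      case True
      then show ?thesis by (intro exI) (simp only: True empty_subsetI)
    qed
    then obtain J where J: "{I \<in> D. z \<in> layer j I} \<subseteq> {J}" ..
    then show ?thesis using card_mono[OF _ J] finite_subset[OF J] by simp
  qed
  have U: "{I \<in> D1 \<union> D2. z \<in> layer j I} = {I \<in> D1. z \<in> layer j I} \<union> {I \<in> D2. z \<in> layer j I}" by auto
  have fin: "finite {I \<in> D1 \<union> D2. z \<in> layer j I}" unfolding U using 1[OF assms(1)] 1[OF assms(2)]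
    by simp
  have "card {I \<in> D1 \<union> D2. z \<in> layer j I} \<le> 2"
    unfolding U using 1[OF assms(1)] 1[OF assms(2)] card_Un_le[of "{I \<in> D1. z \<in> layer j I}" "{I \<in> D2. z \<in> layer j I}"] by linarith
  then have "of_nat (card {I \<in> D1 \<union> D2. z \<in> layer j I}) \<le> (of_nat 2 :: ennreal)"
    by (rule of_nat_mono)
  then show ?thesis using fin by (subst emeasure_count_space_finite) auto
qed

text \<open>The function \<open>sel\<close> selects which of the two layers \<open>j\<close>, \<open>k\<close> is meant, so that the bound serves
both variables of the kernel. The factor 2 counts the two dyadic systems.\<close>

lemma layer_weights_sum:
  fixes g :: "nat \<Rightarrow> real" and sel :: "nat \<Rightarrow> nat \<Rightarrow> nat"
  assumes D: "dyadic_system D1" "dyadic_system D2" and g: "\<And>j. g j \<ge> 0" "g sums S"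
  shows "(\<integral>\<^sup>+(j, k, I). ennreal (g j * g k)
    * indicator (layer (sel j k) I) z \<partial>count_space (UNIV \<times> UNIV \<times> (D1 \<union> D2)))
     \<le> ennreal (2 * S\<^sup>2)"
proof -
  have S: "S \<ge> 0" using sums_le[OF _ sums_zero g(2)] g(1) by simp
  let ?D = "D1 \<union> D2"
  have "(\<integral>\<^sup>+(j, k, I). ennreal (g j * g k)
    * indicator (layer (sel j k) I) z \<partial>count_space (UNIV \<times> UNIV \<times> ?D))
    = (\<integral>\<^sup>+p. (case p of (j, k, I) \<Rightarrow> ennreal (g j * g k) * indicator {I \<in> ?D. z \<in> layer (sel j k) I} I) \<partial>count_space UNIV)"
    by (subst nn_integral_count_space_indicator) (auto intro!: nn_integral_cong split: split_indicator)
  also have "\<dots> = (\<integral>\<^sup>+j. \<integral>\<^sup>+q. (case q of (k, I) \<Rightarrow> ennreal (g j * g k)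
    * indicator {I \<in> ?D. z \<in> layer (sel j k) I} I) \<partial>count_space UNIV \<partial>count_space UNIV)"
    by (subst nn_integral_fst_count_space[symmetric]) simp
  also have "\<dots> = (\<integral>\<^sup>+j. \<integral>\<^sup>+k. \<integral>\<^sup>+I. ennreal (g j * g k)
    * indicator {I \<in> ?D. z \<in> layer (sel j k) I} I \<partial>count_space UNIV \<partial>count_space UNIV \<partial>count_space UNIV)"
    by (subst nn_integral_fst_count_space[symmetric]) simp
  also have "\<dots> = (\<integral>\<^sup>+j. \<integral>\<^sup>+k. ennreal (g j * g k)
    * emeasure (count_space UNIV) {I \<in> ?D. z \<in> layer (sel j k) I} \<partial>count_space UNIV \<partial>count_space UNIV)"
    by (intro nn_integral_cong) (simp add: nn_integral_cmult_indicator)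
  also have "\<dots> \<le> (\<integral>\<^sup>+j. \<integral>\<^sup>+k. ennreal (g j) * 2
    * ennreal (g k) \<partial>count_space UNIV \<partial>count_space UNIV)"
  proof (intro nn_integral_mono)
    fix j k :: nat
    have "ennreal (g j * g k) * emeasure (count_space UNIV) {I \<in> ?D. z \<in> layer (sel j k) I}
      \<le> ennreal (g j * g k) * 2"
      by (intro mult_left_mono layer_overlap D) simp
    also have "\<dots> = ennreal (g j) * 2 * ennreal (g k)" using g(1) by (simp add: ennreal_mult mult_ac)
    finally show "ennreal (g j * g k)
      * emeasure (count_space UNIV) {I \<in> ?D. z \<in> layer (sel j k) I} \<le> ennreal (g j) * 2 * ennreal (g k)" .
  qed
  also have "\<dots> = (\<integral>\<^sup>+j. ennreal (g j) * 2
    * (\<integral>\<^sup>+k. ennreal (g k) \<partial>count_space UNIV) \<partial>count_space UNIV)"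
    by (intro nn_integral_cong nn_integral_cmult) simp
  also have sum: "(\<integral>\<^sup>+k. ennreal (g k) \<partial>count_space UNIV) = ennreal S"
    unfolding nn_integral_count_space_nat by (rule suminf_ennreal_eq[OF g])
  also have "(\<integral>\<^sup>+j. ennreal (g j) * 2 * ennreal S \<partial>count_space UNIV) = ennreal S * 2 * ennreal S"
    by (simp add: nn_integral_multc sum)
  also have "\<dots> = ennreal (2 * S\<^sup>2)" using S by (simp add: power2_eq_square ennreal_mult mult_ac)
  finally show ?thesis .
qed

text \<open>Insert the constant \<open>c\<close> between \<open>b z\<close> and \<open>b w\<close>; then the double integral separates into products
of integrals over the two layers.\<close>

lemma block_Hilbert_Schmidt:
  assumes [measurable]: "b \<in> borel_measurable dA" "u \<in> borel_measurable dA" "v \<in> borel_measurable dA"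
      "P \<in> sets dA" "R \<in> sets dA"
    and r: "r \<ge> 0"
    and u: "mass \<alpha> P (\<lambda>z. (u z)\<^sup>2) \<le> U" "mass \<alpha> P (\<lambda>z. ennreal ((cmod (b z - c))\<^sup>2) * (u z)\<^sup>2)
      \<le> x * U"
    and v: "mass \<alpha> R (\<lambda>z. (v z)\<^sup>2) \<le> V" "mass \<alpha> R (\<lambda>z. ennreal ((cmod (b z - c))\<^sup>2) * (v z)\<^sup>2)
      \<le> y * V"
  shows "(\<integral>\<^sup>+ z. indicator P z * (\<integral>\<^sup>+ w. indicator R w
    * ((ennreal (r * cmod (b z - b w)))\<^sup>2 * (v w)\<^sup>2) \<partial>dA\<^sub>w \<alpha>) * (u z)\<^sup>2 \<partial>dA\<^sub>w \<alpha>)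
     \<le> ennreal (2 * r\<^sup>2) * (x + y) * (U * V)"
proof -
  have 1: "(\<integral>\<^sup>+ w. indicator R w * ((ennreal (r * cmod (b z - b w)))\<^sup>2 * (v w)\<^sup>2) \<partial>dA\<^sub>w \<alpha>)
    \<le> ennreal (2 * r\<^sup>2) * V * (ennreal ((cmod (b z - c))\<^sup>2) + y)" for z
  proof -
    have "(\<integral>\<^sup>+ w. indicator R w * ((ennreal (r * cmod (b z - b w)))\<^sup>2 * (v w)\<^sup>2) \<partial>dA\<^sub>w \<alpha>)
      \<le> (\<integral>\<^sup>+ w. ennreal (2 * r\<^sup>2) * (ennreal ((cmod (b z - c))\<^sup>2) * ((v w)\<^sup>2 * indicator R w) + ennreal ((cmod (b w - c))\<^sup>2) * (v w)\<^sup>2 * indicator R w) \<partial>dA\<^sub>w \<alpha>)"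
    proof (intro nn_integral_mono)
      fix w
      have "(ennreal (r * cmod (b z - b w)))\<^sup>2 = ennreal (r\<^sup>2) * ennreal ((cmod (b z - b w))\<^sup>2)"
        using r by (simp add: ennreal_power power_mult_distrib ennreal_mult)
      also have "\<dots> \<le> ennreal (r\<^sup>2)
        * (2 * ennreal ((cmod (b z - c))\<^sup>2) + 2 * ennreal ((cmod (b w - c))\<^sup>2))"
        by (intro mult_left_mono ennreal_sq_triangle) simp
      also have "\<dots> = ennreal (2 * r\<^sup>2)
        * (ennreal ((cmod (b z - c))\<^sup>2) + ennreal ((cmod (b w - c))\<^sup>2))"
        by (simp add: ennreal_mult distrib_left mult_ac)
      finally have "(ennreal (r * cmod (b z - b w)))\<^sup>2 * ((v w)\<^sup>2 * indicator R w)
         \<le> ennreal (2 * r\<^sup>2) * (ennreal ((cmod (b z - c))\<^sup>2) + ennreal ((cmod (b w - c))\<^sup>2)) * ((v w)\<^sup>2 * indicator R w)"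
        by (rule mult_right_mono) simp
      then show "indicator R w * ((ennreal (r * cmod (b z - b w)))\<^sup>2 * (v w)\<^sup>2) \<le>
        ennreal (2 * r\<^sup>2) * (ennreal ((cmod (b z - c))\<^sup>2) * ((v w)\<^sup>2 * indicator R w) + ennreal ((cmod (b w - c))\<^sup>2) * (v w)\<^sup>2 * indicator R w)"
        by (simp add: distrib_left distrib_right mult_ac)
    qed
    also have "\<dots> = ennreal (2 * r\<^sup>2) * (ennreal ((cmod (b z - c))\<^sup>2) * mass \<alpha> R (\<lambda>w. (v w)\<^sup>2)
        + mass \<alpha> R (\<lambda>w. ennreal ((cmod (b w - c))\<^sup>2) * (v w)\<^sup>2))"
      by (subst nn_integral_cmult, simp, subst nn_integral_add) (auto simp: nn_integral_cmult)
    also have "\<dots> \<le> ennreal (2 * r\<^sup>2) * (ennreal ((cmod (b z - c))\<^sup>2) * V + y * V)"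
      by (intro mult_left_mono add_mono v) auto
    also have "\<dots> = ennreal (2 * r\<^sup>2) * V * (ennreal ((cmod (b z - c))\<^sup>2) + y)"
      by (simp add: distrib_left mult_ac)
    finally show ?thesis .
  qed
  have "(\<integral>\<^sup>+ z. indicator P z * (\<integral>\<^sup>+ w. indicator R w
    * ((ennreal (r * cmod (b z - b w)))\<^sup>2 * (v w)\<^sup>2) \<partial>dA\<^sub>w \<alpha>) * (u z)\<^sup>2 \<partial>dA\<^sub>w \<alpha>)
    \<le> (\<integral>\<^sup>+ z. ennreal (2 * r\<^sup>2) * V * (ennreal ((cmod (b z - c))\<^sup>2) * (u z)\<^sup>2 * indicator P z + y * ((u z)\<^sup>2 * indicator P z)) \<partial>dA\<^sub>w \<alpha>)"
  proof (intro nn_integral_mono)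
    fix z
    have "indicator P z * (\<integral>\<^sup>+ w. indicator R w
      * ((ennreal (r * cmod (b z - b w)))\<^sup>2 * (v w)\<^sup>2) \<partial>dA\<^sub>w \<alpha>) * (u z)\<^sup>2
      \<le> indicator P z * (ennreal (2 * r\<^sup>2) * V * (ennreal ((cmod (b z - c))\<^sup>2) + y)) * (u z)\<^sup>2"
      by (intro mult_right_mono mult_left_mono 1) auto
    then show "indicator P z * (\<integral>\<^sup>+ w. indicator R w
      * ((ennreal (r * cmod (b z - b w)))\<^sup>2 * (v w)\<^sup>2) \<partial>dA\<^sub>w \<alpha>) * (u z)\<^sup>2
      \<le> ennreal (2 * r\<^sup>2) * V * (ennreal ((cmod (b z - c))\<^sup>2) * (u z)\<^sup>2 * indicator P z + y * ((u z)\<^sup>2 * indicator P z))"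
      by (simp add: distrib_left distrib_right mult_ac)
  qed
  also have "\<dots> = ennreal (2 * r\<^sup>2) * V
    * (mass \<alpha> P (\<lambda>z. ennreal ((cmod (b z - c))\<^sup>2) * (u z)\<^sup>2) + y * mass \<alpha> P (\<lambda>z. (u z)\<^sup>2))"
    by (subst nn_integral_cmult, simp, subst nn_integral_add) (auto simp: nn_integral_cmult)
  also have "\<dots> \<le> ennreal (2 * r\<^sup>2) * V * (x * U + y * U)"
    by (intro mult_left_mono add_mono u) auto
  also have "\<dots> = ennreal (2 * r\<^sup>2) * (x + y) * (U * V)"
    by (simp add: distrib_left distrib_right mult_ac)
  finally show ?thesis .
qed

text \<open>The blocks are indexed by \<open>(j, k, I)\<close> and carry the weights \<open>g j * g k\<close>, where
\<open>g j = (1 + 4 * j) * sqrt \<delta> ^ j\<close> combines the linear growth of the oscillation with the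
square root of the mass decay. The constants \<open>m I\<close> play the part of the means of \<open>b\<close>.\<close>

lemma commutator_kernel_bound:
  assumes \<alpha>: "\<alpha> > -1" and adj: "adjacent_dyadic_systems D1 D2"
    and um: "u \<in> borel_measurable dA" and vm: "v \<in> borel_measurable dA"
    and uv: "AE z in dA. u z * v z = 1"
    and N: "N \<ge> 0" and A: "A \<ge> 0"
    and B2: "\<And>I. I \<in> D1 \<union> D2 \<Longrightarrow> mass \<alpha> (carleson_box I) (\<lambda>z. (u z)\<^sup>2)
      * mass \<alpha> (carleson_box I) (\<lambda>z. (v z)\<^sup>2)
        \<le> ennreal N * (emeasure (dA\<^sub>w \<alpha>) (carleson_box I))\<^sup>2"
    and finu: "\<And>I. I \<in> D1 \<union> D2 \<Longrightarrow> mass \<alpha> (carleson_box I) (\<lambda>z. (u z)\<^sup>2) < \<infinity>"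
    and finv: "\<And>I. I \<in> D1 \<union> D2 \<Longrightarrow> mass \<alpha> (carleson_box I) (\<lambda>z. (v z)\<^sup>2) < \<infinity>"
    and constu: "\<And>I. I \<in> D1 \<union> D2 \<Longrightarrow> AE z in dA. z \<in> layer 0 I \<longrightarrow>
        (u z)\<^sup>2 * emeasure (dA\<^sub>w \<alpha>) (layer 0 I) \<le> ennreal A * mass \<alpha> (layer 0 I) (\<lambda>z. (u z)\<^sup>2)"
    and constv: "\<And>I. I \<in> D1 \<union> D2 \<Longrightarrow> AE z in dA. z \<in> layer 0 I \<longrightarrow>
        (v z)\<^sup>2 * emeasure (dA\<^sub>w \<alpha>) (layer 0 I) \<le> ennreal A * mass \<alpha> (layer 0 I) (\<lambda>z. (v z)\<^sup>2)"
  obtains K where "K \<ge> 0"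
    "\<And>b B m f. b \<in> borel_measurable dA \<Longrightarrow> B \<ge> 0 \<Longrightarrow>
      (\<And>I. I \<in> D1 \<union> D2 \<Longrightarrow> (\<integral>\<^sup>+z\<in>carleson_box I. ennreal ((cmod (b z - m I))\<^sup>2) \<partial>dA) \<le> ennreal (B\<^sup>2 * (len I)\<^sup>2)) \<Longrightarrow>
      f \<in> borel_measurable dA \<Longrightarrow>
      (\<integral>\<^sup>+ z. (\<integral>\<^sup>+ w. ennreal (cmod (b z - b w) / cmod (z - cnj w) powr (2 + \<alpha>)) * f w \<partial>dA\<^sub>w \<alpha>)\<^sup>2 * (u z)\<^sup>2 \<partial>dA\<^sub>w \<alpha>)
        \<le> ennreal ((K * B)\<^sup>2) * (\<integral>\<^sup>+ w. (f w)\<^sup>2 * (u w)\<^sup>2 \<partial>dA\<^sub>w \<alpha>)"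
proof -
  let ?D = "D1 \<union> D2"
  have dy: "dyadic_system D1" "dyadic_system D2" using adj
    by (auto simp: adjacent_dyadic_systems_def)
  have D: "halving_family ?D" by (intro halving_family_Un dyadic_system_halving dy)
  obtain \<kappa> where \<kappa>: "\<kappa> > 0"
    "\<And>a L. L > 0 \<Longrightarrow> emeasure (dA\<^sub>w \<alpha>) (carleson_box {a..<a+L})
      \<le> ennreal \<kappa> * emeasure (dA\<^sub>w \<alpha>) (layer 0 {a..<a+L})"
    using carleson_box_le_top_layer[OF \<alpha>] by blast
  obtain \<rho> where \<rho>: "\<rho> > 0" "\<And>z w. z \<in> uhp \<Longrightarrow> w \<in> uhp \<Longrightarrow>
    \<exists>I\<in>?D. \<exists>j k. z \<in> layer j I \<and> w \<in> layer k I \<and>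
      1 / cmod (z - cnj w) powr (2 + \<alpha>) \<le> \<rho> / measure (dA\<^sub>w \<alpha>) (carleson_box I)"
    using kernel_cover[OF \<alpha> adj] by blast
  obtain G where G: "G > 0"
    "\<And>b a L B m c. b \<in> borel_measurable dA \<Longrightarrow> 0 < L \<Longrightarrow> 0 \<le> B \<Longrightarrow>
      (\<integral>\<^sup>+z\<in>carleson_box {a..<a+L}. ennreal ((cmod (b z - m))\<^sup>2) \<partial>dA) \<le> ennreal (B\<^sup>2 * L\<^sup>2) \<Longrightarrow>
      mass \<alpha> (layer 0 {a..<a+L}) (\<lambda>z. ennreal ((cmod (b z - c))\<^sup>2))
        \<le> ennreal (G * (B + cmod (m - c))\<^sup>2) * emeasure (dA\<^sub>w \<alpha>) (layer 0 {a..<a+L})"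
    using top_layer_osc[OF \<alpha>] by blast
  \<comment> \<open>The maximum with 2 keeps \<open>\<delta>\<close> away from 0, as the block weights have to be positive.\<close>
  define \<Theta> where "\<Theta> = max (N * \<kappa>\<^sup>2) 2"
  have \<Theta>: "\<Theta> \<ge> 2" "N * \<kappa>\<^sup>2 \<le> \<Theta>" by (auto simp: \<Theta>_def)
  define \<delta> where "\<delta> = 1 - 1 / \<Theta>"
  have \<delta>: "0 < \<delta>" "\<delta> < 1" using \<Theta> by (auto simp: \<delta>_def field_simps)
  define \<theta> where "\<theta> = sqrt \<delta>"
  have \<theta>: "0 < \<theta>" "\<theta> < 1" "\<theta>\<^sup>2 = \<delta>" using \<delta> by (auto simp: \<theta>_def)
  define g where "g j = (1 + 4 * real j) * \<theta> ^ j" for j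
  have g0: "g j > 0" for j using \<theta> by (simp add: g_def add_pos_nonneg)
  define S where "S = 4 * (1 / (1 - \<theta>)\<^sup>2) - 3 * (1 / (1 - \<theta>))"
  have gS: "g sums S"
  proof -
    have "(\<lambda>j. 4 * (of_nat (Suc j) * \<theta> ^ j) - 3 * \<theta> ^ j) sums S"
      unfolding S_def using \<theta> by (intro sums_diff sums_mult geometric_deriv_sums geometric_sums) auto
    moreover have "4 * (of_nat (Suc j) * \<theta> ^ j) - 3 * \<theta> ^ j = g j" for j
      by (simp add: g_def algebra_simps)
    ultimately show ?thesis by simp
  qed
  have vu: "AE z in dA. v z * u z = 1" using uv by (simp add: mult.commute)
  have B2': "mass \<alpha> (carleson_box I) (\<lambda>z. (v z)\<^sup>2) * mass \<alpha> (carleson_box I) (\<lambda>z. (u z)\<^sup>2)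
        \<le> ennreal N * (emeasure (dA\<^sub>w \<alpha>) (carleson_box I))\<^sup>2" if "I \<in> ?D" for I
    using B2[OF that] by (simp add: mult.commute)
  \<comment> \<open>Stated for arbitrary \<open>u\<close> and \<open>v\<close>: it is applied to the pair and to the pair exchanged.\<close>
  have decay: "mass \<alpha> (layer j I) (\<lambda>z. (u z)\<^sup>2)
    \<le> ennreal (\<delta> ^ j) * mass \<alpha> (carleson_box I) (\<lambda>z. (u z)\<^sup>2)"
    if um: "u \<in> borel_measurable dA" and vm: "v \<in> borel_measurable dA"
      and uv: "AE z in dA. u z * v z = 1"
     and B2: "\<And>I. I \<in> ?D \<Longrightarrow> mass \<alpha> (carleson_box I) (\<lambda>z. (u z)\<^sup>2)
       * mass \<alpha> (carleson_box I) (\<lambda>z. (v z)\<^sup>2)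
        \<le> ennreal N * (emeasure (dA\<^sub>w \<alpha>) (carleson_box I))\<^sup>2"
     and fin: "\<And>I. I \<in> ?D \<Longrightarrow> mass \<alpha> (carleson_box I) (\<lambda>z. (u z)\<^sup>2) < \<infinity>"
     and I: "I \<in> ?D" for I j and u v :: "complex \<Rightarrow> ennreal"
    unfolding \<delta>_def
  proof (rule layer_decay[OF D _ _ fin _ I])
    show "(\<lambda>z. (u z)\<^sup>2) \<in> borel_measurable dA" using um by measurable
    show "1 \<le> \<Theta>" using \<Theta> by simp
    fix I assume I: "I \<in> ?D"
    obtain a L where L: "0 < L" and Ie: "I = {a..<a+L}" using halving_familyE[OF D I] by metis
    have "mass \<alpha> (carleson_box I) (\<lambda>z. (u z)\<^sup>2)
      \<le> ennreal (N * \<kappa>\<^sup>2) * mass \<alpha> (layer 0 I) (\<lambda>z. (u z)\<^sup>2)"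
      using B2[OF I] unfolding Ie
      by (intro box_mass_le_top_layer_mass[OF \<alpha> L um vm uv _ \<kappa>(1) \<kappa>(2)[OF L] N])
    also have "\<dots> \<le> ennreal \<Theta> * mass \<alpha> (layer 0 I) (\<lambda>z. (u z)\<^sup>2)"
      by (intro mult_right_mono ennreal_leI \<Theta>) simp
    finally show "mass \<alpha> (carleson_box I) (\<lambda>z. (u z)\<^sup>2)
      \<le> ennreal \<Theta> * mass \<alpha> (layer 0 I) (\<lambda>z. (u z)\<^sup>2)" .
  qed
  note decay_u = decay[OF um vm uv B2 finu] and decay_v = decay[OF vm um vu B2' finv]
  \<comment> \<open>One factor 2 comes from inserting the mean of \<open>b\<close>, the other from \<open>p + q \<le> 2 * (p * q)\<close> below.\<close>
  define C where "C = 4 * \<rho>\<^sup>2 * A * G * N"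
  have C: "C \<ge> 0" using A G N by (simp add: C_def)
  define X where "X = (UNIV :: nat set) \<times> (UNIV :: nat set) \<times> ?D"
  show thesis
  proof (rule that[of "sqrt C * (2 * S\<^sup>2)"])
    show "0 \<le> sqrt C * (2 * S\<^sup>2)" using C by simp
    fix b B m and f :: "complex \<Rightarrow> ennreal"
    assume bm: "b \<in> borel_measurable dA" and B: "0 \<le> B"
      and osc: "\<And>I. I \<in> ?D \<Longrightarrow> (\<integral>\<^sup>+z\<in>carleson_box I. ennreal ((cmod (b z - m I))\<^sup>2) \<partial>dA)
        \<le> ennreal (B\<^sup>2 * (len I)\<^sup>2)"
      and fm: "f \<in> borel_measurable dA"
    have toposc: "mass \<alpha> (layer 0 I) (\<lambda>z. ennreal ((cmod (b z - c))\<^sup>2))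
        \<le> ennreal (G * (B + cmod (m I - c))\<^sup>2) * emeasure (dA\<^sub>w \<alpha>) (layer 0 I)" if I: "I \<in> ?D" for I c
    proof -
      obtain a L where L: "0 < L" and Ie: "I = {a..<a+L}" using halving_familyE[OF D I] by metis
      show ?thesis
        unfolding Ie by (rule G(2)[OF bm L B]) (use osc[OF I] in \<open>simp only: Ie len_ico[OF L]\<close>)
    qed
    have layer_osc: "mass \<alpha> (layer j I) (\<lambda>z. ennreal ((cmod (b z - m I))\<^sup>2) * (u z)\<^sup>2)
       \<le> ennreal (A * G * (B * (1 + 4 * real j))\<^sup>2) * (ennreal (\<delta> ^ j) * mass \<alpha> (carleson_box I) (\<lambda>z. (u z)\<^sup>2))"
      if um: "u \<in> borel_measurable dA"
        and const: "\<And>I. I \<in> ?D \<Longrightarrow> AE z in dA. z \<in> layer 0 I \<longrightarrow>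
          (u z)\<^sup>2 * emeasure (dA\<^sub>w \<alpha>) (layer 0 I) \<le> ennreal A * mass \<alpha> (layer 0 I) (\<lambda>z. (u z)\<^sup>2)"
        and decay: "\<And>I j. I \<in> ?D \<Longrightarrow>
          mass \<alpha> (layer j I) (\<lambda>z. (u z)\<^sup>2) \<le> ennreal (\<delta> ^ j) * mass \<alpha> (carleson_box I) (\<lambda>z. (u z)\<^sup>2)"
        and I: "I \<in> ?D" for j I and u :: "complex \<Rightarrow> ennreal"
    proof -
      have u2: "(\<lambda>z. (u z)\<^sup>2) \<in> borel_measurable dA" using um by measurable
      have "mass \<alpha> (layer j I) (\<lambda>z. ennreal ((cmod (b z - m I))\<^sup>2) * (u z)\<^sup>2)
         \<le> ennreal (A * G * (B * (1 + 4 * real j) + cmod (m I - m I))\<^sup>2) * mass \<alpha> (layer j I) (\<lambda>z. (u z)\<^sup>2)"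
        by (rule weighted_layer_osc[OF \<alpha> D bm u2 B A less_imp_le[OF G(1)] osc toposc const I])
      also have "\<dots> \<le> ennreal (A * G * (B * (1 + 4 * real j) + cmod (m I - m I))\<^sup>2)
        * (ennreal (\<delta> ^ j) * mass \<alpha> (carleson_box I) (\<lambda>z. (u z)\<^sup>2))"
        by (intro mult_left_mono decay I) simp
      finally show ?thesis by simp
    qed
    have setsI: "layer j I \<in> sets dA" if I: "I \<in> ?D" for j I
    proof -
      obtain a L where L: "0 < L" and Ie: "I = {a..<a+L}" using halving_familyE[OF D I] by metis
      show ?thesis unfolding Ie by (rule layer_sets_dA[OF L])
    qed
    have HS: "(\<integral>\<^sup>+ z. indicator (layer j I) z * (\<integral>\<^sup>+ w. indicator (layer k I) w *
         ((ennreal (\<rho> / measure (dA\<^sub>w \<alpha>) (carleson_box I) * cmod (b z - b w)))\<^sup>2 * (v w)\<^sup>2) \<partial>dA\<^sub>w \<alpha>) * (u z)\<^sup>2 \<partial>dA\<^sub>w \<alpha>)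
        \<le> ennreal (C * B\<^sup>2) * ennreal ((g j * g k)\<^sup>2)" if I: "I \<in> ?D" for j k I
    proof -
      obtain a L where L: "0 < L" and Ie: "I = {a..<a+L}" using halving_familyE[OF D I] by metis
      define \<mu> where "\<mu> = measure (dA\<^sub>w \<alpha>) (carleson_box I)"
      have \<mu>: "\<mu> > 0" "emeasure (dA\<^sub>w \<alpha>) (carleson_box I) = ennreal \<mu>"
        unfolding \<mu>_def Ie using emeasure_dAw_carleson_box_finite_pos[OF \<alpha> L] by blast+
      define s where "s = mass \<alpha> (carleson_box I) (\<lambda>z. (u z)\<^sup>2)"
      define t where "t = mass \<alpha> (carleson_box I) (\<lambda>z. (v z)\<^sup>2)"
      have st: "s * t \<le> ennreal (N * \<mu>\<^sup>2)"
        using B2[OF I] N \<mu> unfolding s_def t_def by (simp add: ennreal_mult ennreal_power)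
      let ?x = "A * G * (B * (1 + 4 * real j))\<^sup>2" and ?y = "A * G * (B * (1 + 4 * real k))\<^sup>2"
      have xy: "?x \<ge> 0" "?y \<ge> 0" using A G by auto
      have "(\<integral>\<^sup>+ z. indicator (layer j I) z * (\<integral>\<^sup>+ w. indicator (layer k I) w *
         ((ennreal (\<rho> / \<mu> * cmod (b z - b w)))\<^sup>2 * (v w)\<^sup>2) \<partial>dA\<^sub>w \<alpha>) * (u z)\<^sup>2 \<partial>dA\<^sub>w \<alpha>)
         \<le> ennreal (2 * (\<rho> / \<mu>)\<^sup>2) * (ennreal ?x + ennreal ?y) * ((ennreal (\<delta> ^ j) * s) * (ennreal (\<delta> ^ k) * t))"
        unfolding s_def t_def
        by (rule block_Hilbert_Schmidt[OF bm um vm setsI[OF I] setsI[OF I] _ decay_u[OF _ _ I] layer_osc[OF um constu decay_u I] decay_v[OF _ _ I] layer_osc[OF vm constv decay_v I]])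
           (use \<rho> \<mu> in simp_all)
      also have "\<dots> = ennreal (2 * (\<rho> / \<mu>)\<^sup>2 * (?x + ?y) * (\<delta> ^ j * \<delta> ^ k)) * (s * t)"
        using xy \<delta> by (simp add: ennreal_mult mult_ac)
      also have "\<dots> \<le> ennreal (2 * (\<rho> / \<mu>)\<^sup>2 * (?x + ?y) * (\<delta> ^ j * \<delta> ^ k)) * ennreal (N * \<mu>\<^sup>2)"
        by (intro mult_left_mono st) simp
      also have "\<dots> = ennreal (2 * (\<rho> / \<mu>)\<^sup>2 * (?x + ?y) * (\<delta> ^ j * \<delta> ^ k) * (N * \<mu>\<^sup>2))"
        using N xy \<delta> by (intro ennreal_mult[symmetric]) auto
      also have "\<dots> \<le> ennreal (C * B\<^sup>2 * (g j * g k)\<^sup>2)"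
      proof (rule ennreal_leI)
        define p where "p = (1 + 4 * real j)\<^sup>2" define q where "q = (1 + 4 * real k)\<^sup>2"
        have pq: "p \<ge> 1" "q \<ge> 1" by (auto simp: p_def q_def)
        have "p * 1 \<le> p * q" "1 * q \<le> p * q"
          using pq by (intro mult_left_mono mult_right_mono; simp)+
        then have "p + q \<le> 2 * (p * q)" by linarith
        have gg: "(g j * g k)\<^sup>2 = p * q * (\<delta> ^ j * \<delta> ^ k)"
          unfolding g_def p_def q_def \<theta>(3)[symmetric]
            by (simp add: power_mult_distrib power_mult[symmetric] mult_ac)
        have "2 * (\<rho> / \<mu>)\<^sup>2 * (?x + ?y) * (\<delta> ^ j * \<delta> ^ k) * (N * \<mu>\<^sup>2) =
          (2 * \<rho>\<^sup>2 * A * G * N * B\<^sup>2 * (\<delta> ^ j * \<delta> ^ k)) * (p + q)"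
        proof -
          have r: "(\<rho> / \<mu>)\<^sup>2 * \<mu>\<^sup>2 = \<rho>\<^sup>2" using \<mu>(1) by (simp add: power_divide)
          have "?x + ?y = A * G * B\<^sup>2 * (p + q)" unfolding p_def q_def power_mult_distrib by algebra
          then have "2 * (\<rho> / \<mu>)\<^sup>2 * (?x + ?y) * (\<delta> ^ j * \<delta> ^ k) * (N * \<mu>\<^sup>2)
            = 2 * ((\<rho> / \<mu>)\<^sup>2 * \<mu>\<^sup>2) * (A * G * B\<^sup>2 * (p + q)) * (\<delta> ^ j * \<delta> ^ k) * N"
            by (simp only: mult_ac)
          then show ?thesis unfolding r by (simp only: mult_ac)
        qed
        also have "\<dots> \<le> (2 * \<rho>\<^sup>2 * A * G * N * B\<^sup>2 * (\<delta> ^ j * \<delta> ^ k)) * (2 * (p * q))"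
          using A G N \<delta> by (intro mult_left_mono \<open>p + q \<le> 2 * (p * q)\<close>) auto
        also have "\<dots> = C * B\<^sup>2 * (g j * g k)\<^sup>2" unfolding gg C_def by (simp add: mult_ac)
        finally show "2 * (\<rho> / \<mu>)\<^sup>2 * (?x + ?y) * (\<delta> ^ j * \<delta> ^ k) * (N * \<mu>\<^sup>2)
          \<le> C * B\<^sup>2 * (g j * g k)\<^sup>2" .
      qed
      also have "\<dots> = ennreal (C * B\<^sup>2) * ennreal ((g j * g k)\<^sup>2)" using C
        by (intro ennreal_mult) auto
      finally show ?thesis unfolding \<mu>_def .
    qed
    have "(\<integral>\<^sup>+ z. (\<integral>\<^sup>+ w. ennreal (cmod (b z - b w) / cmod (z - cnj w) powr (2 + \<alpha>))
      * f w \<partial>dA\<^sub>w \<alpha>)\<^sup>2 * (u z)\<^sup>2 \<partial>dA\<^sub>w \<alpha>)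
        \<le> ennreal (C * B\<^sup>2) * (ennreal (2 * S\<^sup>2))\<^sup>2 * (\<integral>\<^sup>+ w. (f w)\<^sup>2 * (u w)\<^sup>2 \<partial>dA\<^sub>w \<alpha>)"
    proof (rule block_schur_test[where M = "dA\<^sub>w \<alpha>" and X = X and A = "\<lambda>(j, k, I). layer j I"
      and B = "\<lambda>(j, k, I). layer k I"
          and k = "\<lambda>(j, k, I) z w. ennreal (\<rho> / measure (dA\<^sub>w \<alpha>) (carleson_box I)
            * cmod (b z - b w))"
          and \<epsilon> = "\<lambda>(j, k, I). g j * g k" and u = u and v = v])
      show "sigma_finite_measure (dA\<^sub>w \<alpha>)" by (rule sigma_finite_dAw)
      show "countable X" unfolding X_def
        by (intro countable_SIGMA countable_Un dyadic_system_countable dy) auto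
      show "u \<in> borel_measurable (dA\<^sub>w \<alpha>)" "v \<in> borel_measurable (dA\<^sub>w \<alpha>)" "f \<in> borel_measurable (dA\<^sub>w \<alpha>)"
        using um vm fm by simp_all
      show "AE w in dA\<^sub>w \<alpha>. u w * v w = 1" unfolding AE_dAw_iff[OF \<alpha>] by (rule uv)
    next
      fix p assume p: "p \<in> X"
      then obtain j k I where pe: "p = (j, k, I)" and I: "I \<in> ?D" by (auto simp: X_def)
      show "(case p of (j, k, I) \<Rightarrow> layer j I) \<in> sets (dA\<^sub>w \<alpha>)" "(case p of (j, k, I) \<Rightarrow> layer k I) \<in> sets (dA\<^sub>w \<alpha>)"
        unfolding pe using setsI[OF I] by simp_all
      show "(case p of (j, k, I) \<Rightarrow> g j * g k) > 0" unfolding pe using g0 by simp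
      have [measurable]: "b \<in> borel_measurable (dA\<^sub>w \<alpha>)" using bm by simp
      show "(\<lambda>(z, w). (case p of (j, k, I) \<Rightarrow> \<lambda>z w. ennreal (\<rho> / measure (dA\<^sub>w \<alpha>) (carleson_box I)
        * cmod (b z - b w))) z w)
        \<in> borel_measurable (dA\<^sub>w \<alpha> \<Otimes>\<^sub>M dA\<^sub>w \<alpha>)"
        unfolding pe prod.case by measurable
      show "(\<integral>\<^sup>+ z. indicator (case p of (j, k, I) \<Rightarrow> layer j I) z
        * (\<integral>\<^sup>+ w. indicator (case p of (j, k, I) \<Rightarrow> layer k I) w *
         (((case p of (j, k, I) \<Rightarrow> \<lambda>z w. ennreal (\<rho> / measure (dA\<^sub>w \<alpha>) (carleson_box I) * cmod (b z - b w))) z w)\<^sup>2 * (v w)\<^sup>2) \<partial>dA\<^sub>w \<alpha>) * (u z)\<^sup>2 \<partial>dA\<^sub>w \<alpha>)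
        \<le> ennreal (C * B\<^sup>2) * ennreal ((case p of (j, k, I) \<Rightarrow> g j * g k)\<^sup>2)"
        unfolding pe prod.case by (rule HS[OF I])
    next
      fix z assume "z \<in> space (dA\<^sub>w \<alpha>)"
      have "(\<integral>\<^sup>+(j, k, I). ennreal (g j * g k) * indicator (layer j I) z \<partial>count_space X)
        \<le> ennreal (2 * S\<^sup>2)"
        unfolding X_def by (rule layer_weights_sum[OF dy less_imp_le[OF g0] gS])
      also have "(\<integral>\<^sup>+(j, k, I). ennreal (g j * g k) * indicator (layer j I) z \<partial>count_space X) =
        (\<integral>\<^sup>+ p. ennreal (case p of (j, k, I) \<Rightarrow> g j * g k) * indicator (case p of (j, k, I) \<Rightarrow> layer j I) z \<partial>count_space X)"
        by (intro nn_integral_cong) (simp split: prod.split)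
      finally show "(\<integral>\<^sup>+ p. ennreal (case p of (j, k, I) \<Rightarrow> g j * g k)
        * indicator (case p of (j, k, I) \<Rightarrow> layer j I) z \<partial>count_space X) \<le> ennreal (2 * S\<^sup>2)" .
    next
      fix z assume "z \<in> space (dA\<^sub>w \<alpha>)"
      have "(\<integral>\<^sup>+(j, k, I). ennreal (g j * g k) * indicator (layer k I) z \<partial>count_space X)
        \<le> ennreal (2 * S\<^sup>2)"
        unfolding X_def by (rule layer_weights_sum[OF dy less_imp_le[OF g0] gS])
      also have "(\<integral>\<^sup>+(j, k, I). ennreal (g j * g k) * indicator (layer k I) z \<partial>count_space X) =
        (\<integral>\<^sup>+ p. ennreal (case p of (j, k, I) \<Rightarrow> g j * g k) * indicator (case p of (j, k, I) \<Rightarrow> layer k I) z \<partial>count_space X)"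
        by (intro nn_integral_cong) (simp split: prod.split)
      finally show "(\<integral>\<^sup>+ p. ennreal (case p of (j, k, I) \<Rightarrow> g j * g k)
        * indicator (case p of (j, k, I) \<Rightarrow> layer k I) z \<partial>count_space X) \<le> ennreal (2 * S\<^sup>2)" .
    next
      fix z w assume "z \<in> space (dA\<^sub>w \<alpha>)" "w \<in> space (dA\<^sub>w \<alpha>)"
      then obtain I j k where I: "I \<in> ?D" and jk: "z \<in> layer j I" "w \<in> layer k I"
        and le: "1 / cmod (z - cnj w) powr (2 + \<alpha>) \<le> \<rho> / measure (dA\<^sub>w \<alpha>) (carleson_box I)"
        using \<rho>(2)[of z w] by auto
      have p: "(j, k, I) \<in> X" using I by (simp add: X_def)
      have "ennreal (cmod (b z - b w) / cmod (z - cnj w) powr (2 + \<alpha>))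
        \<le> ennreal (\<rho> / measure (dA\<^sub>w \<alpha>) (carleson_box I) * cmod (b z - b w))"
        using mult_right_mono[OF le, of "cmod (b z - b w)"] by (intro ennreal_leI) simp
      also have "\<dots> = (\<lambda>p. indicator (case p of (j, k, I) \<Rightarrow> layer j I) z
        * (indicator (case p of (j, k, I) \<Rightarrow> layer k I) w *
          (case p of (j, k, I) \<Rightarrow> \<lambda>z w. ennreal (\<rho> / measure (dA\<^sub>w \<alpha>) (carleson_box I) * cmod (b z - b w))) z w)) (j, k, I)"
        using jk by simp
      also have "\<dots> \<le> (\<integral>\<^sup>+ p. indicator (case p of (j, k, I) \<Rightarrow> layer j I) z
        * (indicator (case p of (j, k, I) \<Rightarrow> layer k I) w *
          (case p of (j, k, I) \<Rightarrow> \<lambda>z w. ennreal (\<rho> / measure (dA\<^sub>w \<alpha>) (carleson_box I) * cmod (b z - b w))) z w) \<partial>count_space X)"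
        by (rule nn_integral_ge_point[OF p])
      finally show "ennreal (cmod (b z - b w) / cmod (z - cnj w) powr (2 + \<alpha>)) \<le> \<dots>" .
    qed
    also have "ennreal (C * B\<^sup>2) * (ennreal (2 * S\<^sup>2))\<^sup>2 = ennreal ((sqrt C * (2 * S\<^sup>2) * B)\<^sup>2)"
      using C by (simp add: ennreal_power ennreal_mult[symmetric] power_mult_distrib mult_ac)
    finally show "(\<integral>\<^sup>+ z. (\<integral>\<^sup>+ w. ennreal (cmod (b z - b w) / cmod (z - cnj w) powr (2 + \<alpha>))
      * f w \<partial>dA\<^sub>w \<alpha>)\<^sup>2 * (u z)\<^sup>2 \<partial>dA\<^sub>w \<alpha>)
        \<le> ennreal ((sqrt C * (2 * S\<^sup>2) * B)\<^sup>2) * (\<integral>\<^sup>+ w. (f w)\<^sup>2 * (u w)\<^sup>2 \<partial>dA\<^sub>w \<alpha>)" .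
  qed
qed

section \<open>Constants of the weight and symbol classes\<close>

lemma ennreal_sqrt_sq: "(ennreal (sqrt x))\<^sup>2 = ennreal x"
proof (cases "x \<ge> 0")
  case True
  then show ?thesis by (simp add: ennreal_power)
qed (simp add: ennreal_neg)

text \<open>A box average of a positive function is never zero. Hence a finite product of the two averages
forces both of them to be finite.\<close>

lemma B2_product_bound:
  assumes \<alpha>: "\<alpha> > -1" and D: "halving_family D" and \<sigma>: "\<sigma> \<in> B2 D \<alpha>"
  obtains N where "N \<ge> 0"
    "\<And>I. I \<in> D \<Longrightarrow> mass \<alpha> (carleson_box I) (\<lambda>z. ennreal (\<sigma> z))
      * mass \<alpha> (carleson_box I) (\<lambda>z. ennreal (inverse (\<sigma> z)))
        \<le> ennreal N * (emeasure (dA\<^sub>w \<alpha>) (carleson_box I))\<^sup>2"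
    "\<And>I. I \<in> D \<Longrightarrow> mass \<alpha> (carleson_box I) (\<lambda>z. ennreal (\<sigma> z)) < \<infinity>"
    "\<And>I. I \<in> D \<Longrightarrow> mass \<alpha> (carleson_box I) (\<lambda>z. ennreal (inverse (\<sigma> z))) < \<infinity>"
proof -
  have m[measurable]: "\<sigma> \<in> borel_measurable dA" and pos: "AE z in dA. 0 < \<sigma> z"
    and sup: "(SUP I \<in> D. box_avg \<alpha> \<sigma> I * box_avg \<alpha> (\<lambda>z. inverse (\<sigma> z)) I) < \<infinity>"
    using \<sigma> by (auto simp: B2_def weight_def)
  define M where "M = (SUP I \<in> D. box_avg \<alpha> \<sigma> I * box_avg \<alpha> (\<lambda>z. inverse (\<sigma> z)) I)"
  have M: "ennreal (enn2real M) = M" using sup by (simp add: M_def)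
  have pr: "mass \<alpha> (carleson_box I) (\<lambda>z. ennreal (\<sigma> z))
    * mass \<alpha> (carleson_box I) (\<lambda>z. ennreal (inverse (\<sigma> z)))
        \<le> M * (emeasure (dA\<^sub>w \<alpha>) (carleson_box I))\<^sup>2" 
     and nz: "mass \<alpha> (carleson_box I) (\<lambda>z. ennreal (\<sigma> z)) \<noteq> 0" "mass \<alpha> (carleson_box I) (\<lambda>z. ennreal (inverse (\<sigma> z))) \<noteq> 0"
     and Ef: "emeasure (dA\<^sub>w \<alpha>) (carleson_box I) < top" if I: "I \<in> D" for I
  proof -
    obtain a L where L: "0 < L" and Ie: "I = {a..<a+L}" using halving_familyE[OF D I] by metis
    have Q[measurable]: "carleson_box I \<in> sets dA" unfolding Ie by (rule carleson_box_sets_dA)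
    define E where "E = emeasure (dA\<^sub>w \<alpha>) (carleson_box I)"
    have E: "E \<noteq> 0" "E \<noteq> top"
      unfolding E_def Ie using emeasure_dAw_carleson_box_finite_pos[OF \<alpha> L, of a] by auto
    show "emeasure (dA\<^sub>w \<alpha>) (carleson_box I) < top" using E by (simp add: E_def less_top)
    have dE: "x = x / E * E" for x
      using E by (metis ennreal_divide_self ennreal_divide_times mult.right_neutral ennreal_times_divide mult.commute less_top)
    have "box_avg \<alpha> \<sigma> I * box_avg \<alpha> (\<lambda>z. inverse (\<sigma> z)) I \<le> M"
      unfolding M_def by (rule SUP_upper[OF I])
    then have "(box_avg \<alpha> \<sigma> I * box_avg \<alpha> (\<lambda>z. inverse (\<sigma> z)) I) * E\<^sup>2 \<le> M * E\<^sup>2"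
      by (rule mult_right_mono) simp
    also have "(box_avg \<alpha> \<sigma> I * box_avg \<alpha> (\<lambda>z. inverse (\<sigma> z)) I) * E\<^sup>2
       = (box_avg \<alpha> \<sigma> I * E) * (box_avg \<alpha> (\<lambda>z. inverse (\<sigma> z)) I * E)" by (simp add: power2_eq_square mult_ac)
    also have "\<dots> = mass \<alpha> (carleson_box I) (\<lambda>z. ennreal (\<sigma> z))
      * mass \<alpha> (carleson_box I) (\<lambda>z. ennreal (inverse (\<sigma> z)))"
      unfolding box_avg_def E_def[symmetric] dE[symmetric] ..
    finally show "mass \<alpha> (carleson_box I) (\<lambda>z. ennreal (\<sigma> z))
      * mass \<alpha> (carleson_box I) (\<lambda>z. ennreal (inverse (\<sigma> z)))
        \<le> M * (emeasure (dA\<^sub>w \<alpha>) (carleson_box I))\<^sup>2" unfolding E_def .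
    have nz: "mass \<alpha> (carleson_box I) s \<noteq> 0" if [measurable]: "s \<in> borel_measurable dA"
      and s: "AE z in dA. 0 < s z" for s :: "complex \<Rightarrow> ennreal"
    proof
      assume "mass \<alpha> (carleson_box I) s = 0"
      then have "AE z in dA\<^sub>w \<alpha>. s z * indicator (carleson_box I) z = 0"
        by (subst (asm) nn_integral_0_iff_AE) auto
      then have "AE z in dA\<^sub>w \<alpha>. z \<notin> carleson_box I"
        using s[unfolded AE_dAw_iff[OF \<alpha>, symmetric]]
          by eventually_elim (auto split: split_indicator_asm)
      then have "E = 0" unfolding E_def using Q
        by (subst (asm) AE_iff_measurable[OF _ refl]) (auto simp: carleson_box_sub_uhp Collect_conj_eq Int_absorb1)
      then show False using E by simp
    qed
    show "mass \<alpha> (carleson_box I) (\<lambda>z. ennreal (\<sigma> z)) \<noteq> 0" "mass \<alpha> (carleson_box I) (\<lambda>z. ennreal (inverse (\<sigma> z))) \<noteq> 0"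
      by (rule nz, measurable, use pos in simp)+
  qed
  show thesis
  proof (rule that[of "enn2real M"])
    fix I assume I: "I \<in> D"
    show "mass \<alpha> (carleson_box I) (\<lambda>z. ennreal (\<sigma> z))
      * mass \<alpha> (carleson_box I) (\<lambda>z. ennreal (inverse (\<sigma> z)))
        \<le> ennreal (enn2real M) * (emeasure (dA\<^sub>w \<alpha>) (carleson_box I))\<^sup>2"
      unfolding M by (rule pr[OF I])
    have "M * (emeasure (dA\<^sub>w \<alpha>) (carleson_box I))\<^sup>2 < top"
      using Ef[OF I] sup unfolding M_def by (simp add: ennreal_mult_less_top power2_eq_square)
    from le_less_trans[OF pr[OF I] this]
    show "mass \<alpha> (carleson_box I) (\<lambda>z. ennreal (\<sigma> z)) < \<infinity>" "mass \<alpha> (carleson_box I) (\<lambda>z. ennreal (inverse (\<sigma> z))) < \<infinity>"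
      using nz[OF I] by (auto simp: ennreal_mult_less_top)
  qed simp
qed

text \<open>Reconciles the half-open layer with the open upper half of a box.\<close>

lemma horizontal_line_null: "AE z in dA. Im z \<noteq> y"
proof -
  have "negligible {z::complex. z \<bullet> \<i> = y}"
    by (rule negligible_standard_hyperplane) (simp add: Basis_complex_def)
  then have "{z. Im z = y} \<in> null_sets lebesgue" by (simp add: negligible_iff_null_sets)
  then have "AE z in lebesgue. z \<notin> {z. Im z = y}" by (rule AE_not_in)
  then show ?thesis unfolding dA_def by (subst AE_restrict_space_iff) auto
qed

text \<open>Integrate the comparison in \<open>w\<close> over \<open>T\<close>.\<close>

lemma comparable_imp_average_bound:
  assumes \<alpha>: "\<alpha> > -1" and T[measurable]: "T \<in> sets dA" and [measurable]: "s \<in> borel_measurable dA"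
    and c: "AE z in dA. AE w in dA. z \<in> T \<longrightarrow> w \<in> T \<longrightarrow> s z \<le> C * s w"
  shows "AE z in dA. z \<in> T \<longrightarrow> s z * emeasure (dA\<^sub>w \<alpha>) T \<le> C * mass \<alpha> T s"
  using c
proof eventually_elim
  case (elim z)
  show ?case
  proof
    assume z: "z \<in> T"
    have "s z * emeasure (dA\<^sub>w \<alpha>) T = (\<integral>\<^sup>+w. s z * indicator T w \<partial>dA\<^sub>w \<alpha>)"
      by (subst nn_integral_cmult_indicator) auto
    also have "\<dots> \<le> (\<integral>\<^sup>+w. C * (s w * indicator T w) \<partial>dA\<^sub>w \<alpha>)"
    proof (rule nn_integral_mono_AE, use elim[unfolded AE_dAw_iff[OF \<alpha>, symmetric]] in eventually_elim)
      case (elim w)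
      then show ?case using z by (simp split: split_indicator)
    qed
    also have "\<dots> = C * mass \<alpha> T s" by (rule nn_integral_cmult) auto
    finally show "s z * emeasure (dA\<^sub>w \<alpha>) T \<le> C * mass \<alpha> T s" .
  qed
qed

lemma APR_average_bound:
  assumes \<alpha>: "\<alpha> > -1" and D: "halving_family D" and \<sigma>: "\<sigma> \<in> APR"
  obtains A where "A \<ge> 0"
    "\<And>I. I \<in> D \<Longrightarrow> AE z in dA. z \<in> layer 0 I \<longrightarrow>
        ennreal (\<sigma> z) * emeasure (dA\<^sub>w \<alpha>) (layer 0 I) \<le> ennreal A * mass \<alpha> (layer 0 I) (\<lambda>z. ennreal (\<sigma> z))"
    "\<And>I. I \<in> D \<Longrightarrow> AE z in dA. z \<in> layer 0 I \<longrightarrow>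
        ennreal (inverse (\<sigma> z)) * emeasure (dA\<^sub>w \<alpha>) (layer 0 I) \<le> ennreal A * mass \<alpha> (layer 0 I) (\<lambda>z. ennreal (inverse (\<sigma> z)))"
proof -
  obtain C where C: "C > 0" and cmp: "\<And>I z w. bdd_interval I \<Longrightarrow> z \<in> upper_box I \<Longrightarrow> w \<in> upper_box I \<Longrightarrow>
    \<sigma> z \<le> C * \<sigma> w"
    and [measurable]: "\<sigma> \<in> borel_measurable dA" and pos: "AE z in dA. 0 < \<sigma> z"
    using \<sigma> unfolding APR_def weight_def by blast
  show thesis
  proof (rule that[of C])
    show "0 \<le> C" using C by simp
    fix I assume I: "I \<in> D"
    obtain a L where L: "0 < L" and Ie: "I = {a..<a+L}" using halving_familyE[OF D I] by metis
    have T: "layer 0 I \<in> sets dA" unfolding Ie by (rule layer_sets_dA[OF L])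
    have bI: "bdd_interval I" unfolding Ie bdd_interval_def using L by (auto simp: is_interval_co)
    have up: "AE z in dA. z \<in> layer 0 I \<longrightarrow> z \<in> upper_box I"
      using horizontal_line_null[of "len I / 2"]
        by eventually_elim (auto simp: layer_def upper_box_def)
    show "AE z in dA. z \<in> layer 0 I \<longrightarrow>
        ennreal (\<sigma> z) * emeasure (dA\<^sub>w \<alpha>) (layer 0 I) \<le> ennreal C * mass \<alpha> (layer 0 I) (\<lambda>z. ennreal (\<sigma> z))"
    proof (rule comparable_imp_average_bound[OF \<alpha> T], measurable)
      show "AE z in dA. AE w in dA. z \<in> layer 0 I \<longrightarrow> w \<in> layer 0 I \<longrightarrow> ennreal (\<sigma> z)
        \<le> ennreal C * ennreal (\<sigma> w)"
        using up
      proof eventually_elim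
        case z: (elim z)
        show ?case using up pos
        proof eventually_elim
          case (elim w)
          then show ?case using z cmp[OF bI, of z w] C
            by (auto simp: ennreal_mult[symmetric] intro!: ennreal_leI)
        qed
      qed
    qed
    show "AE z in dA. z \<in> layer 0 I \<longrightarrow>
        ennreal (inverse (\<sigma> z)) * emeasure (dA\<^sub>w \<alpha>) (layer 0 I) \<le> ennreal C * mass \<alpha> (layer 0 I) (\<lambda>z. ennreal (inverse (\<sigma> z)))"
    proof (rule comparable_imp_average_bound[OF \<alpha> T], measurable)
      show "AE z in dA. AE w in dA. z \<in> layer 0 I \<longrightarrow> w \<in> layer 0 I \<longrightarrow> ennreal (inverse (\<sigma> z))
        \<le> ennreal C * ennreal (inverse (\<sigma> w))"
        using up pos
      proof eventually_elim
        case z: (elim z)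
        show ?case using up pos
        proof eventually_elim
          case (elim w)
          show ?case
          proof (intro impI)
            assume "z \<in> layer 0 I" "w \<in> layer 0 I"
            then have "\<sigma> w \<le> C * \<sigma> z" using cmp[OF bI, of w z] elim z by blast
            then have "inverse (\<sigma> z) \<le> C * inverse (\<sigma> w)" using elim z C by (simp add: field_simps)
            then show "ennreal (inverse (\<sigma> z)) \<le> ennreal C * ennreal (inverse (\<sigma> w))"
              using C elim by (simp add: ennreal_mult[symmetric] ennreal_leI)
          qed
        qed
      qed
    qed
  qed
qed

lemma BMO2_oscillation_bound:
  assumes D: "halving_family D" and b: "b \<in> BMO2 D" and ne: "D \<noteq> {}"
  shows "0 \<le> BMO2_norm D b"
    "\<And>I. I \<in> D \<Longrightarrow> (\<integral>\<^sup>+z\<in>carleson_box I. ennreal ((cmod (b z - box_mean b I))\<^sup>2) \<partial>dA)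
      \<le> ennreal ((BMO2_norm D b)\<^sup>2 * (len I)\<^sup>2)"
proof -
  have bm[measurable]: "b \<in> borel_measurable dA" and b2: "(\<integral>\<^sup>+ z. ennreal ((cmod (b z))\<^sup>2) \<partial>dA) < \<infinity>"
    and bdd: "bdd_above (box_osc b ` D)" using b by (auto simp: BMO2_def)
  have le: "box_osc b I \<le> BMO2_norm D b" if "I \<in> D" for I
    unfolding BMO2_norm_def by (rule cSUP_upper[OF that bdd])
  have "0 \<le> (LINT z:carleson_box I|dA. (cmod (b z - box_mean b I))\<^sup>2)" for I
    unfolding set_lebesgue_integral_def by (intro Bochner_Integration.integral_nonneg) auto
  then have "0 \<le> box_osc b I" for I
    unfolding box_osc_def by (intro real_sqrt_ge_zero divide_nonneg_nonneg) auto
  then show B: "0 \<le> BMO2_norm D b" using le ne by (meson all_not_in_conv order_trans)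
  fix I assume I: "I \<in> D"
  obtain a L where L: "0 < L" and Ie: "I = {a..<a+L}" using halving_familyE[OF D I] by metis
  have Q[measurable]: "carleson_box I \<in> sets dA" unfolding Ie by (rule carleson_box_sets_dA)
  have eQ: "emeasure dA (carleson_box I) = ennreal (L\<^sup>2)" unfolding Ie
    by (rule emeasure_dA_carleson_box[OF L])
  define c where "c = box_mean b I"
  let ?f = "\<lambda>z. indicat_real (carleson_box I) z *\<^sub>R (cmod (b z - c))\<^sup>2"
  have fin: "(\<integral>\<^sup>+z\<in>carleson_box I. ennreal ((cmod (b z - c))\<^sup>2) \<partial>dA) < \<infinity>"
  proof -
    have "(\<integral>\<^sup>+z\<in>carleson_box I. ennreal ((cmod (b z - c))\<^sup>2) \<partial>dA) \<le>
       (\<integral>\<^sup>+z. 2 * ennreal ((cmod (b z))\<^sup>2) + 2 * ennreal ((cmod c)\<^sup>2) * indicator (carleson_box I) z \<partial>dA)"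
      using ennreal_sq_triangle[of "b _" c 0]
        by (intro nn_integral_mono) (auto split: split_indicator)
    also have "\<dots> = 2 * (\<integral>\<^sup>+z. ennreal ((cmod (b z))\<^sup>2) \<partial>dA)
      + 2 * ennreal ((cmod c)\<^sup>2) * ennreal (L\<^sup>2)"
      by (subst nn_integral_add) (auto simp: nn_integral_cmult nn_integral_cmult_indicator eQ)
    also have "\<dots> < \<infinity>" using b2 by (auto simp: ennreal_mult_less_top)
    finally show ?thesis .
  qed
  have ind: "ennreal ((cmod (b z - c))\<^sup>2) * indicator (carleson_box I) z = ennreal (?f z)" for z
    by (simp split: split_indicator)
  have fin': "(\<integral>\<^sup>+z. ennreal (?f z) \<partial>dA) < \<infinity>" using fin unfolding ind .
  have fm: "?f \<in> borel_measurable dA" by measurable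
  have "(LINT z|dA. ?f z) = enn2real (\<integral>\<^sup>+z. ennreal (?f z) \<partial>dA)"
    by (rule integral_eq_nn_integral[OF fm]) auto
  then have e: "(\<integral>\<^sup>+z. ennreal (?f z) \<partial>dA) = ennreal (LINT z|dA. ?f z)" using fin' by simp
  have "sqrt ((LINT z|dA. ?f z) / L\<^sup>2) \<le> BMO2_norm D b"
    using le[OF I] unfolding box_osc_def set_lebesgue_integral_def c_def Ie measure_dA_carleson_box[OF L] .
  then have "(LINT z|dA. ?f z) / L\<^sup>2 \<le> (BMO2_norm D b)\<^sup>2"
    using real_sqrt_le_iff B by (metis real_sqrt_abs2 abs_of_nonneg power2_eq_square)
  then have "(LINT z|dA. ?f z) \<le> (BMO2_norm D b)\<^sup>2 * L\<^sup>2" using L by (simp add: field_simps)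
  then have "(\<integral>\<^sup>+z\<in>carleson_box I. ennreal ((cmod (b z - c))\<^sup>2) \<partial>dA)
    \<le> ennreal ((BMO2_norm D b)\<^sup>2 * L\<^sup>2)"
    unfolding ind e by (rule ennreal_leI)
  moreover have "len I = L" unfolding Ie by (rule len_ico[OF L])
  ultimately show "(\<integral>\<^sup>+z\<in>carleson_box I. ennreal ((cmod (b z - box_mean b I))\<^sup>2) \<partial>dA)
    \<le> ennreal ((BMO2_norm D b)\<^sup>2 * (len I)\<^sup>2)"
    unfolding c_def by simp
qed

section \<open>The commutator as an absolutely convergent integral\<close>

text \<open>The power is continuous off the closed negative real axis, and \<open>z - cnj w\<close> stays in the upper half plane.\<close>

lemma measurable_Bergman_kernel:
  "(\<lambda>(z, w). (z - cnj w) powr c) \<in> borel_measurable (dA\<^sub>w \<alpha> \<Otimes>\<^sub>M dA\<^sub>w \<alpha>)"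
proof -
  define p where "p \<zeta> = (if \<zeta> \<in> uhp then \<zeta> powr c else 0)" for \<zeta> :: complex
  have [measurable]: "p \<in> borel_measurable borel"
    unfolding p_def[abs_def]
    by (intro borel_measurable_continuous_on_if continuous_intros uhp_borel)
       (auto simp: uhp_def complex_nonpos_Reals_iff)
  have [measurable]: "(\<lambda>z. z) \<in> dA\<^sub>w \<alpha> \<rightarrow>\<^sub>M borel" "cnj \<in> borel_measurable borel"
    by (auto intro!: borel_measurable_dA borel_measurable_continuous_onI continuous_intros)
  have "(\<lambda>(z, w). p (z - cnj w)) \<in> borel_measurable (dA\<^sub>w \<alpha> \<Otimes>\<^sub>M dA\<^sub>w \<alpha>)" by measurable
  also have "?this \<longleftrightarrow> ?thesis"
    by (rule measurable_cong) (auto simp: p_def space_pair_measure uhp_def)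
  finally show ?thesis .
qed

lemma cmod_powr_real: "cmod (x powr complex_of_real a) = cmod x powr a"
  by (simp add: norm_powr_real_powr')

lemma cmod_diff_cnj_pos:
  assumes "z \<in> uhp" "w \<in> uhp"
  shows "Im z \<le> cmod (z - cnj w)" "0 < cmod (z - cnj w)" "z - cnj w \<noteq> 0"
proof -
  have "Im z + Im w \<le> cmod (z - cnj w)" using abs_Im_le_cmod[of "z - cnj w"] by simp
  with assms show "Im z \<le> cmod (z - cnj w)" "0 < cmod (z - cnj w)" by (auto simp: uhp_def)
  then show "z - cnj w \<noteq> 0" by auto
qed

abbreviation commutator_integrand ::
  "(complex \<Rightarrow> complex) \<Rightarrow> real \<Rightarrow> (complex \<Rightarrow> complex) \<Rightarrow> complex \<Rightarrow> complex \<Rightarrow> complex" where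
  "commutator_integrand b \<alpha> f z w \<equiv>
     (b z - b w) * f w / (z - cnj w) powr complex_of_real (2 + \<alpha>)"

text \<open>The bounded extension of the commutator. Writing \<open>b z - b w\<close> under a single integral makes it
converge absolutely almost everywhere for every \<open>f\<close> in the weighted space.\<close>

definition commutator_op :: "(complex \<Rightarrow> complex) \<Rightarrow> real \<Rightarrow> (complex \<Rightarrow> complex) \<Rightarrow> complex \<Rightarrow> complex" where
  "commutator_op b \<alpha> f z = \<i> powr complex_of_real (2 + \<alpha>) *
     (\<integral>w. commutator_integrand b \<alpha> f z w \<partial>dA\<^sub>w \<alpha>)"

definition commutator_majorant :: "(complex \<Rightarrow> complex) \<Rightarrow> real \<Rightarrow> (complex \<Rightarrow> complex) \<Rightarrow> complex \<Rightarrow> ennreal" where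
  "commutator_majorant b \<alpha> f z =
     (\<integral>\<^sup>+w. ennreal (cmod (b z - b w) / cmod (z - cnj w) powr (2 + \<alpha>)) * ennreal (cmod (f w)) \<partial>dA\<^sub>w \<alpha>)"

lemma commutator_integrand_measurable:
  assumes "b \<in> borel_measurable dA" "f \<in> borel_measurable dA"
  shows "(\<lambda>(z, w). commutator_integrand b \<alpha> f z w) \<in> borel_measurable (dA\<^sub>w \<alpha> \<Otimes>\<^sub>M dA\<^sub>w \<alpha>)"
proof -
  have [measurable]: "b \<in> borel_measurable (dA\<^sub>w \<alpha>)" "f \<in> borel_measurable (dA\<^sub>w \<alpha>)" using assms
    by simp_all
  note [measurable] = measurable_Bergman_kernel
  show ?thesis by measurable
qed

lemma commutator_integrand_norm:
  "ennreal (cmod (commutator_integrand b \<alpha> f z w)) =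
     ennreal (cmod (b z - b w) / cmod (z - cnj w) powr (2 + \<alpha>)) * ennreal (cmod (f w))"
  unfolding norm_divide norm_mult cmod_powr_real by (simp add: ennreal_mult[symmetric])

lemma commutator_op_measurable:
  assumes "b \<in> borel_measurable dA" "f \<in> borel_measurable dA"
  shows "commutator_op b \<alpha> f \<in> borel_measurable dA"
proof -
  interpret sigma_finite_measure "dA\<^sub>w \<alpha>" by (rule sigma_finite_dAw)
  have "(\<lambda>z. \<integral>w. commutator_integrand b \<alpha> f z w \<partial>dA\<^sub>w \<alpha>) \<in> borel_measurable (dA\<^sub>w \<alpha>)"
    by (rule borel_measurable_lebesgue_integral[OF commutator_integrand_measurable[OF assms]])
  then have "(\<lambda>z. \<integral>w. commutator_integrand b \<alpha> f z w \<partial>dA\<^sub>w \<alpha>) \<in> borel_measurable dA"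
    by simp
  then show ?thesis unfolding commutator_op_def[abs_def] by measurable
qed

lemma commutator_majorant_measurable:
  assumes "b \<in> borel_measurable dA" "f \<in> borel_measurable dA"
  shows "commutator_majorant b \<alpha> f \<in> borel_measurable dA"
proof -
  interpret sigma_finite_measure "dA\<^sub>w \<alpha>" by (rule sigma_finite_dAw)
  have "(\<lambda>(z, w). ennreal (cmod (commutator_integrand b \<alpha> f z w))) \<in> borel_measurable (dA\<^sub>w \<alpha> \<Otimes>\<^sub>M dA\<^sub>w \<alpha>)"
    using measurable_compose[OF commutator_integrand_measurable[OF assms, of \<alpha>], of "\<lambda>x. ennreal (cmod x)" borel]
    by (simp add: split_beta')
  then have "(\<lambda>z. \<integral>\<^sup>+w. ennreal (cmod (commutator_integrand b \<alpha> f z w))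
    \<partial>dA\<^sub>w \<alpha>) \<in> borel_measurable (dA\<^sub>w \<alpha>)"
    by (rule borel_measurable_nn_integral)
  then show ?thesis unfolding commutator_integrand_norm commutator_majorant_def[abs_def] by simp
qed

lemma commutator_op_le_majorant:
  "ennreal (cmod (commutator_op b \<alpha> f z)) \<le> commutator_majorant b \<alpha> f z"
proof -
  let ?h = "\<lambda>w. commutator_integrand b \<alpha> f z w"
  have 1: "cmod (commutator_op b \<alpha> f z) = cmod (\<integral>w. ?h w \<partial>dA\<^sub>w \<alpha>)"
    by (simp only: commutator_op_def norm_mult cmod_powr_real) simp
  show ?thesis
  proof (cases "integrable (dA\<^sub>w \<alpha>) ?h")
    case True
    have "ennreal (cmod (\<integral>w. ?h w \<partial>dA\<^sub>w \<alpha>)) \<le> (\<integral>\<^sup>+w. ennreal (cmod (?h w)) \<partial>dA\<^sub>w \<alpha>)"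
      by (rule integral_norm_bound_ennreal[OF True])
    then show ?thesis unfolding 1 commutator_majorant_def commutator_integrand_norm .
  next
    case False
    then show ?thesis unfolding 1 by (simp add: not_integrable_integral_eq)
  qed
qed

lemma commutator_integrand_section_measurable:
  assumes "b \<in> borel_measurable dA" "f \<in> borel_measurable dA" "z \<in> uhp"
  shows "(\<lambda>w. commutator_integrand b \<alpha> f z w) \<in> borel_measurable dA"
proof -
  have "z \<in> space (dA\<^sub>w \<alpha>)" using assms(3) by simp
  from measurable_compose[OF measurable_Pair1'[OF this] commutator_integrand_measurable[OF assms(1,2)]]
  show ?thesis by simp
qed

lemma commutator_integrable:
  assumes "b \<in> borel_measurable dA" "f \<in> borel_measurable dA" "z \<in> uhp" "commutator_majorant b \<alpha> f z < \<infinity>"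
  shows "integrable (dA\<^sub>w \<alpha>) (\<lambda>w. commutator_integrand b \<alpha> f z w)"
proof (rule integrableI_bounded)
  show "(\<lambda>w. commutator_integrand b \<alpha> f z w) \<in> borel_measurable (dA\<^sub>w \<alpha>)"
    using commutator_integrand_section_measurable[OF assms(1-3)] by simp
  show "(\<integral>\<^sup>+w. ennreal (cmod (commutator_integrand b \<alpha> f z w)) \<partial>dA\<^sub>w \<alpha>) < \<infinity>"
    unfolding commutator_integrand_norm using assms(4) unfolding commutator_majorant_def .
qed

text \<open>On a compact subset of the half plane the density is bounded, and \<open>1 + (cmod (b w))\<^sup>2\<close>
is integrable there.\<close>

lemma integrable_of_compact_support:
  assumes \<alpha>: "\<alpha> > -1" and K: "compact K" "K \<subseteq> uhp"
    and [measurable]: "b \<in> borel_measurable dA" "g \<in> borel_measurable dA"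
    and b2: "(\<integral>\<^sup>+ z. ennreal ((cmod (b z))\<^sup>2) \<partial>dA) < \<infinity>"
    and C: "C \<ge> 0" and g: "\<And>w. w \<in> K \<Longrightarrow> cmod (g w) \<le> C * (1 + (cmod (b w))\<^sup>2)" "\<And>w. w \<in> uhp - K \<Longrightarrow>
      g w = 0"
  shows "integrable (dA\<^sub>w \<alpha>) g"
proof (rule integrableI_bounded)
  show "g \<in> borel_measurable (dA\<^sub>w \<alpha>)" by simp
  have KS[measurable]: "K \<in> sets dA" using K by (intro borel_sets_dA borel_compact)
  have Kf: "emeasure dA K < \<infinity>"
  proof -
    have "emeasure dA K = emeasure lborel K" using K unfolding dA_def
      by (subst emeasure_restrict_space) (auto simp: borel_compact)
    then show ?thesis using emeasure_bounded_finite[OF compact_imp_bounded[OF K(1)]] by simp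
  qed
  have "continuous_on K (density_w \<alpha>)"
    unfolding density_w_def[abs_def] using K(2) by (intro continuous_intros) (auto simp: uhp_def)
  then have "bounded (density_w \<alpha> ` K)" using K(1)
    by (intro compact_imp_bounded compact_continuous_image)
  then obtain m where m0: "m > 0" "\<forall>z\<in>K. \<bar>density_w \<alpha> z\<bar> \<le> m"
    unfolding bounded_pos by auto
  then have m: "m > 0" "\<And>z. z \<in> K \<Longrightarrow> density_w \<alpha> z \<le> m" by (auto simp: abs_le_iff)
  have "(\<integral>\<^sup>+w. ennreal (cmod (g w)) \<partial>dA\<^sub>w \<alpha>)
    = (\<integral>\<^sup>+w. ennreal (density_w \<alpha> w) * ennreal (cmod (g w)) \<partial>dA)"
    by (rule nn_integral_dAw) measurable
  also have "\<dots> \<le> (\<integral>\<^sup>+w. ennreal (m * C) * (indicator K w + ennreal ((cmod (b w))\<^sup>2)) \<partial>dA)"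
  proof (intro nn_integral_mono)
    fix w assume w: "w \<in> space dA"
    show "ennreal (density_w \<alpha> w) * ennreal (cmod (g w))
      \<le> ennreal (m * C) * (indicator K w + ennreal ((cmod (b w))\<^sup>2))"
    proof (cases "w \<in> K")
      case True
      have "ennreal (density_w \<alpha> w) * ennreal (cmod (g w))
        \<le> ennreal m * ennreal (C * (1 + (cmod (b w))\<^sup>2))"
        using m(2)[OF True] g(1)[OF True] by (intro mult_mono ennreal_leI) auto
      also have "\<dots> = ennreal (m * C) * (indicator K w + ennreal ((cmod (b w))\<^sup>2))"
        using m C True by (simp add: ennreal_mult mult_ac)
      finally show ?thesis .
    next
      case False
      then show ?thesis using w g(2)[of w] by simp
    qed
  qed
  also have "\<dots> = ennreal (m * C) * (emeasure dA K + (\<integral>\<^sup>+w. ennreal ((cmod (b w))\<^sup>2) \<partial>dA))"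
    by (subst nn_integral_cmult, measurable, subst nn_integral_add) auto
  also have "\<dots> < \<infinity>" using Kf b2 by (simp add: ennreal_mult_less_top)
  finally show "(\<integral>\<^sup>+w. ennreal (cmod (g w)) \<partial>dA\<^sub>w \<alpha>) < \<infinity>" .
qed

text \<open>For fixed \<open>z\<close> the kernel is bounded by \<open>Im z powr -(2 + \<alpha>)\<close>, so for bounded \<open>f\<close> with
compact support both terms of the commutator converge separately.\<close>

lemma commutator_op_extends:
  assumes \<alpha>: "\<alpha> > -1" and bm[measurable]: "b \<in> borel_measurable dA"
    and b2: "(\<integral>\<^sup>+ z. ennreal ((cmod (b z))\<^sup>2) \<partial>dA) < \<infinity>" and f: "f \<in> bdd_cpt_supp" and z: "z \<in> uhp"
  shows "commutator_op b \<alpha> f z = commutator b \<alpha> f z"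
proof -
  obtain M K where [measurable]: "f \<in> borel_measurable dA" and M: "\<And>w. w \<in> uhp \<Longrightarrow> cmod (f w) \<le> M"
    and K: "compact K" "K \<subseteq> uhp" "\<And>w. w \<in> uhp - K \<Longrightarrow> f w = 0"
    using f unfolding bdd_cpt_supp_def by blast
  define p where "p w = (z - cnj w) powr complex_of_real (2 + \<alpha>)" for w
  have "p \<in> borel_measurable (dA\<^sub>w \<alpha>)"
  proof -
    have "z \<in> space (dA\<^sub>w \<alpha>)" using z by simp
    from measurable_compose[OF measurable_Pair1'[OF this] measurable_Bergman_kernel]
    show ?thesis unfolding p_def[abs_def] by simp
  qed
  then have [measurable]: "p \<in> borel_measurable dA" by simp
  define y where "y = Im z powr (2 + \<alpha>)"
  have y: "y > 0" using z by (auto simp: y_def uhp_def)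
  have py: "y \<le> cmod (p w)" if "w \<in> uhp" for w
    unfolding p_def cmod_powr_real y_def using cmod_diff_cnj_pos[OF z that] z \<alpha>
      by (intro powr_mono2) (auto simp: uhp_def)
  have M0: "M \<ge> 0" using order_trans[OF norm_ge_zero M[OF z]] .
  have bnd: "cmod (f w / p w) \<le> M / y" if "w \<in> uhp" for w
    unfolding norm_divide using M[OF that] py[OF that] y M0 by (intro frac_le) auto
  have i1: "integrable (dA\<^sub>w \<alpha>) (\<lambda>w. f w / p w)"
  proof (rule integrable_of_compact_support[OF \<alpha> K(1,2) bm _ b2, of _ "M / y"])
    fix w assume w: "w \<in> K"
    have "cmod (f w / p w) \<le> M / y" using bnd w K(2) by auto
    also have "\<dots> \<le> M / y * (1 + (cmod (b w))\<^sup>2)"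
      using M0 y mult_left_mono[of 1 "1 + (cmod (b w))\<^sup>2" "M / y"] by simp
    finally show "cmod (f w / p w) \<le> M / y * (1 + (cmod (b w))\<^sup>2)" .
  qed (use K(3) M0 y in auto)
  have i2: "integrable (dA\<^sub>w \<alpha>) (\<lambda>w. b w * f w / p w)"
  proof (rule integrable_of_compact_support[OF \<alpha> K(1,2) bm _ b2, of _ "M / y"])
    fix w assume w: "w \<in> K"
    have "2 * cmod (b w) \<le> 1 + (cmod (b w))\<^sup>2"
      using sum_power2_ge_zero[of "cmod (b w) - 1" 0] by (simp add: power2_eq_square algebra_simps)
    then have "cmod (b w) \<le> 1 + (cmod (b w))\<^sup>2" using norm_ge_zero[of "b w"] by linarith
    then have "cmod (b w) * cmod (f w / p w) \<le> (1 + (cmod (b w))\<^sup>2) * (M / y)"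
      using bnd[of w] w K(2) by (intro mult_mono) auto
    then show "cmod (b w * f w / p w) \<le> M / y * (1 + (cmod (b w))\<^sup>2)"
      by (simp add: norm_mult norm_divide mult_ac)
  qed (use K(3) M0 y in auto)
  have "(\<integral>w. (b z - b w) * f w / p w \<partial>dA\<^sub>w \<alpha>) = (\<integral>w. b z * (f w / p w) - b w * f w / p w \<partial>dA\<^sub>w \<alpha>)"
    by (intro Bochner_Integration.integral_cong) (auto simp: algebra_simps diff_divide_distrib)
  also have "\<dots> = b z * (\<integral>w. f w / p w \<partial>dA\<^sub>w \<alpha>) - (\<integral>w. b w * f w / p w \<partial>dA\<^sub>w \<alpha>)"
    unfolding Bochner_Integration.integral_diff[OF integrable_mult_right[OF i1] i2]
      integral_mult_right_zero ..
  finally show ?thesis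
    unfolding commutator_op_def commutator_def bergman_proj_def p_def
    by (simp only: right_diff_distrib mult.left_commute)
qed

text \<open>The kernel bound, applied with \<open>u\<close> and \<open>v\<close> the square roots of \<open>\<sigma>\<close> and of its inverse,
controls the majorant. It makes the majorant finite almost everywhere, which gives the linearity,
and it bounds the norm.\<close>

proposition commutator_bounded:
  assumes \<alpha>: "\<alpha> > -1" and adj: "adjacent_dyadic_systems D1 D2" and \<sigma>: "\<sigma> \<in> B2 (D1 \<union> D2) \<alpha>" "\<sigma> \<in> APR"
  shows "\<exists>K>0. \<forall>b \<in> BMO2 (D1 \<union> D2).
            \<exists>T. bounded_extension \<alpha> \<sigma> (commutator b \<alpha>) T \<and>
                L2w_opnorm \<alpha> \<sigma> T \<le> K * BMO2_norm (D1 \<union> D2) b"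
proof -
  let ?D = "D1 \<union> D2"
  have D: "halving_family ?D"
    using adj unfolding adjacent_dyadic_systems_def
      by (intro halving_family_Un dyadic_system_halving) auto
  have ne: "?D \<noteq> {}"
  proof -
    have "bdd_interval {0..1::real}" by (auto simp: bdd_interval_def is_interval_cc)
    then show ?thesis using adj unfolding adjacent_dyadic_systems_def by blast
  qed
  have \<sigma>m[measurable]: "\<sigma> \<in> borel_measurable dA" and pos: "AE z in dA. 0 < \<sigma> z"
    using \<sigma>(2) by (auto simp: APR_def weight_def)
  define u where "u z = ennreal (sqrt (\<sigma> z))" for z
  define v where "v z = ennreal (sqrt (inverse (\<sigma> z)))" for z
  have u2: "(u z)\<^sup>2 = ennreal (\<sigma> z)" and v2: "(v z)\<^sup>2 = ennreal (inverse (\<sigma> z))" for z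
    by (simp_all only: u_def v_def ennreal_sqrt_sq)
  have um[measurable]: "u \<in> borel_measurable dA" and vm: "v \<in> borel_measurable dA"
    unfolding u_def[abs_def] v_def[abs_def] by measurable
  have uv: "AE z in dA. u z * v z = 1"
    using pos by eventually_elim (simp add: u_def v_def ennreal_mult[symmetric] real_sqrt_mult[symmetric] del: real_sqrt_inverse)
  obtain N where N: "N \<ge> 0"
    "\<And>I. I \<in> ?D \<Longrightarrow> mass \<alpha> (carleson_box I) (\<lambda>z. (u z)\<^sup>2) * mass \<alpha> (carleson_box I) (\<lambda>z. (v z)\<^sup>2)
        \<le> ennreal N * (emeasure (dA\<^sub>w \<alpha>) (carleson_box I))\<^sup>2"
    "\<And>I. I \<in> ?D \<Longrightarrow> mass \<alpha> (carleson_box I) (\<lambda>z. (u z)\<^sup>2) < \<infinity>"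
    "\<And>I. I \<in> ?D \<Longrightarrow> mass \<alpha> (carleson_box I) (\<lambda>z. (v z)\<^sup>2) < \<infinity>"
    using B2_product_bound[OF \<alpha> D \<sigma>(1)] unfolding u2 v2 by blast
  obtain A where A: "A \<ge> 0"
    "\<And>I. I \<in> ?D \<Longrightarrow> AE z in dA. z \<in> layer 0 I \<longrightarrow>
        (u z)\<^sup>2 * emeasure (dA\<^sub>w \<alpha>) (layer 0 I) \<le> ennreal A * mass \<alpha> (layer 0 I) (\<lambda>z. (u z)\<^sup>2)"
    "\<And>I. I \<in> ?D \<Longrightarrow> AE z in dA. z \<in> layer 0 I \<longrightarrow>
        (v z)\<^sup>2 * emeasure (dA\<^sub>w \<alpha>) (layer 0 I) \<le> ennreal A * mass \<alpha> (layer 0 I) (\<lambda>z. (v z)\<^sup>2)"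
    using APR_average_bound[OF \<alpha> D \<sigma>(2)] unfolding u2 v2 by blast
  obtain K where K: "K \<ge> 0"
    "\<And>b B m f. b \<in> borel_measurable dA \<Longrightarrow> B \<ge> 0 \<Longrightarrow>
      (\<And>I. I \<in> ?D \<Longrightarrow> (\<integral>\<^sup>+z\<in>carleson_box I. ennreal ((cmod (b z - m I))\<^sup>2) \<partial>dA) \<le> ennreal (B\<^sup>2 * (len I)\<^sup>2)) \<Longrightarrow>
      f \<in> borel_measurable dA \<Longrightarrow>
      (\<integral>\<^sup>+ z. (\<integral>\<^sup>+ w. ennreal (cmod (b z - b w) / cmod (z - cnj w) powr (2 + \<alpha>)) * f w \<partial>dA\<^sub>w \<alpha>)\<^sup>2 * (u z)\<^sup>2 \<partial>dA\<^sub>w \<alpha>)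
        \<le> ennreal ((K * B)\<^sup>2) * (\<integral>\<^sup>+ w. (f w)\<^sup>2 * (u w)\<^sup>2 \<partial>dA\<^sub>w \<alpha>)"
    using commutator_kernel_bound[OF \<alpha> adj um vm uv N(1) A(1) N(2) N(3) N(4) A(2) A(3)] by blast
  have nn: "ennreal ((cmod x)\<^sup>2 * \<sigma> z) = (ennreal (cmod x))\<^sup>2 * (u z)\<^sup>2" for x z
    unfolding u2 by (simp add: ennreal_mult' ennreal_power)
  have norm_eq: "L2w_norm \<alpha> \<sigma> g = sqrt (enn2real (\<integral>\<^sup>+z. ennreal ((cmod (g z))\<^sup>2 * \<sigma> z) \<partial>dA\<^sub>w \<alpha>))"
    if [measurable]: "g \<in> borel_measurable dA" for g
    unfolding L2w_norm_def
  proof (subst integral_eq_nn_integral)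
    show "AE z in dA\<^sub>w \<alpha>. 0 \<le> (cmod (g z))\<^sup>2 * \<sigma> z"
      unfolding AE_dAw_iff[OF \<alpha>] using pos by eventually_elim simp
  qed simp_all
  show ?thesis
  proof (intro exI[of _ "K + 1"] conjI ballI)
    show "K + 1 > 0" using K by simp
    fix b assume b: "b \<in> BMO2 ?D"
    define B where "B = BMO2_norm ?D b"
    have B: "B \<ge> 0" "\<And>I. I \<in> ?D \<Longrightarrow>
      (\<integral>\<^sup>+z\<in>carleson_box I. ennreal ((cmod (b z - box_mean b I))\<^sup>2) \<partial>dA) \<le> ennreal (B\<^sup>2 * (len I)\<^sup>2)"
      unfolding B_def by (rule BMO2_oscillation_bound[OF D b ne], rule BMO2_oscillation_bound[OF D b ne])
    have bm: "b \<in> borel_measurable dA" and b2: "(\<integral>\<^sup>+ z. ennreal ((cmod (b z))\<^sup>2) \<partial>dA) < \<infinity>"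
      using b by (auto simp: BMO2_def)
    define T where "T = commutator_op b \<alpha>"
    define H where "H = commutator_majorant b \<alpha>"
    have Hb: "(\<integral>\<^sup>+ z. (H f z)\<^sup>2 * (u z)\<^sup>2 \<partial>dA\<^sub>w \<alpha>)
      \<le> ennreal ((K * B)\<^sup>2) * (\<integral>\<^sup>+ z. ennreal ((cmod (f z))\<^sup>2 * \<sigma> z) \<partial>dA\<^sub>w \<alpha>)"
      if [measurable]: "f \<in> borel_measurable dA" for f
      unfolding H_def commutator_majorant_def nn
    proof (rule K(2)[OF bm B(1), where m = "box_mean b" and f = "\<lambda>w. ennreal (cmod (f w))"])
      show "(\<lambda>w. ennreal (cmod (f w))) \<in> borel_measurable dA" by measurable
    qed (rule B(2))
    have L2: "f \<in> borel_measurable dA" "(\<integral>\<^sup>+ z. ennreal ((cmod (f z))\<^sup>2 * \<sigma> z) \<partial>dA\<^sub>w \<alpha>) < \<infinity>"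
      if "f \<in> L2w \<alpha> \<sigma>" for f
      using that by (auto simp: L2w_def)
    have Tm: "T f \<in> borel_measurable dA" if "f \<in> L2w \<alpha> \<sigma>" for f
      unfolding T_def by (rule commutator_op_measurable[OF bm L2(1)[OF that]])
    have Tb: "(\<integral>\<^sup>+ z. ennreal ((cmod (T f z))\<^sup>2 * \<sigma> z) \<partial>dA\<^sub>w \<alpha>)
      \<le> ennreal ((K * B)\<^sup>2) * (\<integral>\<^sup>+ z. ennreal ((cmod (f z))\<^sup>2 * \<sigma> z) \<partial>dA\<^sub>w \<alpha>)"
      if f: "f \<in> L2w \<alpha> \<sigma>" for f
    proof -
      have "(\<integral>\<^sup>+ z. ennreal ((cmod (T f z))\<^sup>2 * \<sigma> z) \<partial>dA\<^sub>w \<alpha>)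
        \<le> (\<integral>\<^sup>+ z. (H f z)\<^sup>2 * (u z)\<^sup>2 \<partial>dA\<^sub>w \<alpha>)"
        unfolding nn T_def H_def
          by (intro nn_integral_mono mult_right_mono power_mono commutator_op_le_majorant) auto
      also note Hb[OF L2(1)[OF f]]
      finally show ?thesis .
    qed
    have TL: "T f \<in> L2w \<alpha> \<sigma>" if f: "f \<in> L2w \<alpha> \<sigma>" for f
      unfolding L2w_def using Tm[OF f] le_less_trans[OF Tb[OF f]] L2(2)[OF f]
        by (auto simp: ennreal_mult_less_top)
    have Tn: "L2w_norm \<alpha> \<sigma> (T f) \<le> K * B * L2w_norm \<alpha> \<sigma> f" if f: "f \<in> L2w \<alpha> \<sigma>" for f
    proof -
      have "enn2real (\<integral>\<^sup>+ z. ennreal ((cmod (T f z))\<^sup>2 * \<sigma> z) \<partial>dA\<^sub>w \<alpha>)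
        \<le> enn2real (ennreal ((K * B)\<^sup>2) * (\<integral>\<^sup>+ z. ennreal ((cmod (f z))\<^sup>2 * \<sigma> z) \<partial>dA\<^sub>w \<alpha>))"
        using L2(2)[OF f] by (intro enn2real_mono Tb f) (auto simp: ennreal_mult_less_top)
      also have "\<dots> = (K * B)\<^sup>2 * enn2real (\<integral>\<^sup>+ z. ennreal ((cmod (f z))\<^sup>2 * \<sigma> z) \<partial>dA\<^sub>w \<alpha>)"
        by (simp add: enn2real_mult)
      finally have "sqrt (enn2real (\<integral>\<^sup>+ z. ennreal ((cmod (T f z))\<^sup>2 * \<sigma> z) \<partial>dA\<^sub>w \<alpha>))
        \<le> sqrt ((K * B)\<^sup>2 * enn2real (\<integral>\<^sup>+ z. ennreal ((cmod (f z))\<^sup>2 * \<sigma> z) \<partial>dA\<^sub>w \<alpha>))"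
        by (rule real_sqrt_le_mono)
      then show ?thesis
        unfolding norm_eq[OF Tm[OF f]] norm_eq[OF L2(1)[OF f]] using K(1) B(1)
          by (simp add: real_sqrt_mult)
    qed
    have Hfin: "AE z in dA. H f z < \<infinity>" if f: "f \<in> L2w \<alpha> \<sigma>" for f
    proof -
      note [measurable] = L2(1)[OF f]
      have [measurable]: "H f \<in> borel_measurable dA" unfolding H_def
        by (rule commutator_majorant_measurable[OF bm L2(1)[OF f]])
      have "(\<integral>\<^sup>+ z. (H f z)\<^sup>2 * (u z)\<^sup>2 \<partial>dA\<^sub>w \<alpha>) < \<infinity>"
        by (rule le_less_trans[OF Hb[OF L2(1)[OF f]]]) (use L2(2)[OF f] in \<open>simp add: ennreal_mult_less_top\<close>)
      then have "(\<integral>\<^sup>+ z. (H f z)\<^sup>2 * (u z)\<^sup>2 \<partial>dA\<^sub>w \<alpha>) \<noteq> \<infinity>" by simp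
      then have "AE z in dA\<^sub>w \<alpha>. (H f z)\<^sup>2 * (u z)\<^sup>2 \<noteq> \<infinity>"
        by (intro nn_integral_PInf_AE) auto
      then show ?thesis
        using pos unfolding AE_dAw_iff[OF \<alpha>]
        by eventually_elim (auto simp: u_def ennreal_mult_eq_top_iff power2_eq_square less_top)
    qed
    have lin: "AE z in dA. T (\<lambda>w. c * f w + d * g w) z = c * T f z + d * T g z"
      if f: "f \<in> L2w \<alpha> \<sigma>" and g: "g \<in> L2w \<alpha> \<sigma>" for f g c d
      using Hfin[OF f] Hfin[OF g] AE_space
    proof eventually_elim
      case (elim z)
      let ?p = "\<lambda>w. (z - cnj w) powr complex_of_real (2 + \<alpha>)"
      have z: "z \<in> uhp" using elim by simp
      have i: "integrable (dA\<^sub>w \<alpha>) (\<lambda>w. (b z - b w) * h w / ?p w)"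
        if "h \<in> borel_measurable dA" "H h z < \<infinity>" for h
        by (rule commutator_integrable[OF bm that(1) z that(2)[unfolded H_def]])
      note i = i[OF L2(1)[OF f] elim(1)] i[OF L2(1)[OF g] elim(2)]
      have "(\<integral>w. (b z - b w) * (c * f w + d * g w) / ?p w \<partial>dA\<^sub>w \<alpha>) =
         (\<integral>w. c * ((b z - b w) * f w / ?p w) + d * ((b z - b w) * g w / ?p w) \<partial>dA\<^sub>w \<alpha>)"
        by (intro Bochner_Integration.integral_cong) (auto simp: algebra_simps add_divide_distrib diff_divide_distrib)
      also have "\<dots> = c * (\<integral>w. (b z - b w) * f w / ?p w \<partial>dA\<^sub>w \<alpha>)
        + d * (\<integral>w. (b z - b w) * g w / ?p w \<partial>dA\<^sub>w \<alpha>)"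
        unfolding Bochner_Integration.integral_add[OF integrable_mult_right[OF i(1)] integrable_mult_right[OF i(2)]]
          integral_mult_right_zero ..
      finally show ?case unfolding T_def commutator_op_def by (simp add: algebra_simps)
    qed
    have ext: "bounded_extension \<alpha> \<sigma> (commutator b \<alpha>) T"
      unfolding bounded_extension_def bounded_op_on_L2w_def
    proof (intro conjI ballI allI)
      show "\<exists>C. \<forall>f\<in>L2w \<alpha> \<sigma>. L2w_norm \<alpha> \<sigma> (T f) \<le> C * L2w_norm \<alpha> \<sigma> f" using Tn by blast
      fix f assume f: "f \<in> bdd_cpt_supp"
      show "AE z in dA. T f z = commutator b \<alpha> f z"
        unfolding T_def by (rule AE_I2) (use commutator_op_extends[OF \<alpha> bm b2 f] in simp)
    qed (use TL lin in auto)
    have "L2w_opnorm \<alpha> \<sigma> T \<le> (K + 1) * B"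
      unfolding L2w_opnorm_def
    proof (rule cSUP_least)
      have "(\<lambda>z. 0) \<in> {f \<in> L2w \<alpha> \<sigma>. L2w_norm \<alpha> \<sigma> f \<le> 1}" by (simp add: L2w_def L2w_norm_def)
      then show "{f \<in> L2w \<alpha> \<sigma>. L2w_norm \<alpha> \<sigma> f \<le> 1} \<noteq> {}" by blast
      fix f assume "f \<in> {f \<in> L2w \<alpha> \<sigma>. L2w_norm \<alpha> \<sigma> f \<le> 1}"
      then have f: "f \<in> L2w \<alpha> \<sigma>" "L2w_norm \<alpha> \<sigma> f \<le> 1" by auto
      have "L2w_norm \<alpha> \<sigma> (T f) \<le> K * B * L2w_norm \<alpha> \<sigma> f" by (rule Tn[OF f(1)])
      also have "\<dots> \<le> K * B * 1" using K(1) B(1) f(2) by (intro mult_left_mono) auto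
      also have "\<dots> \<le> (K + 1) * B" using B(1) by (simp add: algebra_simps)
      finally show "L2w_norm \<alpha> \<sigma> (T f) \<le> (K + 1) * B" .
    qed
    then show "\<exists>T. bounded_extension \<alpha> \<sigma> (commutator b \<alpha>) T \<and> L2w_opnorm \<alpha> \<sigma> T
      \<le> (K + 1) * BMO2_norm ?D b"
      using ext unfolding B_def by blast
  qed
qed

section \<open>A weight and a symbol without hyperbolic regularity\<close>

text \<open>Rectangles of area \<open>r\<^sup>2 / (2 * 4 ^ n)\<close> that accumulate at \<open>\<i>\<close>. On the \<open>n\<close>-th one \<open>r / Re z\<close> is
between \<open>2 ^ n\<close> and \<open>2 ^ (n + 1)\<close>, so on their union \<open>r / Re z\<close> is integrable and its square
is not.\<close>

definition stair :: "real \<Rightarrow> nat \<Rightarrow> complex set" where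
  "stair r n = {z. r / 2 ^ Suc n < Re z \<and> Re z < r / 2 ^ n \<and> 1 < Im z \<and> Im z < 1 + r / 2 ^ n}"

definition stairs :: "real \<Rightarrow> complex set" where
  "stairs r = (\<Union>n. stair r n)"

lemma stair_borel [measurable]: "stair r n \<in> sets borel"
  unfolding stair_def by measurable

lemma stairs_borel [measurable]: "stairs r \<in> sets borel"
  unfolding stairs_def by measurable

lemma stair_bounds:
  assumes "0 < r" "z \<in> stair r n"
  shows "0 < Re z" "Re z < r" "1 < Im z" "Im z < 1 + r" "2 ^ n < r / Re z" "r / Re z < 2 ^ Suc n"
proof -
  have r: "0 < r / 2 ^ Suc n" "r / 2 ^ n \<le> r" using assms(1) by (simp_all add: field_simps)
  show re: "0 < Re z" "Re z < r" "1 < Im z" "Im z < 1 + r"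
    using assms(2) r unfolding stair_def mem_Collect_eq by linarith+
  show "2 ^ n < r / Re z" "r / Re z < 2 ^ Suc n"
    using assms(2) re(1) unfolding stair_def by (auto simp: field_simps)
qed

lemma stairs_bounds:
  assumes "0 < r" "z \<in> stairs r"
  shows "0 < Re z" "Re z < r" "1 < Im z" "Im z < 1 + r" "1 \<le> r / Re z"
proof -
  obtain n where n: "z \<in> stair r n" using assms(2) by (auto simp: stairs_def)
  show re: "0 < Re z" "Re z < r" "1 < Im z" "Im z < 1 + r" by (rule stair_bounds[OF assms(1) n])+
  then show "1 \<le> r / Re z" by simp
qed

lemma stair_sub_uhp: "0 < r \<Longrightarrow> stair r n \<subseteq> uhp"
  using stair_bounds(3) by (force simp: uhp_def)

lemma stairs_sub_uhp: "0 < r \<Longrightarrow> stairs r \<subseteq> uhp"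
  using stair_sub_uhp by (auto simp: stairs_def)

lemma stair_disjoint: "0 < r \<Longrightarrow> disjoint_family (stair r)"
proof (unfold disjoint_family_on_def, intro ballI impI)
  have *: "stair r m \<inter> stair r n = {}" if "0 < r" "m < n" for m n
  proof (rule equals0I)
    fix z assume z: "z \<in> stair r m \<inter> stair r n"
    have "r / 2 ^ n \<le> r / 2 ^ Suc m" using that by (intro divide_left_mono power_increasing) auto
    then show False using z by (simp add: stair_def)
  qed
  fix m n :: nat assume "0 < r" "m \<noteq> n"
  then show "stair r m \<inter> stair r n = {}" using *[of m n] *[of n m]
    by (cases m n rule: linorder_cases) auto
qed

lemma emeasure_dA_stair:
  assumes r: "0 < r" shows "emeasure dA (stair r n) = ennreal (r\<^sup>2 / 2 / 4 ^ n)"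
proof -
  have "emeasure dA (stair r n) = ennreal ((r / 2 ^ n - r / 2 ^ Suc n) * (1 + r / 2 ^ n - 1))"
    using r by (intro emeasure_dA_rectangle stair_borel stair_sub_uhp)
       (auto simp: stair_def in_box_complex_iff in_cbox_complex_iff field_simps)
  moreover have "(r / 2 ^ n - r / 2 ^ Suc n) * (1 + r / 2 ^ n - 1) = r\<^sup>2 / 2 / 4 ^ n"
    by (simp add: field_simps power2_eq_square power_mult_distrib[symmetric])
  ultimately show ?thesis by simp
qed

lemma nn_integral_stairs:
  assumes r: "0 < r" and [measurable]: "F \<in> borel_measurable dA"
  shows "(\<integral>\<^sup>+z\<in>stairs r. F z \<partial>dA) = (\<Sum>n. \<integral>\<^sup>+z\<in>stair r n. F z \<partial>dA)"
  unfolding stairs_def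
  by (rule nn_integral_disjoint_family) (use stair_disjoint[OF r] borel_sets_dA[OF stair_borel stair_sub_uhp[OF r]] in auto)

lemma stairs_integral_finite:
  assumes r: "0 < r"
  shows "(\<integral>\<^sup>+z\<in>stairs r. ennreal (r / Re z) \<partial>dA) < \<infinity>"
proof -
  have [measurable]: "(\<lambda>z. ennreal (r / Re z)) \<in> borel_measurable dA"
    by (rule borel_measurable_dA) measurable
  have "(\<integral>\<^sup>+z\<in>stairs r. ennreal (r / Re z) \<partial>dA) = (\<Sum>n. \<integral>\<^sup>+z\<in>stair r n. ennreal (r / Re z) \<partial>dA)"
    by (rule nn_integral_stairs[OF r]) measurable
  also have "\<dots> \<le> (\<Sum>n. ennreal (r\<^sup>2 * (1/2) ^ n))"
  proof (intro suminf_le)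
    fix n
    have [measurable]: "stair r n \<in> sets dA" by (intro borel_sets_dA stair_borel stair_sub_uhp r)
    have "(\<integral>\<^sup>+z\<in>stair r n. ennreal (r / Re z) \<partial>dA)
      \<le> (\<integral>\<^sup>+z. ennreal (2 ^ Suc n) * indicator (stair r n) z \<partial>dA)"
      using stair_bounds(6)[OF r, of _ n]
      by (intro nn_integral_mono) (auto split: split_indicator intro!: ennreal_leI less_imp_le)
    also have "\<dots> = ennreal (2 ^ Suc n) * ennreal (r\<^sup>2 / 2 / 4 ^ n)"
      by (simp only: nn_integral_cmult_indicator \<open>stair r n \<in> sets dA\<close> emeasure_dA_stair[OF r])
    also have "\<dots> = ennreal (2 ^ Suc n * (r\<^sup>2 / 2 / 4 ^ n))" by (rule ennreal_mult[symmetric]) auto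
    also have "2 ^ Suc n * (r\<^sup>2 / 2 / 4 ^ n) = r\<^sup>2 * (1/2) ^ n"
    proof -
      have "(4::real) ^ n = 2 ^ n * 2 ^ n" by (simp add: power_mult_distrib[symmetric])
      then show ?thesis by (simp add: power_one_over)
    qed
    finally show "(\<integral>\<^sup>+z\<in>stair r n. ennreal (r / Re z) \<partial>dA) \<le> ennreal (r\<^sup>2 * (1/2) ^ n)" .
  qed auto
  also have "\<dots> = ennreal (r\<^sup>2 * (1 / (1 - 1/2)))"
    by (intro suminf_ennreal_eq sums_mult geometric_sums) auto
  finally show ?thesis using le_less_trans by fastforce
qed

lemma stairs_integral_sq_infinite:
  assumes r: "0 < r"
  shows "(\<integral>\<^sup>+z\<in>stairs r. ennreal ((r / Re z)\<^sup>2) \<partial>dA) = \<infinity>"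
proof -
  have [measurable]: "(\<lambda>z. ennreal ((r / Re z)\<^sup>2)) \<in> borel_measurable dA"
    by (rule borel_measurable_dA) measurable
  have "(\<Sum>n::nat. ennreal (r\<^sup>2 / 2)) \<le> (\<Sum>n. \<integral>\<^sup>+z\<in>stair r n. ennreal ((r / Re z)\<^sup>2) \<partial>dA)"
  proof (intro suminf_le)
    fix n
    have S: "stair r n \<in> sets dA" by (intro borel_sets_dA stair_borel stair_sub_uhp r)
    have "ennreal (r\<^sup>2 / 2) = ennreal (4 ^ n) * ennreal (r\<^sup>2 / 2 / 4 ^ n)"
      by (subst ennreal_mult[symmetric]) auto
    also have "\<dots> = (\<integral>\<^sup>+z. ennreal (4 ^ n) * indicator (stair r n) z \<partial>dA)"
      by (simp only: nn_integral_cmult_indicator S emeasure_dA_stair[OF r])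
    also have "\<dots> \<le> (\<integral>\<^sup>+z\<in>stair r n. ennreal ((r / Re z)\<^sup>2) \<partial>dA)"
    proof (intro nn_integral_mono)
      fix z
      have "4 ^ n \<le> (r / Re z)\<^sup>2" if "z \<in> stair r n"
      proof -
        have "(4::real) ^ n = (2 ^ n)\<^sup>2"
          by (simp add: power2_eq_square power_mult_distrib[symmetric])
        also have "\<dots> \<le> (r / Re z)\<^sup>2" using stair_bounds(5)[OF r that] by (intro power_mono) auto
        finally show ?thesis .
      qed
      then show "ennreal (4 ^ n) * indicator (stair r n) z
        \<le> ennreal ((r / Re z)\<^sup>2) * indicator (stair r n) z"
        by (auto split: split_indicator intro!: ennreal_leI)
    qed
    finally show "ennreal (r\<^sup>2 / 2) \<le> (\<integral>\<^sup>+z\<in>stair r n. ennreal ((r / Re z)\<^sup>2) \<partial>dA)" .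
  qed auto
  also have "\<dots> = (\<integral>\<^sup>+z\<in>stairs r. ennreal ((r / Re z)\<^sup>2) \<partial>dA)"
    by (rule nn_integral_stairs[OF r, symmetric]) measurable
  finally have le: "(\<Sum>n::nat. ennreal (r\<^sup>2 / 2)) \<le> (\<integral>\<^sup>+z\<in>stairs r. ennreal ((r / Re z)\<^sup>2) \<partial>dA)" .
  have "(\<Sum>n::nat. ennreal (r\<^sup>2 / 2)) = (\<integral>\<^sup>+n. ennreal (r\<^sup>2 / 2) \<partial>count_space (UNIV::nat set))"
    by (rule nn_integral_count_space_nat[symmetric])
  also have "\<dots> = \<infinity>" using r by (simp add: ennreal_mult_top)
  finally show ?thesis using le by (simp add: top_unique)
qed

text \<open>On the stairs \<open>\<sigma>\<close> equals \<open>r / Re z\<close>, and so does \<open>(cmod b)\<^sup>2\<close> for the symbol below: \<open>b\<close> is square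
integrable, but \<open>(cmod b)\<^sup>2 * \<sigma>\<close> is not integrable.\<close>

definition stair_weight :: "real \<Rightarrow> complex \<Rightarrow> real" where
  "stair_weight r z = (if z \<in> stairs r then r / Re z else 1)"

definition stair_symbol :: "real \<Rightarrow> complex \<Rightarrow> complex" where
  "stair_symbol r z = (if z \<in> stairs r then complex_of_real (sqrt (r / Re z)) else 0)"

lemma stair_weight_measurable [measurable]: "stair_weight r \<in> borel_measurable dA"
  unfolding stair_weight_def[abs_def] by (rule borel_measurable_dA) measurable

lemma stair_symbol_measurable [measurable]: "stair_symbol r \<in> borel_measurable dA"
  unfolding stair_symbol_def[abs_def] by (rule borel_measurable_dA) measurable

lemma stair_symbol_sq:
  assumes "0 < r" shows "ennreal ((cmod (stair_symbol r z))\<^sup>2)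
    = ennreal (r / Re z) * indicator (stairs r) z"
  using stairs_bounds(1)[OF assms, of z] assms
    by (auto simp: stair_symbol_def split: split_indicator)

lemma stair_weight_ge_1: "0 < r \<Longrightarrow> 1 \<le> stair_weight r z"
  using stairs_bounds(5)[of r z] by (auto simp: stair_weight_def)

lemma stairs_disjoint_small_box:
  assumes "0 < r" "0 < L" "L \<le> 1" shows "z \<in> carleson_box {a..<a+L} \<Longrightarrow> z \<notin> stairs r"
proof
  assume "z \<in> carleson_box {a..<a+L}" "z \<in> stairs r"
  then have "Im z < L" "1 < Im z"
    using mem_carleson_box[OF assms(2)] stairs_bounds(3)[OF assms(1)] by blast+
  then show False using assms(3) by linarith
qed

lemma density_w_stairs:
  assumes \<alpha>: "\<alpha> > -1" and r: "0 < r" "r \<le> 1/8"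
  obtains c C where "0 < c" "\<And>z. z \<in> stairs r \<Longrightarrow> c \<le> density_w \<alpha> z" "0 < C" "\<And>z. z \<in> stairs r \<Longrightarrow>
    density_w \<alpha> z \<le> C"
proof -
  \<comment> \<open>The top layer over \<open>{0..<2}\<close> has heights in \<open>{1..<2}\<close>.\<close>
  have "stairs r \<subseteq> layer 0 {0..<0+2}"
  proof
    fix z assume "z \<in> stairs r"
    from stairs_bounds[OF r(1) this] r(2) show "z \<in> layer 0 {0..<0+2}"
      unfolding mem_layer[OF zero_less_numeral] by simp
  qed
  then show thesis
    using density_w_layer[OF \<alpha>, of 2 _ 0 0] \<alpha>
    by (intro that[of "(\<alpha> + 1) / pi * 2 powr (- \<bar>\<alpha>\<bar>) * (2 / 2 ^ 0) powr \<alpha>" "(\<alpha> + 1) / pi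
      * 2 powr \<bar>\<alpha>\<bar> * (2 / 2 ^ 0) powr \<alpha>"])
       (auto simp: subset_iff)
qed

text \<open>Boxes of side at most 1 do not meet the stairs. Larger boxes have measure bounded below, so the
finite extra mass of the weight on the stairs changes their averages by a bounded amount, and
the inverse weight is at most 1.\<close>

lemma stair_weight_B2:
  assumes \<alpha>: "\<alpha> > -1" and r: "0 < r" "r \<le> 1/8" and D: "halving_family D"
  shows "stair_weight r \<in> B2 D \<alpha>"
proof -
  obtain C where C: "0 < C" "\<And>z. z \<in> stairs r \<Longrightarrow> density_w \<alpha> z \<le> C" using density_w_stairs[OF \<alpha> r]
    by metis
  have Sm[measurable]: "stairs r \<in> sets dA" by (intro borel_sets_dA stairs_borel stairs_sub_uhp r)
  have [measurable]: "(\<lambda>z. ennreal (r / Re z)) \<in> borel_measurable dA"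
    by (rule borel_measurable_dA) measurable
  define S where "S = mass \<alpha> (stairs r) (\<lambda>z. ennreal (r / Re z))"
  have "S = (\<integral>\<^sup>+z. ennreal (density_w \<alpha> z) * (ennreal (r / Re z) * indicator (stairs r) z) \<partial>dA)"
    unfolding S_def by (rule nn_integral_dAw) measurable
  also have "\<dots> \<le> (\<integral>\<^sup>+z. ennreal C * (ennreal (r / Re z) * indicator (stairs r) z) \<partial>dA)"
    using C by (intro nn_integral_mono) (auto split: split_indicator intro!: mult_right_mono ennreal_leI)
  also have "\<dots> = ennreal C * (\<integral>\<^sup>+z\<in>stairs r. ennreal (r / Re z) \<partial>dA)"
    by (rule nn_integral_cmult) measurable
  also have "\<dots> < top" using stairs_integral_finite[OF r(1)] by (simp add: ennreal_mult_less_top)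
  finally have Sf: "S < top" .
  define c0 where "c0 = (\<alpha> + 1) / pi * 2 powr (- \<bar>\<alpha>\<bar>) / 2"
  have c0: "c0 > 0" using \<alpha> by (simp add: c0_def)
  have le: "box_avg \<alpha> (stair_weight r) I * box_avg \<alpha> (\<lambda>z. inverse (stair_weight r z)) I
    \<le> 1 + S / ennreal c0" if I: "I \<in> D" for I
  proof -
    obtain a L where L: "0 < L" and Ie: "I = {a..<a+L}" using halving_familyE[OF D I] by metis
    let ?Q = "carleson_box I"
    have Q[measurable]: "?Q \<in> sets dA" unfolding Ie by (rule carleson_box_sets_dA)
    define \<mu> where "\<mu> = emeasure (dA\<^sub>w \<alpha>) ?Q"
    have \<mu>: "\<mu> \<noteq> 0" "\<mu> < top" unfolding \<mu>_def Ie
      using emeasure_dAw_carleson_box_finite_pos[OF \<alpha> L, of a] by auto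
    have ind: "(\<integral>\<^sup>+z. indicator ?Q z \<partial>dA\<^sub>w \<alpha>) = \<mu>" unfolding \<mu>_def
      by (rule nn_integral_indicator) simp
    have "mass \<alpha> ?Q (\<lambda>z. ennreal (inverse (stair_weight r z))) \<le> (\<integral>\<^sup>+z. indicator ?Q z \<partial>dA\<^sub>w \<alpha>)"
    proof (intro nn_integral_mono)
      fix z
      have "inverse (stair_weight r z) \<le> 1" using stair_weight_ge_1[OF r(1), of z]
        by (simp add: field_simps)
      then show "ennreal (inverse (stair_weight r z)) * indicator ?Q z \<le> indicator ?Q z"
        by (auto split: split_indicator simp: ennreal_le_1)
    qed
    then have "box_avg \<alpha> (\<lambda>z. inverse (stair_weight r z)) I \<le> \<mu> / \<mu>"
      unfolding box_avg_def \<mu>_def[symmetric] ind by (rule divide_right_mono_ennreal)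
    also have "\<dots> = 1" using \<mu> by (rule ennreal_divide_self)
    finally have 1: "box_avg \<alpha> (\<lambda>z. inverse (stair_weight r z)) I \<le> 1" .
    have 2: "box_avg \<alpha> (stair_weight r) I \<le> 1 + S / ennreal c0"
    proof (cases "L \<le> 1")
      case True
      have "mass \<alpha> ?Q (\<lambda>z. ennreal (stair_weight r z)) = (\<integral>\<^sup>+z. indicator ?Q z \<partial>dA\<^sub>w \<alpha>)"
        using stairs_disjoint_small_box[OF r(1) L True, of _ a] unfolding Ie
        by (intro nn_integral_cong) (auto simp: stair_weight_def split: split_indicator)
      then have "box_avg \<alpha> (stair_weight r) I = \<mu> / \<mu>" unfolding box_avg_def \<mu>_def[symmetric] ind
        by simp
      also have "\<dots> = 1" using \<mu> by (rule ennreal_divide_self)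
      finally show ?thesis by simp
    next
      case False
      have "ennreal c0 \<le> ennreal (c0 * L powr (2 + \<alpha>))"
        using False c0 \<alpha> ge_one_powr_ge_zero[of L "2 + \<alpha>"] by (intro ennreal_leI) simp
      also have "\<dots> \<le> emeasure (dA\<^sub>w \<alpha>) (layer 0 I)"
        using emeasure_dAw_layer(1)[OF \<alpha> L, of 0 a] unfolding c0_def Ie by simp
      also have "\<dots> \<le> \<mu>"
        unfolding \<mu>_def Ie by (intro emeasure_mono layer_sub_carleson_box[OF L]) (simp only: sets_dAw carleson_box_sets_dA)
      finally have c\<mu>: "ennreal c0 \<le> \<mu>" .
      have "mass \<alpha> ?Q (\<lambda>z. ennreal (stair_weight r z))
        \<le> (\<integral>\<^sup>+z. indicator ?Q z + ennreal (r / Re z) * indicator (stairs r) z \<partial>dA\<^sub>w \<alpha>)"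
        by (intro nn_integral_mono) (auto simp: stair_weight_def split: split_indicator)
      also have "\<dots> = \<mu> + S"
        unfolding S_def by (subst nn_integral_add) (auto simp: ind)
      finally have "box_avg \<alpha> (stair_weight r) I \<le> (\<mu> + S) / \<mu>"
        unfolding box_avg_def \<mu>_def[symmetric] by (rule divide_right_mono_ennreal)
      also have "\<dots> = 1 + S / \<mu>" unfolding add_divide_distrib_ennreal using \<mu> by simp
      also have "\<dots> \<le> 1 + S / ennreal c0"
      proof (intro add_left_mono divide_le_posI_ennreal)
        show "0 < \<mu>" using \<mu>(1) by (simp add: zero_less_iff_neq_zero)
        have "S = S * ennreal c0 / ennreal c0"
          using c0 by (intro mult_divide_eq_ennreal[symmetric]) auto
        also have "\<dots> = ennreal c0 * (S / ennreal c0)"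
          by (simp add: ennreal_times_divide mult.commute)
        also have "\<dots> \<le> \<mu> * (S / ennreal c0)" by (intro mult_right_mono c\<mu>) simp
        finally show "S \<le> \<mu> * (S / ennreal c0)" .
      qed
      finally show ?thesis .
    qed
    show ?thesis using mult_mono[OF 2 1] by simp
  qed
  have "(SUP I\<in>D. box_avg \<alpha> (stair_weight r) I * box_avg \<alpha> (\<lambda>z. inverse (stair_weight r z)) I)
    \<le> 1 + S / ennreal c0"
    by (rule SUP_least) (rule le)
  also have "\<dots> < \<infinity>" using Sf c0 by (cases S rule: ennreal_cases) (simp_all add: divide_ennreal)
  finally show ?thesis
    unfolding B2_def weight_def using less_le_trans[OF zero_less_one stair_weight_ge_1[OF r(1)]]
      by auto
qed

text \<open>One upper half box contains points of every \<open>stair r n\<close>, where the weight exceeds \<open>2 ^ n\<close>, and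
also a point where it equals 1.\<close>

lemma stair_weight_not_APR:
  assumes r: "0 < r" "r \<le> 1/8"
  shows "stair_weight r \<notin> APR"
proof
  assume "stair_weight r \<in> APR"
  then obtain C where C: "C > 0"
    and cmp: "\<And>I z w. bdd_interval I \<Longrightarrow> z \<in> upper_box I \<Longrightarrow> w \<in> upper_box I \<Longrightarrow>
      stair_weight r z \<le> C * stair_weight r w"
    unfolding APR_def by blast
  \<comment> \<open>The upper half box over this interval has heights between 3/4 and 3/2.\<close>
  let ?I = "{0..3/2::real}"
  have I: "bdd_interval ?I" by (auto simp: bdd_interval_def is_interval_cc)
  define w where "w = Complex 1 1"
  have w: "w \<in> upper_box ?I" "stair_weight r w = 1"
    using stairs_bounds(3)[OF r(1), of w] by (auto simp: w_def upper_box_def stair_weight_def)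
  have "2 ^ n \<le> C" for n
  proof -
    define z where "z = Complex (3 / 4 * (r / 2 ^ n)) (1 + r / 2 ^ n / 2)"
    have z: "z \<in> stair r n" using r by (simp add: z_def stair_def field_simps)
    have zb: "z \<in> upper_box ?I" using stair_bounds(1-4)[OF r(1) z] r(2) by (simp add: upper_box_def)
    have "2 ^ n < stair_weight r z"
      using stair_bounds(5)[OF r(1) z] z by (auto simp: stair_weight_def stairs_def)
    also have "\<dots> \<le> C" using cmp[OF I zb w(1)] w(2) by simp
    finally show ?thesis by simp
  qed
  moreover obtain n where "C < 2 ^ n" using real_arch_pow[of 2 C] by auto
  ultimately show False by (meson not_le)
qed

text \<open>As for the weight, only boxes of side larger than 1 see the stairs, and for these the \<open>L\<^sup>2\<close> norm
of the symbol bounds the oscillation. The mean is estimated through \<open>cmod (b z) \<le> (cmod (b z))\<^sup>2\<close>,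
valid because \<open>b\<close> is 0 or at least 1 in modulus.\<close>

lemma stair_symbol_BMO2:
  assumes r: "0 < r" "r \<le> 1/8" and D: "halving_family D"
  shows "stair_symbol r \<in> BMO2 D"
proof -
  let ?b = "stair_symbol r"
  define S where "S = (\<integral>\<^sup>+ z. ennreal ((cmod (?b z))\<^sup>2) \<partial>dA)"
  have S: "S < \<infinity>" unfolding S_def stair_symbol_sq[OF r(1)] by (rule stairs_integral_finite[OF r(1)])
  define s where "s = enn2real S"
  have s: "S = ennreal s" "0 \<le> s" using S by (auto simp: s_def)
  have bb: "cmod (?b z) \<le> (cmod (?b z))\<^sup>2" for z
  proof (cases "z \<in> stairs r")
    case True
    then have "1 \<le> cmod (?b z)" using stairs_bounds(1,5)[OF r(1) True] r(1)
      by (simp add: stair_symbol_def)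
    then show ?thesis by (rule self_le_power) simp
  qed (simp add: stair_symbol_def)
  have "box_osc ?b I \<le> sqrt (2 * s + 2 * s\<^sup>2)" if I: "I \<in> D" for I
  proof -
    obtain a L where L: "0 < L" and Ie: "I = {a..<a+L}" using halving_familyE[OF D I] by metis
    have Q[measurable]: "carleson_box I \<in> sets dA" unfolding Ie by (rule carleson_box_sets_dA)
    have eQ: "emeasure dA (carleson_box I) = ennreal (L\<^sup>2)" unfolding Ie
      by (rule emeasure_dA_carleson_box[OF L])
    have mQ: "measure dA (carleson_box I) = L\<^sup>2" unfolding Ie
      by (rule measure_dA_carleson_box[OF L])
    define m where "m = box_mean ?b I"
    have osc: "box_osc ?b I = sqrt ((LINT z:carleson_box I|dA. (cmod (?b z - m))\<^sup>2) / L\<^sup>2)"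
      unfolding box_osc_def m_def mQ ..
    show ?thesis
    proof (cases "L \<le> 1")
      case True
      then have 0: "?b z = 0" if "z \<in> carleson_box I" for z
        using stairs_disjoint_small_box[OF r(1) L True, of z a] that unfolding Ie stair_symbol_def
          by simp
      have "m = 0" unfolding m_def box_mean_def set_lebesgue_integral_def
        using 0 by (subst Bochner_Integration.integral_cong[OF refl, of _ _ "\<lambda>_. 0"]) (auto split: split_indicator)
      then have "(LINT z:carleson_box I|dA. (cmod (?b z - m))\<^sup>2) = 0"
        unfolding set_lebesgue_integral_def
        using 0 by (subst Bochner_Integration.integral_cong[OF refl, of _ _ "\<lambda>_. 0"]) (auto split: split_indicator)
      then show ?thesis unfolding osc using s by simp
    next
      case False
      then have L1: "1 \<le> L\<^sup>2" by (simp add: one_le_power)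
      have "ennreal (cmod (LINT z:carleson_box I|dA. ?b z)) \<le> S"
      proof (cases "integrable dA (\<lambda>z. indicat_real (carleson_box I) z *\<^sub>R ?b z)")
        case True
        have "ennreal (cmod (LINT z:carleson_box I|dA. ?b z))
          \<le> (\<integral>\<^sup>+z. ennreal (cmod (indicat_real (carleson_box I) z *\<^sub>R ?b z)) \<partial>dA)"
          unfolding set_lebesgue_integral_def by (rule integral_norm_bound_ennreal[OF True])
        also have "\<dots> \<le> S"
          unfolding S_def using bb
            by (intro nn_integral_mono) (auto split: split_indicator intro!: ennreal_leI)
        finally show ?thesis .
      next
        case False
        then show ?thesis unfolding set_lebesgue_integral_def
          by (simp add: not_integrable_integral_eq)
      qed
      then have "cmod (LINT z:carleson_box I|dA. ?b z) \<le> s" unfolding s(1) using s(2) by simp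
      moreover have "cmod m = cmod (LINT z:carleson_box I|dA. ?b z) / L\<^sup>2"
        unfolding m_def box_mean_def mQ norm_divide by (simp add: norm_power)
      ultimately have m: "cmod m * L\<^sup>2 \<le> s" using L by simp
      have "ennreal (LINT z:carleson_box I|dA. (cmod (?b z - m))\<^sup>2)
        \<le> (\<integral>\<^sup>+z. ennreal (indicat_real (carleson_box I) z *\<^sub>R (cmod (?b z - m))\<^sup>2) \<partial>dA)"
        unfolding set_lebesgue_integral_def
      proof (subst integral_eq_nn_integral)
        have "ennreal (enn2real x) \<le> x" for x by (cases x rule: ennreal_cases) auto
        then show "ennreal (enn2real (\<integral>\<^sup>+z. ennreal (indicat_real (carleson_box I) z *\<^sub>R (cmod (?b z - m))\<^sup>2) \<partial>dA))
          \<le> (\<integral>\<^sup>+z. ennreal (indicat_real (carleson_box I) z *\<^sub>R (cmod (?b z - m))\<^sup>2) \<partial>dA)" .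
      qed auto
      also have "\<dots> \<le> (\<integral>\<^sup>+z. 2 * ennreal ((cmod (?b z))\<^sup>2)
        + 2 * ennreal ((cmod m)\<^sup>2) * indicator (carleson_box I) z \<partial>dA)"
        using ennreal_sq_triangle[of "?b _" m 0]
          by (intro nn_integral_mono) (auto split: split_indicator)
      also have "\<dots> = 2 * S + 2 * ennreal ((cmod m)\<^sup>2) * ennreal (L\<^sup>2)"
        unfolding S_def by (subst nn_integral_add) (auto simp: nn_integral_cmult nn_integral_cmult_indicator eQ)
      also have "\<dots> = ennreal (2 * s + 2 * (cmod m)\<^sup>2 * L\<^sup>2)" unfolding s(1) using s(2)
        by (simp add: ennreal_mult)
      finally have le: "(LINT z:carleson_box I|dA. (cmod (?b z - m))\<^sup>2)
        \<le> 2 * s + 2 * (cmod m)\<^sup>2 * L\<^sup>2"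
        using s(2) by (subst (asm) ennreal_le_iff) auto
      have "(cmod m)\<^sup>2 \<le> s\<^sup>2"
      proof (rule power_mono)
        have "cmod m * 1 \<le> cmod m * L\<^sup>2" using L1 by (intro mult_left_mono) auto
        then show "cmod m \<le> s" using m by simp
      qed simp
      then have "2 * s + 2 * (cmod m)\<^sup>2 * L\<^sup>2 \<le> 2 * s * L\<^sup>2 + 2 * s\<^sup>2 * L\<^sup>2"
        using L1 s(2) mult_left_mono[of 1 "L\<^sup>2" "2 * s"] by (intro add_mono mult_right_mono) auto
      with le have "(LINT z:carleson_box I|dA. (cmod (?b z - m))\<^sup>2) \<le> (2 * s + 2 * s\<^sup>2) * L\<^sup>2"
        by (simp add: distrib_right)
      then have "(LINT z:carleson_box I|dA. (cmod (?b z - m))\<^sup>2) / L\<^sup>2 \<le> 2 * s + 2 * s\<^sup>2"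
        using L by (simp add: divide_le_eq)
      then show ?thesis unfolding osc by (rule real_sqrt_le_mono)
    qed
  qed
  then have "bdd_above (box_osc ?b ` D)" by (intro bdd_aboveI2)
  then show ?thesis unfolding BMO2_def using S unfolding S_def by simp
qed

lemma small_ball_3i:
  assumes \<alpha>: "\<alpha> > -1" and \<delta>: "\<delta> \<le> 1/4"
  shows "ball (3 * \<i>) \<delta> \<subseteq> uhp" "ball (3 * \<i>) \<delta> \<in> sets dA"
    "emeasure (dA\<^sub>w \<alpha>) (ball (3 * \<i>) \<delta>) < \<infinity>"
proof -
  have sub: "ball (3 * \<i>) \<delta> \<subseteq> carleson_box {-4..<-4+8}"
  proof
    fix w assume "w \<in> ball (3 * \<i>) \<delta>"
    then have "cmod (3 * \<i> - w) < 1/4" using \<delta> by (simp add: dist_norm)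
    then show "w \<in> carleson_box {-4..<-4+8}"
      unfolding mem_carleson_box[OF zero_less_numeral]
      using abs_Im_le_cmod[of "3 * \<i> - w"] abs_Re_le_cmod[of "3 * \<i> - w"] by auto
  qed
  show u: "ball (3 * \<i>) \<delta> \<subseteq> uhp" using sub carleson_box_sub_uhp by (rule order_trans)
  show "ball (3 * \<i>) \<delta> \<in> sets dA" by (intro borel_sets_dA u) auto
  have "emeasure (dA\<^sub>w \<alpha>) (ball (3 * \<i>) \<delta>) \<le> emeasure (dA\<^sub>w \<alpha>) (carleson_box {-4..<-4+8})"
    using sub by (intro emeasure_mono) (simp_all only: sets_dAw carleson_box_sets_dA)
  also have "\<dots> < \<infinity>" unfolding emeasure_dAw_carleson_box_finite_pos(1)[OF \<alpha> zero_less_numeral]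
    by simp
  finally show "emeasure (dA\<^sub>w \<alpha>) (ball (3 * \<i>) \<delta>) < \<infinity>" .
qed

text \<open>For \<open>z\<close> near \<open>\<i>\<close> and \<open>w\<close> near \<open>3 * \<i>\<close> the number \<open>z - cnj w\<close> is near \<open>4 * \<i>\<close>, so by continuity
the kernel differs from a nonzero constant by at most half its modulus, and the integral
cannot cancel.\<close>

lemma bergman_proj_indicator_lower_bound:
  assumes \<alpha>: "\<alpha> > -1"
  obtains \<delta> c where "0 < \<delta>" "\<delta> \<le> 1/4" "0 < c"
    "\<And>z. z \<in> ball \<i> \<delta> \<Longrightarrow> c \<le> cmod (bergman_proj \<alpha> (indicator (ball (3 * \<i>) \<delta>)) z)"
proof -
  define p where "p \<zeta> = 1 / \<zeta> powr complex_of_real (2 + \<alpha>)" for \<zeta> :: complex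
  have p0: "p (4 * \<i>) \<noteq> 0" by (simp add: p_def)
  have "isCont p (4 * \<i>)"
    unfolding p_def by (intro continuous_intros) (auto simp: complex_nonpos_Reals_iff)
  then have "\<exists>d>0. \<forall>\<zeta>. cmod (\<zeta> - 4 * \<i>) < d \<longrightarrow> cmod (p \<zeta> - p (4 * \<i>)) < cmod (p (4 * \<i>)) / 2"
    using p0 unfolding continuous_at_eps_delta dist_norm by (metis half_gt_zero zero_less_norm_iff)
  then obtain d where d: "d > 0" "\<And>\<zeta>. cmod (\<zeta> - 4 * \<i>) < d \<Longrightarrow>
    cmod (p \<zeta> - p (4 * \<i>)) < cmod (p (4 * \<i>)) / 2"
    by blast
  define \<delta> where "\<delta> = min (d / 2) (1/4)"
  have \<delta>: "0 < \<delta>" "\<delta> \<le> d / 2" "\<delta> \<le> 1/4" using d by (auto simp: \<delta>_def)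
  let ?B = "ball (3 * \<i>) \<delta>"
  have Bsub: "?B \<subseteq> uhp" and Bm[measurable]: "?B \<in> sets dA" and Bf: "emeasure (dA\<^sub>w \<alpha>) ?B < \<infinity>"
    by (rule small_ball_3i[OF \<alpha> \<delta>(3)])+
  define A where "A = measure (dA\<^sub>w \<alpha>) ?B"
  have Apos: "A > 0"
  proof -
    have "emeasure dA ?B \<noteq> 0"
    proof -
      have "emeasure dA ?B = emeasure lborel ?B" using Bsub unfolding dA_def
        by (subst emeasure_restrict_space) auto
      moreover have "\<not> negligible ?B" using \<delta>(1) by (intro open_not_negligible) auto
      ultimately show ?thesis by (simp add: negligible_iff_emeasure0)
    qed
    moreover have "emeasure (dA\<^sub>w \<alpha>) ?B = 0 \<longleftrightarrow> emeasure dA ?B = 0"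
    proof -
      have *: "emeasure M ?B = 0 \<longleftrightarrow> (AE z in M. z \<notin> ?B)" if "sets M = sets dA" "space M = uhp" for M
        using that Bsub Bm by (subst AE_iff_measurable[of ?B]) auto
      show ?thesis using AE_dAw_iff[OF \<alpha>] by (simp add: *)
    qed
    ultimately show ?thesis unfolding A_def using Bf
      by (simp add: measure_def enn2real_positive_iff zero_less_iff_neq_zero)
  qed
  have key: "cmod (p (4 * \<i>)) / 2 * A
    \<le> cmod (bergman_proj \<alpha> (indicator ?B) z)" if z: "z \<in> ball \<i> \<delta>" for z
  proof -
    have zu: "z \<in> uhp"
      using z \<delta> abs_Im_le_cmod[of "\<i> - z"] by (auto simp: dist_norm uhp_def)
    have close: "cmod (p (z - cnj w) - p (4 * \<i>)) < cmod (p (4 * \<i>)) / 2" if w: "w \<in> ?B" for w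
    proof (rule d(2))
      have "z - cnj w - 4 * \<i> = (z - \<i>) - cnj (w - 3 * \<i>)" by (simp add: complex_eq_iff)
      then have "cmod (z - cnj w - 4 * \<i>) \<le> cmod (z - \<i>) + cmod (w - 3 * \<i>)"
        by (metis complex_mod_cnj norm_triangle_ineq4)
      then show "cmod (z - cnj w - 4 * \<i>) < d" using z w \<delta>
        by (simp add: dist_norm norm_minus_commute)
    qed
    have "z \<in> space (dA\<^sub>w \<alpha>)" using zu by simp
    from measurable_compose[OF measurable_Pair1'[OF this] measurable_Bergman_kernel[of "complex_of_real (2 + \<alpha>)" \<alpha>]]
    have pm: "(\<lambda>w. p (z - cnj w)) \<in> borel_measurable dA" unfolding p_def by simp
    note [measurable] = this
    have i1: "integrable (dA\<^sub>w \<alpha>) (\<lambda>w. p (4 * \<i>) * indicator ?B w)"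
    proof (rule integrable_mult_right)
      have "integrable (dA\<^sub>w \<alpha>) (\<lambda>w. complex_of_real (indicat_real ?B w))"
        using Bf by (intro integrable_of_real integrable_real_indicator) auto
      then show "integrable (dA\<^sub>w \<alpha>) (indicator ?B :: complex \<Rightarrow> complex)"
        by (simp add: of_real_indicator)
    qed
    have i2: "integrable (dA\<^sub>w \<alpha>) (\<lambda>w. (p (z - cnj w) - p (4 * \<i>)) * indicator ?B w)"
    proof (rule Bochner_Integration.integrable_bound)
      show "integrable (dA\<^sub>w \<alpha>) (\<lambda>w. p (4 * \<i>) * indicator ?B w)" by (rule i1)
      show "(\<lambda>w. (p (z - cnj w) - p (4 * \<i>)) * indicator ?B w) \<in> borel_measurable (dA\<^sub>w \<alpha>)" by simp
      have "cmod ((p (z - cnj w) - p (4 * \<i>)) * indicator ?B w)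
        \<le> cmod (p (4 * \<i>) * indicator ?B w)" for w
      proof (cases "w \<in> ?B")
        case True
        have "cmod (p (z - cnj w) - p (4 * \<i>)) \<le> cmod (p (4 * \<i>))"
          using close[OF True] norm_ge_zero[of "p (z - cnj w) - p (4 * \<i>)"] by linarith
        then show ?thesis by (simp add: indicator_simps(1)[OF True])
      qed simp
      then show "AE w in dA\<^sub>w \<alpha>. cmod ((p (z - cnj w) - p (4 * \<i>)) * indicator ?B w)
        \<le> cmod (p (4 * \<i>) * indicator ?B w)"
        by simp
    qed
    have I1: "(\<integral>w. p (4 * \<i>) * indicator ?B w \<partial>dA\<^sub>w \<alpha>) = p (4 * \<i>) * A"
    proof -
      have "(\<integral>w. complex_of_real (indicat_real ?B w) \<partial>dA\<^sub>w \<alpha>)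
        = complex_of_real (\<integral>w. indicat_real ?B w \<partial>dA\<^sub>w \<alpha>)"
        using Bf by (intro integral_of_real integrable_real_indicator) auto
      also have "(\<integral>w. indicat_real ?B w \<partial>dA\<^sub>w \<alpha>) = A"
        unfolding A_def using Bf by (simp add: Bsub Int_absorb2)
      finally show ?thesis by (simp add: of_real_indicator)
    qed
    have I2: "cmod (\<integral>w. (p (z - cnj w) - p (4 * \<i>)) * indicator ?B w \<partial>dA\<^sub>w \<alpha>)
      \<le> cmod (p (4 * \<i>)) / 2 * A"
    proof -
      have "cmod (\<integral>w. (p (z - cnj w) - p (4 * \<i>)) * indicator ?B w \<partial>dA\<^sub>w \<alpha>)
        \<le> (\<integral>w. cmod ((p (z - cnj w) - p (4 * \<i>)) * indicator ?B w) \<partial>dA\<^sub>w \<alpha>)"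
        by (rule integral_norm_bound)
      also have "\<dots> \<le> (\<integral>w. cmod (p (4 * \<i>)) / 2 * indicator ?B w \<partial>dA\<^sub>w \<alpha>)"
      proof (rule integral_mono)
        show "integrable (dA\<^sub>w \<alpha>) (\<lambda>w. cmod (p (4 * \<i>)) / 2 * indicator ?B w)"
          using Bf by (intro integrable_mult_right integrable_real_indicator) auto
        fix w show "cmod ((p (z - cnj w) - p (4 * \<i>)) * indicator ?B w)
          \<le> cmod (p (4 * \<i>)) / 2 * indicator ?B w"
          using close[of w] by (auto simp: norm_mult split: split_indicator)
      qed (rule integrable_norm[OF i2])
      also have "\<dots> = cmod (p (4 * \<i>)) / 2 * A" unfolding A_def using Bf
        by (simp add: Bsub Int_absorb2)
      finally show ?thesis .
    qed
    have "(\<integral>w. indicator ?B w / (z - cnj w) powr complex_of_real (2 + \<alpha>) \<partial>dA\<^sub>w \<alpha>)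
       = (\<integral>w. p (4 * \<i>) * indicator ?B w + (p (z - cnj w) - p (4 * \<i>)) * indicator ?B w \<partial>dA\<^sub>w \<alpha>)"
      by (intro Bochner_Integration.integral_cong) (auto simp: p_def split: split_indicator)
    also have "\<dots> = p (4 * \<i>) * A + (\<integral>w. (p (z - cnj w) - p (4 * \<i>)) * indicator ?B w \<partial>dA\<^sub>w \<alpha>)"
      unfolding Bochner_Integration.integral_add[OF i1 i2] I1 ..
    finally have e: "(\<integral>w. indicator ?B w / (z - cnj w) powr complex_of_real (2 + \<alpha>) \<partial>dA\<^sub>w \<alpha>)
      = p (4 * \<i>) * A + (\<integral>w. (p (z - cnj w) - p (4 * \<i>)) * indicator ?B w \<partial>dA\<^sub>w \<alpha>)" .
    have "cmod (bergman_proj \<alpha> (indicator ?B) z)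
      = cmod (\<integral>w. indicator ?B w / (z - cnj w) powr complex_of_real (2 + \<alpha>) \<partial>dA\<^sub>w \<alpha>)"
      unfolding bergman_proj_def norm_mult cmod_powr_real by simp
    also have "\<dots> \<ge> cmod (p (4 * \<i>) * A) - cmod (p (4 * \<i>)) / 2 * A"
      unfolding e using norm_diff_ineq[of "p (4 * \<i>) * complex_of_real A"] I2 by (smt (verit, best))
    also have "cmod (p (4 * \<i>) * A) - cmod (p (4 * \<i>)) / 2 * A = cmod (p (4 * \<i>)) / 2 * A"
      using Apos by (simp add: norm_mult)
    finally show ?thesis .
  qed
  show thesis
    by (rule that[of \<delta> "cmod (p (4 * \<i>)) / 2 * A"]) (use \<delta> p0 Apos key in auto)
qed

text \<open>The test function is the indicator of a small ball around \<open>3 * \<i>\<close>. It is supported off the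
stairs, so the second term of the commutator vanishes.\<close>

proposition commutator_unbounded_without_APR:
  assumes \<alpha>: "\<alpha> > -1" and D: "halving_family D"
  shows "\<exists>\<sigma> \<in> B2 D \<alpha> - APR. \<exists>b \<in> BMO2 D. \<not> (\<exists>T. bounded_extension \<alpha> \<sigma> (commutator b \<alpha>) T)"
proof -
  obtain \<delta> c where \<delta>: "0 < \<delta>" "\<delta> \<le> 1/4" and c: "0 < c"
    "\<And>z. z \<in> ball \<i> \<delta> \<Longrightarrow> c \<le> cmod (bergman_proj \<alpha> (indicator (ball (3 * \<i>) \<delta>)) z)"
    using bergman_proj_indicator_lower_bound[OF \<alpha>] by metis
  \<comment> \<open>The stairs fit into the square of side \<open>r\<close> at \<open>\<i>\<close>, hence into the ball of radius \<open>\<delta>\<close>.\<close>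
  define r where "r = \<delta> / 2"
  have r: "0 < r" "r \<le> 1/8" using \<delta> by (auto simp: r_def)
  define f :: "complex \<Rightarrow> complex" where "f = indicator (ball (3 * \<i>) \<delta>)"
  let ?\<sigma> = "stair_weight r" and ?b = "stair_symbol r"
  have Bim: "11/4 \<le> Im w" if "w \<in> cball (3 * \<i>) \<delta>" for w
    using that \<delta> abs_Im_le_cmod[of "3 * \<i> - w"] by (auto simp: dist_norm)
  have stairs_ball: "z \<in> ball \<i> \<delta>" if "z \<in> stairs r" for z
  proof -
    have "cmod (z - \<i>) \<le> \<bar>Re (z - \<i>)\<bar> + \<bar>Im (z - \<i>)\<bar>" by (rule cmod_le)
    also have "\<dots> < r + r" using stairs_bounds[OF r(1) that] by simp
    finally show ?thesis by (simp add: r_def dist_norm norm_minus_commute)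
  qed
  have disj: "w \<notin> stairs r" if "w \<in> ball (3 * \<i>) \<delta>" for w
    using Bim[of w] that stairs_bounds(4)[OF r(1), of w] r(2) by auto
  have Bsub: "ball (3 * \<i>) \<delta> \<subseteq> uhp" "cball (3 * \<i>) \<delta> \<subseteq> uhp"
    using Bim by (auto simp: uhp_def intro: less_le_trans[of 0 "11/4"])
  have Bm[measurable]: "ball (3 * \<i>) \<delta> \<in> sets dA" by (intro borel_sets_dA Bsub) auto
  have fm[measurable]: "f \<in> borel_measurable dA" unfolding f_def by measurable
  have fc: "f \<in> bdd_cpt_supp"
    unfolding bdd_cpt_supp_def
  proof (intro CollectI conjI)
    show "\<exists>M. \<forall>z\<in>uhp. cmod (f z) \<le> M"
      by (intro exI[of _ 1]) (auto simp: f_def split: split_indicator)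
    show "\<exists>K. compact K \<and> K \<subseteq> uhp \<and> (\<forall>z\<in>uhp - K. f z = 0)"
      using Bsub by (intro exI[of _ "cball (3 * \<i>) \<delta>"]) (auto simp: f_def split: split_indicator)
  qed (rule fm)
  have fL: "f \<in> L2w \<alpha> ?\<sigma>"
  proof -
    have "(\<integral>\<^sup>+z. ennreal ((cmod (f z))\<^sup>2 * ?\<sigma> z) \<partial>dA\<^sub>w \<alpha>)
      = (\<integral>\<^sup>+z. indicator (ball (3 * \<i>) \<delta>) z \<partial>dA\<^sub>w \<alpha>)"
      using disj by (intro nn_integral_cong) (auto simp: f_def stair_weight_def split: split_indicator)
    also have "\<dots> = emeasure (dA\<^sub>w \<alpha>) (ball (3 * \<i>) \<delta>)" by (rule nn_integral_indicator) simp
    also have "\<dots> < \<infinity>" by (rule small_ball_3i(3)[OF \<alpha> \<delta>(2)])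
    finally show ?thesis unfolding L2w_def by simp
  qed
  have "\<not> (\<exists>T. bounded_extension \<alpha> ?\<sigma> (commutator ?b \<alpha>) T)"
  proof
    assume "\<exists>T. bounded_extension \<alpha> ?\<sigma> (commutator ?b \<alpha>) T"
    then obtain T where T: "bounded_extension \<alpha> ?\<sigma> (commutator ?b \<alpha>) T" ..
    then have TL: "T f \<in> L2w \<alpha> ?\<sigma>" and Te: "AE z in dA. T f z = commutator ?b \<alpha> f z"
      using fL fc unfolding bounded_extension_def bounded_op_on_L2w_def by auto
    have bf: "(\<lambda>w. ?b w * f w) = (\<lambda>w. 0)"
      using disj by (auto simp: f_def stair_symbol_def split: split_indicator)
    have comm: "commutator ?b \<alpha> f z = ?b z * bergman_proj \<alpha> f z" for z
      unfolding commutator_def bf by (simp add: bergman_proj_def)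
    obtain c1 where c1: "0 < c1" "\<And>z. z \<in> stairs r \<Longrightarrow> c1 \<le> density_w \<alpha> z"
      using density_w_stairs[OF \<alpha> r] by metis
    have Sm[measurable]: "stairs r \<in> sets dA" by (intro borel_sets_dA stairs_borel stairs_sub_uhp r)
    have [measurable]: "(\<lambda>z. ennreal ((r / Re z)\<^sup>2)) \<in> borel_measurable dA"
      by (rule borel_measurable_dA) measurable
    have "\<infinity> = ennreal (c1 * c\<^sup>2) * (\<integral>\<^sup>+z\<in>stairs r. ennreal ((r / Re z)\<^sup>2) \<partial>dA)"
      unfolding stairs_integral_sq_infinite[OF r(1)] using c1 c by (simp add: ennreal_mult_top)
    also have "\<dots> = (\<integral>\<^sup>+z. ennreal (c1 * c\<^sup>2)
      * (ennreal ((r / Re z)\<^sup>2) * indicator (stairs r) z) \<partial>dA)"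
      by (rule nn_integral_cmult[symmetric]) measurable
    also have "\<dots> \<le> (\<integral>\<^sup>+z. ennreal (density_w \<alpha> z) * ennreal ((cmod (T f z))\<^sup>2 * ?\<sigma> z) \<partial>dA)"
    proof (rule nn_integral_mono_AE, use Te in eventually_elim)
      case (elim z)
      show ?case
      proof (cases "z \<in> stairs r")
        case True
        have x: "r / Re z \<ge> 0" using stairs_bounds(1)[OF r(1) True] r by simp
        have "c \<le> cmod (bergman_proj \<alpha> f z)" unfolding f_def by (rule c(2)[OF stairs_ball[OF True]])
        then have "c\<^sup>2 \<le> (cmod (bergman_proj \<alpha> f z))\<^sup>2" using c(1) by (intro power_mono) auto
        then have "c\<^sup>2 * (r / Re z) \<le> (cmod (bergman_proj \<alpha> f z))\<^sup>2 * (r / Re z)"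
          using x by (rule mult_right_mono)
        also have "\<dots> = (cmod (T f z))\<^sup>2"
          unfolding elim comm norm_mult power_mult_distrib using True x
            by (simp add: stair_symbol_def)
        finally have st: "c\<^sup>2 * (r / Re z) * (r / Re z) \<le> (cmod (T f z))\<^sup>2 * ?\<sigma> z"
          unfolding stair_weight_def if_P[OF True] by (rule mult_right_mono[OF _ x])
        have "ennreal c1 * ennreal (c\<^sup>2 * (r / Re z) * (r / Re z))
          \<le> ennreal (density_w \<alpha> z) * ennreal ((cmod (T f z))\<^sup>2 * ?\<sigma> z)"
          by (rule mult_mono[OF ennreal_leI[OF c1(2)[OF True]] ennreal_leI[OF st]]) simp_all
        moreover have "ennreal c1 * ennreal (c\<^sup>2 * (r / Re z) * (r / Re z))
          = ennreal (c1 * c\<^sup>2) * ennreal ((r / Re z)\<^sup>2)"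
        proof -
          have "ennreal c1 * ennreal (c\<^sup>2 * (r / Re z) * (r / Re z))
            = ennreal (c1 * (c\<^sup>2 * (r / Re z) * (r / Re z)))"
            using c1(1) by (intro ennreal_mult[symmetric] mult_nonneg_nonneg zero_le_power2 x) auto
          also have "c1 * (c\<^sup>2 * (r / Re z) * (r / Re z)) = (c1 * c\<^sup>2) * (r / Re z)\<^sup>2"
            by (simp add: power2_eq_square)
          also have "ennreal \<dots> = ennreal (c1 * c\<^sup>2) * ennreal ((r / Re z)\<^sup>2)"
            using c1(1) by (intro ennreal_mult) auto
          finally show ?thesis .
        qed
        ultimately show ?thesis using True by simp
      qed simp
    qed
    also have "\<dots> = (\<integral>\<^sup>+z. ennreal ((cmod (T f z))\<^sup>2 * ?\<sigma> z) \<partial>dA\<^sub>w \<alpha>)"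
    proof -
      have [measurable]: "T f \<in> borel_measurable dA" using TL by (simp add: L2w_def)
      show ?thesis by (rule nn_integral_dAw[symmetric]) measurable
    qed
    also have "\<dots> < \<infinity>" using TL by (simp add: L2w_def)
    finally show False by simp
  qed
  then show ?thesis
    using stair_weight_B2[OF \<alpha> r D] stair_weight_not_APR[OF r] stair_symbol_BMO2[OF r D] by blast
qed

section \<open>The weighted commutator bound and its sharpness\<close>

theorem theorem1p12:
  fixes \<alpha> :: real and D1 D2 :: "real set set"
  assumes "\<alpha> > -1"
    and "adjacent_dyadic_systems D1 D2"
  shows "(\<forall>\<sigma> \<in> B2 (D1 \<union> D2) \<alpha> \<inter> APR. \<exists>K>0. \<forall>b \<in> BMO2 (D1 \<union> D2).
            \<exists>T. bounded_extension \<alpha> \<sigma> (commutator b \<alpha>) T \<and>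
                L2w_opnorm \<alpha> \<sigma> T \<le> K * BMO2_norm (D1 \<union> D2) b)
       \<and> (\<exists>\<sigma> \<in> B2 (D1 \<union> D2) \<alpha> - APR. \<exists>b \<in> BMO2 (D1 \<union> D2).
            \<not> (\<exists>T. bounded_extension \<alpha> \<sigma> (commutator b \<alpha>) T))"
proof
  have D: "halving_family (D1 \<union> D2)"
    using assms(2) unfolding adjacent_dyadic_systems_def
    by (intro halving_family_Un dyadic_system_halving) auto
  show "\<forall>\<sigma> \<in> B2 (D1 \<union> D2) \<alpha> \<inter> APR. \<exists>K>0. \<forall>b \<in> BMO2 (D1 \<union> D2).
            \<exists>T. bounded_extension \<alpha> \<sigma> (commutator b \<alpha>) T \<and>
                L2w_opnorm \<alpha> \<sigma> T \<le> K * BMO2_norm (D1 \<union> D2) b"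
    using commutator_bounded[OF assms] by blast
  show "\<exists>\<sigma> \<in> B2 (D1 \<union> D2) \<alpha> - APR. \<exists>b \<in> BMO2 (D1 \<union> D2).
            \<not> (\<exists>T. bounded_extension \<alpha> \<sigma> (commutator b \<alpha>) T)"
    by (rule commutator_unbounded_without_APR[OF assms(1) D])
qed

end
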